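(* Let the type be $E_6$ or $E_7$. The map $\mathsf{T}(\infty)\rightarrow \mathsf{K}(\infty)\subset \mathsf{B}(\infty)\otimes\bigotimes_{c\in\bar{\mathsf{C}}_\sqcup}\mathsf{B}_c$ which sends the marginally large tableau with reduced set of accumulated box counts $(t_c)_{c\in\bar{\mathsf{C}}_\sqcup}$ to $$b_\infty\otimes\big(\otimes_{c\in\bar{\mathsf{C}}_\sqcup} b(-t_c)\big)$$ is an isomorphism of crystals, where $$\mathsf{K}(\infty)=\{b_\infty\}\otimes\left\{\otimes_c\, b(-s_c)\ \middle|\ \text{(a) } s_c\ge 0 \text{ for every } c\in\bar{\mathsf{C}}_\sqcup;\ \text{(b) } s_{c_1}\le s_{c_2}\text{ for every } c_1,c_2\in\bar{\mathsf{C}}_r\subset\bar{\mathsf{C}}_\sqcup \text{ such that } c_1\leftsquigarrow c_2\right\}.$$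
   Context: **Root systems.** The simple root index set is $I=\{1,\dots,6\}$ for $E_6$ with Dynkin diagram edges $1-2$, $2-3$, $3-4$, $4-5$, $3-6$, and $I=\{1,\dots,7\}$ for $E_7$ with these same edges together with $7-1$. Let $\alpha_i$, $h_i$, $\Lambda_i$ ($i\in I$) be the simple roots, simple coroots and fundamental weights, $\langle h_i,\Lambda_j\rangle=\delta_{ij}$. **Basic crystal.** Let $\mathsf{C}=\mathsf{B}(\Lambda_1)$ for $E_6$ and $\mathsf{C}=\mathsf{B}(\Lambda_7)$ for $E_7$ (crystals of minuscule representations). A node is determined by its weight, and is written by listing the indices $k$ for which $\Lambda_k$ has coefficient $+1$ without bar and the indices $j$ for which $\Lambda_j$ has coefficient $-1$ with bar; e.g. $\bar 3 46$ has weight $-\Lambda_3+\Lambda_4+\Lambda_6$. The nodes are the weights in the Weyl group orbit of $\Lambda_1$ (resp. $\Lambda_7$), and there is an arrow of color $i$ from $c$ to $c'$ iff $\langle h_i,\mathrm{wt}(c)\rangle=1$ and $\mathrm{wt}(c')=\mathrm{wt}(c)-\alpha_i$; then $\tilde f_i c=c'$, $\tilde e_i c'=c$, with $\tilde f_i,\tilde e_i$ zero otherwise; $\varepsilon_i(c)=\max(0,-\langle h_i,\mathrm{wt}(c)\rangle)$, $\varphi_i(c)=\max(0,\langle h_i,\mathrm{wt}(c)\rangle)$. Write $c_2\leftsquigarrow c_1$ if $c_1=c_2$ or there is a directed path from $c_1$ to $c_2$ in $\mathsf{C}$; this is a partial order. **Row graphs.** Let $N=5$ for $E_6$, $N=6$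 for $E_7$. The full sub-graphs $\mathsf{C}_r$ ($1\le r\le N$) of $\mathsf{C}$ have node sets: $\mathsf{C}_N=\mathsf{C}$; for $E_7$ only, $\mathsf{C}_5=\{c\mid \bar57\leftsquigarrow c\leftsquigarrow\bar71\}$; and for both types $\mathsf{C}_4=\{c\mid\bar61\leftsquigarrow c\leftsquigarrow\bar12\}$, $\mathsf{C}_3=\{c\mid\bar42\leftsquigarrow c\leftsquigarrow\bar23\}$, $\mathsf{C}_2=\{c\mid\bar5\bar63\leftsquigarrow c\leftsquigarrow\bar346\}$, $\mathsf{C}_1=\{\bar56,\bar456\}$. Each $\mathsf{C}_r$ has a unique source node and a unique sink node. Let $\bar{\mathsf{C}}_r$ be the set of nodes of $\mathsf{C}_r$ having in-degree exactly $1$ in the graph $\mathsf{C}_r$, with the inherited partial order, and let $\bar{\mathsf{C}}_\sqcup=\bigsqcup_{r=1}^N\bar{\mathsf{C}}_r$ (disjoint union). **Tableaux.** A tableau has $N$ left-justified rows numbered from bottom (row $1$, shortest) to top (row $N$). It is *large* if for each $r$: (1) each box of row $r$ contains a node of $\mathsf{C}_r$; (2) the number of boxes of row $r$ containing the source node of $\mathsf{C}_r$ is greater than the total number of boxes in the row immediately below (this total being $0$ for $r=1$); (3) the set of elements appearing in row $r$ is totally ordered by $\leftsquigarrow$ (lies on one source-to-sink directed path of $\mathsf{C}_r$); (4) read from left to right, the elements of row $r$ follow their order along this path, starting with the source node. It is *marginally large* if moreover in (2) the excess is exactly one for every $r$. $\mathsf{T}(\infty)$ is the set of marginally large tableaux.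 For $c\in\bar{\mathsf{C}}_r$, $t_c$ is the number of boxes in row $r$ containing some $x\in\mathsf{C}_r$ with $x\leftsquigarrow c$; $(t_c)_{c\in\bar{\mathsf{C}}_\sqcup}$ is the reduced set of accumulated box counts. **Tensor product rule.** For $b_k\in B_k$ ($1\le k\le m$) put $a_k=\varepsilon_i(b_k)-\sum_{v<k}\langle h_i,\mathrm{wt}(b_v)\rangle$. Then $\tilde e_i$ acts on the factor $k$ of $b_1\otimes\cdots\otimes b_m$ for which $a_k>a_v$ for $v<k$ and $a_k\ge a_v$ for $v>k$; $\tilde f_i$ acts on the factor $k$ for which $a_k\ge a_v$ for $v<k$ and $a_k>a_v$ for $v>k$. Also $\varepsilon_i(b_1\otimes\cdots\otimes b_m)=\max_k a_k$, weights add, and $\varphi_i=\varepsilon_i+\langle h_i,\mathrm{wt}\rangle$. **Crystal structure on $\mathsf{T}(\infty)$.** Read $T$ as a tensor product of its boxes (elements of $\mathsf{C}$): rows from top to bottom, each row from right to left. Apply $\tilde f_i$ or $\tilde e_i$ by the tensor product rule and put the result back into the same shape (result $0$ gives $0$). If $\tilde f_i$ changed a source-node box in row $r$, the result is not large, and one inserts a column consisting of one source-node box in each of the rows $r,r+1,\dots,N$ to restore marginal largeness. If $\tilde e_i$ changed a box of row $r$ into the source node of $\mathsf{C}_r$, the result is large but not marginally large, and one removes a column consisting of one source-node box in each of the rows $r,\dots,N$. Further $\mathrm{wt}(T)=\sum(\mathrm{wt}(c)-\mathrm{wt}(\text{source node of }\mathsf{C}_r))$, summed over all boxes, with $c$ the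 entry and $r$ the row of the box; $\varepsilon_i(T)=\max\{n\ge0\mid\tilde e_i^nT\ne0\}$; $\varphi_i(T)=\varepsilon_i(T)+\langle h_i,\mathrm{wt}(T)\rangle$. **Crystals $\mathsf{B}_i$.** $\mathsf{B}_i=\{b_i(k)\mid k\in\mathbf{Z}\}$ with $\mathrm{wt}(b_i(k))=k\alpha_i$, $\varphi_i(b_i(k))=k$, $\varepsilon_i(b_i(k))=-k$, $\tilde f_ib_i(k)=b_i(k-1)$, $\tilde e_ib_i(k)=b_i(k+1)$, and for $j\ne i$: $\varphi_i(b_j(k))=\varepsilon_i(b_j(k))=-\infty$, $\tilde f_ib_j(k)=\tilde e_ib_j(k)=0$. $\mathsf{B}(\infty)$ is the crystal base of $U_q^-(\mathfrak g)$, $\mathfrak g$ of the given type, with highest weight element $b_\infty$. **The crystal $\bigotimes_{c\in\bar{\mathsf{C}}_\sqcup}\mathsf{B}_c$.** For a source-to-sink directed path $\mathbf p_r$ in $\mathsf{C}_r$ whose arrows, starting at the source, have colors $i_1,i_2,\dots,i_m$, set $\mathsf{K}_{\mathbf p_r}=\mathsf{B}_{i_m}\otimes\cdots\otimes\mathsf{B}_{i_2}\otimes\mathsf{B}_{i_1}$. Different paths give crystals isomorphic by reordering factors (via the trivial isomorphisms $\mathsf{B}_i\otimes\mathsf{B}_j\cong\mathsf{B}_j\otimes\mathsf{B}_i$ for $i,j$ not adjacent in the Dynkin diagram, along commutative squares of $\mathsf{C}_r$); $\mathsf{K}_r$ denotes this common crystal, and $\bigotimes_{c\in\bar{\mathsf{C}}_\sqcup}\mathsf{B}_c$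 denotes $\mathsf{K}_N\otimes\cdots\otimes\mathsf{K}_2\otimes\mathsf{K}_1$. Factors are indexed as follows: the arrows of $\mathsf{C}_r$ are partitioned into groups (opposite, equally colored arrows of a commutative square are in the same group) so that each source-to-sink path uses exactly one arrow of each group, and each group contains exactly one arrow whose head lies in $\bar{\mathsf{C}}_r$; this head indexes the group. Equivalently, an arrow from $x$ to $x'$ belongs to the group of the unique $d\in\bar{\mathsf{C}}_r$ with $x'\leftsquigarrow d$ but not $x\leftsquigarrow d$. The factor of $\mathsf{K}_{\mathbf p_r}$ coming from the arrow in the group of $c$ is denoted $\mathsf{B}_c$ (it equals $\mathsf{B}_i$, $i$ the color of the unique arrow of $\mathsf{C}_r$ into $c$). $\otimes_c b(-s_c)$ denotes the element whose factor in $\mathsf{B}_c=\mathsf{B}_i$ is $b_i(-s_c)$. The set $\mathsf{K}(\infty)$ carries the crystal structure restricted from $\mathsf{B}(\infty)\otimes\bigotimes_c\mathsf{B}_c$. *)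

theory Defs
  imports
    "HOL-Library.Poly_Mapping"
    "HOL-Library.Extended"
    "HOL-Computational_Algebra.Polynomial"
    "HOL-Computational_Algebra.Fraction_Field"
begin

section \<open>Root data\<close>

datatype etype = E6 | E7

fun index_set :: "etype \<Rightarrow> nat set" where
  "index_set E6 = {1..6}"
| "index_set E7 = {1..7}"

definition dynkin_edges :: "etype \<Rightarrow> nat set set" where
  "dynkin_edges X = {{1,2}, {2,3}, {3,4}, {4,5}, {3,6}} \<union> (if X = E7 then {{7,1}} else {})"

definition cartan :: "etype \<Rightarrow> nat \<Rightarrow> nat \<Rightarrow> int" where
  "cartan X i j = (if i = j then 2 else if {i, j} \<in> dynkin_edges X then -1 else 0)"

text \<open>A weight \<open>\<mu>\<close> is represented by its coordinates \<open>\<mu> i = \<langle>h\<^sub>i, \<mu>\<rangle>\<close> with respect to the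
  fundamental weights; the coordinates outside the index set are 0.\<close>

type_synonym weight = "nat \<Rightarrow> int"

definition simple_root :: "etype \<Rightarrow> nat \<Rightarrow> weight" where
  "simple_root X i = (\<lambda>j. if j \<in> index_set X then cartan X j i else 0)"

definition fundamental_weight :: "nat \<Rightarrow> weight" where
  "fundamental_weight i = (\<lambda>j. if j = i then 1 else 0)"

definition simple_reflection :: "etype \<Rightarrow> nat \<Rightarrow> weight \<Rightarrow> weight" where
  "simple_reflection X i \<mu> = (\<lambda>j. \<mu> j - \<mu> i * simple_root X i j)"

inductive_set weyl_orbit :: "etype \<Rightarrow> weight \<Rightarrow> weight set" for X :: etype and \<mu> :: weight where
  base: "\<mu> \<in> weyl_orbit X \<mu>"
| step: "\<nu> \<in> weyl_orbit X \<mu> \<Longrightarrow> i \<in> index_set X \<Longrightarrow> simple_reflection X i \<nu> \<in> weyl_orbit X \<mu>"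


section \<open>Abstract crystals\<close>

text \<open>\<open>None\<close> plays the role of the element 0, \<open>Minf\<close> that of the value \<open>-\<infinity>\<close>.\<close>

record 'b crystal =
  elts :: "'b set"
  wt :: "'b \<Rightarrow> weight"
  eps :: "nat \<Rightarrow> 'b \<Rightarrow> int extended"
  phi :: "nat \<Rightarrow> 'b \<Rightarrow> int extended"
  et :: "nat \<Rightarrow> 'b \<Rightarrow> 'b option"
  ft :: "nat \<Rightarrow> 'b \<Rightarrow> 'b option"

definition is_crystal :: "etype \<Rightarrow> 'b crystal \<Rightarrow> bool" where
  "is_crystal X B \<longleftrightarrow>
    (\<forall>b\<in>elts B. \<forall>j. j \<notin> index_set X \<longrightarrow> wt B b j = 0) \<and>
    (\<forall>i\<in>index_set X. \<forall>b\<in>elts B.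
      phi B i b = eps B i b + Fin (wt B b i) \<and>
      (\<forall>b'. et B i b = Some b' \<longrightarrow>
        b' \<in> elts B \<and>
        wt B b' = (\<lambda>j. wt B b j + simple_root X i j) \<and>
        eps B i b' = eps B i b + Fin (-1) \<and>
        phi B i b' = phi B i b + Fin 1) \<and>
      (\<forall>b'. ft B i b = Some b' \<longrightarrow>
        b' \<in> elts B \<and>
        wt B b' = (\<lambda>j. wt B b j - simple_root X i j) \<and>
        eps B i b' = eps B i b + Fin 1 \<and>
        phi B i b' = phi B i b + Fin (-1)) \<and>
      (\<forall>b'\<in>elts B. ft B i b = Some b' \<longleftrightarrow> et B i b' = Some b) \<and>
      (phi B i b = Minf \<longrightarrow> et B i b = None \<and> ft B i b = None))"

definition crystal_isomorphism ::
  "etype \<Rightarrow> 'a crystal \<Rightarrow> 'b crystal \<Rightarrow> ('a \<Rightarrow> 'b) \<Rightarrow> bool" where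
  "crystal_isomorphism X A B \<psi> \<longleftrightarrow>
    is_crystal X A \<and> is_crystal X B \<and> bij_betw \<psi> (elts A) (elts B) \<and>
    (\<forall>b\<in>elts A. wt B (\<psi> b) = wt A b) \<and>
    (\<forall>i\<in>index_set X. \<forall>b\<in>elts A.
      eps B i (\<psi> b) = eps A i b \<and>
      phi B i (\<psi> b) = phi A i b \<and>
      et B i (\<psi> b) = map_option \<psi> (et A i b) \<and>
      ft B i (\<psi> b) = map_option \<psi> (ft A i b))"

definition option_iterate :: "('b \<Rightarrow> 'b option) \<Rightarrow> nat \<Rightarrow> 'b \<Rightarrow> 'b option" where
  "option_iterate g n b = ((\<lambda>x. Option.bind x g) ^^ n) (Some b)"

definition max_iterations :: "('b \<Rightarrow> 'b option) \<Rightarrow> 'b \<Rightarrow> nat" where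
  "max_iterations g b = Max {n. option_iterate g n b \<noteq> None}"

text \<open>Transport along an injection \<open>g\<close> with left inverse \<open>h\<close>.  It is used to place crystals with
  different element types into one sum type, so that they can be tensored together.\<close>

definition transport_crystal :: "('a \<Rightarrow> 'b) \<Rightarrow> ('b \<Rightarrow> 'a) \<Rightarrow> 'a crystal \<Rightarrow> 'b crystal" where
  "transport_crystal g h B = \<lparr>
    elts = g ` elts B,
    wt = (\<lambda>x. wt B (h x)),
    eps = (\<lambda>i x. eps B i (h x)),
    phi = (\<lambda>i x. phi B i (h x)),
    et = (\<lambda>i x. map_option g (et B i (h x))),
    ft = (\<lambda>i x. map_option g (ft B i (h x)))\<rparr>"

definition restrict_crystal :: "'b crystal \<Rightarrow> 'b set \<Rightarrow> 'b crystal" where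
  "restrict_crystal B K = B\<lparr>elts := K\<rparr>"


section \<open>Tensor product rule\<close>

text \<open>Factors are numbered from 0, from left to right.\<close>

definition signature_value :: "'b crystal list \<Rightarrow> nat \<Rightarrow> 'b list \<Rightarrow> nat \<Rightarrow> int extended" where
  "signature_value Bs i bs k = eps (Bs ! k) i (bs ! k) + Fin (- (\<Sum>v<k. wt (Bs ! v) (bs ! v) i))"

definition e_position :: "'b crystal list \<Rightarrow> nat \<Rightarrow> 'b list \<Rightarrow> nat" where
  "e_position Bs i bs = (THE k. k < length bs \<and>
    (\<forall>v<k. signature_value Bs i bs v < signature_value Bs i bs k) \<and>
    (\<forall>v<length bs. k < v \<longrightarrow> signature_value Bs i bs v \<le> signature_value Bs i bs k))"

definition f_position :: "'b crystal list \<Rightarrow> nat \<Rightarrow> 'b list \<Rightarrow> nat" where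
  "f_position Bs i bs = (THE k. k < length bs \<and>
    (\<forall>v<k. signature_value Bs i bs v \<le> signature_value Bs i bs k) \<and>
    (\<forall>v<length bs. k < v \<longrightarrow> signature_value Bs i bs v < signature_value Bs i bs k))"

definition tensor_wt :: "'b crystal list \<Rightarrow> 'b list \<Rightarrow> weight" where
  "tensor_wt Bs bs = (\<lambda>j. \<Sum>v<length bs. wt (Bs ! v) (bs ! v) j)"

definition tensor_eps :: "'b crystal list \<Rightarrow> nat \<Rightarrow> 'b list \<Rightarrow> int extended" where
  "tensor_eps Bs i bs = Max (signature_value Bs i bs ` {..<length bs})"

definition tensor :: "'b crystal list \<Rightarrow> 'b list crystal" where
  "tensor Bs = \<lparr>
    elts = {bs. length bs = length Bs \<and> (\<forall>k<length Bs. bs ! k \<in> elts (Bs ! k))},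
    wt = tensor_wt Bs,
    eps = tensor_eps Bs,
    phi = (\<lambda>i bs. tensor_eps Bs i bs + Fin (tensor_wt Bs bs i)),
    et = (\<lambda>i bs. let k = e_position Bs i bs
                  in map_option (\<lambda>b. bs[k := b]) (et (Bs ! k) i (bs ! k))),
    ft = (\<lambda>i bs. let k = f_position Bs i bs
                  in map_option (\<lambda>b. bs[k := b]) (ft (Bs ! k) i (bs ! k)))\<rparr>"


section \<open>The basic crystal\<close>

fun minuscule_weight :: "etype \<Rightarrow> weight" where
  "minuscule_weight E6 = fundamental_weight 1"
| "minuscule_weight E7 = fundamental_weight 7"

definition nodes :: "etype \<Rightarrow> weight set" where
  "nodes X = weyl_orbit X (minuscule_weight X)"

definition arrow :: "etype \<Rightarrow> nat \<Rightarrow> weight \<Rightarrow> weight \<Rightarrow> bool" where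
  "arrow X i c c' \<longleftrightarrow> i \<in> index_set X \<and> c \<in> nodes X \<and> c' \<in> nodes X \<and>
     c i = 1 \<and> c' = (\<lambda>j. c j - simple_root X i j)"

definition basic_crystal :: "etype \<Rightarrow> weight crystal" where
  "basic_crystal X = \<lparr>
    elts = nodes X,
    wt = (\<lambda>c. c),
    eps = (\<lambda>i c. Fin (max 0 (- c i))),
    phi = (\<lambda>i c. Fin (max 0 (c i))),
    et = (\<lambda>i c'. if \<exists>c. arrow X i c c' then Some (THE c. arrow X i c c') else None),
    ft = (\<lambda>i c. if \<exists>c'. arrow X i c c' then Some (THE c'. arrow X i c c') else None)\<rparr>"

text \<open>\<open>below X c\<^sub>2 c\<^sub>1\<close>: there is a (possibly empty) directed path from \<open>c\<^sub>1\<close> to \<open>c\<^sub>2\<close>.  The source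
  is thus the greatest node.\<close>

definition below :: "etype \<Rightarrow> weight \<Rightarrow> weight \<Rightarrow> bool" where
  "below X c2 c1 \<longleftrightarrow> (c1, c2) \<in> {(c, c'). \<exists>i. arrow X i c c'}\<^sup>*"


section \<open>Row graphs\<close>

text \<open>\<open>bar_weight js ks\<close> has coefficient -1 at the (barred) indices \<open>js\<close> and +1 at \<open>ks\<close>.\<close>

definition bar_weight :: "nat list \<Rightarrow> nat list \<Rightarrow> weight" where
  "bar_weight js ks = (\<lambda>i. (\<Sum>k\<leftarrow>ks. fundamental_weight k i) - (\<Sum>j\<leftarrow>js. fundamental_weight j i))"

definition between :: "etype \<Rightarrow> weight \<Rightarrow> weight \<Rightarrow> weight set" where
  "between X lo hi = {c \<in> nodes X. below X lo c \<and> below X c hi}"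

fun nrows :: "etype \<Rightarrow> nat" where
  "nrows E6 = 5"
| "nrows E7 = 6"

definition row_nodes :: "etype \<Rightarrow> nat \<Rightarrow> weight set" where
  "row_nodes X r =
    (if r = nrows X then nodes X
     else if r = 5 \<and> X = E7 then between X (bar_weight [5] [7]) (bar_weight [7] [1])
     else if r = 4 then between X (bar_weight [6] [1]) (bar_weight [1] [2])
     else if r = 3 then between X (bar_weight [4] [2]) (bar_weight [2] [3])
     else if r = 2 then between X (bar_weight [5, 6] [3]) (bar_weight [3] [4, 6])
     else if r = 1 then {bar_weight [5] [6], bar_weight [4] [5, 6]}
     else {})"

definition row_arrow :: "etype \<Rightarrow> nat \<Rightarrow> nat \<Rightarrow> weight \<Rightarrow> weight \<Rightarrow> bool" where
  "row_arrow X r i c c' \<longleftrightarrow> c \<in> row_nodes X r \<and> c' \<in> row_nodes X r \<and> arrow X i c c'"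

definition source :: "etype \<Rightarrow> nat \<Rightarrow> weight" where
  "source X r = (THE c. c \<in> row_nodes X r \<and> \<not> (\<exists>i x. row_arrow X r i x c))"

definition sink :: "etype \<Rightarrow> nat \<Rightarrow> weight" where
  "sink X r = (THE c. c \<in> row_nodes X r \<and> \<not> (\<exists>i x. row_arrow X r i c x))"

definition reduced_nodes :: "etype \<Rightarrow> nat \<Rightarrow> weight set" where
  "reduced_nodes X r = {c \<in> row_nodes X r. card {(i, x). row_arrow X r i x c} = 1}"

definition full_path :: "etype \<Rightarrow> nat \<Rightarrow> weight list \<Rightarrow> bool" where
  "full_path X r p \<longleftrightarrow> p \<noteq> [] \<and> hd p = source X r \<and> last p = sink X r \<and>
     set p \<subseteq> row_nodes X r \<and>
     (\<forall>k. Suc k < length p \<longrightarrow> (\<exists>i. row_arrow X r i (p ! k) (p ! Suc k)))"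


section \<open>Tableaux\<close>

text \<open>\<open>T r\<close> is the list of entries of row \<open>r\<close>, from left to right.  Since row 0 is empty,
  the condition on the row immediately below also covers \<open>r = 1\<close>.\<close>

type_synonym tableau = "nat \<Rightarrow> weight list"

definition large :: "etype \<Rightarrow> tableau \<Rightarrow> bool" where
  "large X T \<longleftrightarrow>
    (\<forall>r. r \<notin> {1..nrows X} \<longrightarrow> T r = []) \<and>
    (\<forall>r\<in>{1..nrows X}.
      set (T r) \<subseteq> row_nodes X r \<and>
      count_list (T r) (source X r) > length (T (r - 1)) \<and>
      (\<forall>x\<in>set (T r). \<forall>y\<in>set (T r). below X x y \<or> below X y x) \<and>
      sorted_wrt (\<lambda>x y. below X y x) (T r) \<and>
      hd (T r) = source X r)"

definition marginally_large :: "etype \<Rightarrow> tableau \<Rightarrow> bool" where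
  "marginally_large X T \<longleftrightarrow> large X T \<and>
    (\<forall>r\<in>{1..nrows X}. count_list (T r) (source X r) = length (T (r - 1)) + 1)"

definition box_count :: "etype \<Rightarrow> tableau \<Rightarrow> nat \<Rightarrow> weight \<Rightarrow> nat" where
  "box_count X T r c = length (filter (\<lambda>x. x \<in> row_nodes X r \<and> below X x c) (T r))"

text \<open>Reading order: rows from top to bottom, each row from right to left.  A position is
  a pair (row, column) with columns counted from 0.\<close>

definition reading_positions :: "etype \<Rightarrow> tableau \<Rightarrow> (nat \<times> nat) list" where
  "reading_positions X T =
    concat (map (\<lambda>r. map (Pair r) (rev [0..<length (T r)])) (rev [1..<Suc (nrows X)]))"

definition reading_word :: "etype \<Rightarrow> tableau \<Rightarrow> weight list" where
  "reading_word X T = map (\<lambda>(r, k). T r ! k) (reading_positions X T)"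

definition reading_factors :: "etype \<Rightarrow> tableau \<Rightarrow> weight crystal list" where
  "reading_factors X T = replicate (length (reading_word X T)) (basic_crystal X)"

definition put_box :: "tableau \<Rightarrow> nat \<Rightarrow> nat \<Rightarrow> weight \<Rightarrow> tableau" where
  "put_box T r k c = T(r := (T r)[k := c])"

definition insert_column :: "etype \<Rightarrow> nat \<Rightarrow> tableau \<Rightarrow> tableau" where
  "insert_column X r T = (\<lambda>r'. if r' \<in> {r..nrows X} then source X r' # T r' else T r')"

definition remove_column :: "etype \<Rightarrow> nat \<Rightarrow> tableau \<Rightarrow> tableau" where
  "remove_column X r T = (\<lambda>r'. if r' \<in> {r..nrows X} then remove1 (source X r') (T r') else T r')"

definition tableau_f :: "etype \<Rightarrow> nat \<Rightarrow> tableau \<Rightarrow> tableau option" where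
  "tableau_f X i T =
    (let m = f_position (reading_factors X T) i (reading_word X T);
         (r, k) = reading_positions X T ! m
     in map_option
          (\<lambda>c. if T r ! k = source X r then insert_column X r (put_box T r k c)
               else put_box T r k c)
          (ft (basic_crystal X) i (T r ! k)))"

definition tableau_e :: "etype \<Rightarrow> nat \<Rightarrow> tableau \<Rightarrow> tableau option" where
  "tableau_e X i T =
    (let m = e_position (reading_factors X T) i (reading_word X T);
         (r, k) = reading_positions X T ! m
     in map_option
          (\<lambda>c. if c = source X r then remove_column X r (put_box T r k c)
               else put_box T r k c)
          (et (basic_crystal X) i (T r ! k)))"

definition tableau_wt :: "etype \<Rightarrow> tableau \<Rightarrow> weight" where
  "tableau_wt X T = (\<lambda>j. \<Sum>r=1..nrows X. \<Sum>c\<leftarrow>T r. c j - source X r j)"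

definition tableau_eps :: "etype \<Rightarrow> nat \<Rightarrow> tableau \<Rightarrow> int" where
  "tableau_eps X i T = int (max_iterations (tableau_e X i) T)"

definition T_infinity :: "etype \<Rightarrow> tableau crystal" where
  "T_infinity X = \<lparr>
    elts = {T. marginally_large X T},
    wt = tableau_wt X,
    eps = (\<lambda>i T. Fin (tableau_eps X i T)),
    phi = (\<lambda>i T. Fin (tableau_eps X i T + tableau_wt X T i)),
    et = tableau_e X,
    ft = tableau_f X\<rparr>"


section \<open>The crystal base of the negative half of the quantum group\<close>

subsection \<open>The algebra\<close>

text \<open>The free associative algebra over \<open>\<rat>(q)\<close> is the monoid algebra of the free monoid of words,
  so lists are made into a monoid under concatenation.\<close>

instantiation list :: (type) monoid_add
begin
definition zero_list :: "'a list" where "zero_list = []"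
definition plus_list :: "'a list \<Rightarrow> 'a list \<Rightarrow> 'a list" where "plus_list = (@)"
instance by standard (simp_all add: zero_list_def plus_list_def)
end

type_synonym qfield = "rat poly fract"
type_synonym free_alg = "nat list \<Rightarrow>\<^sub>0 qfield"

definition qq :: qfield where
  "qq = Fract [:0, 1:] 1"

definition qint :: "nat \<Rightarrow> qfield" where
  "qint n = (qq ^ n - inverse qq ^ n) / (qq - inverse qq)"

definition qfact :: "nat \<Rightarrow> qfield" where
  "qfact n = (\<Prod>k=1..n. qint k)"

definition scal :: "qfield \<Rightarrow> free_alg" where
  "scal a = Poly_Mapping.single [] a"

definition gen :: "nat \<Rightarrow> free_alg" where
  "gen i = Poly_Mapping.single [i] 1"

definition divided_power :: "nat \<Rightarrow> nat \<Rightarrow> free_alg" where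
  "divided_power i n = scal (inverse (qfact n)) * gen i ^ n"

definition words_alg :: "etype \<Rightarrow> free_alg set" where
  "words_alg X = {u. Poly_Mapping.keys u \<subseteq> lists (index_set X)}"

definition serre :: "etype \<Rightarrow> nat \<Rightarrow> nat \<Rightarrow> free_alg" where
  "serre X i j = (\<Sum>k\<le>nat (1 - cartan X i j).
     (-1) ^ k * divided_power i k * gen j * divided_power i (nat (1 - cartan X i j) - k))"

inductive_set serre_ideal :: "etype \<Rightarrow> free_alg set" for X :: etype where
  zero: "0 \<in> serre_ideal X"
| add: "x \<in> serre_ideal X \<Longrightarrow> i \<in> index_set X \<Longrightarrow> j \<in> index_set X \<Longrightarrow> i \<noteq> j \<Longrightarrow>
        u \<in> words_alg X \<Longrightarrow> v \<in> words_alg X \<Longrightarrow> x + u * serre X i j * v \<in> serre_ideal X"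

text \<open>\<open>U\<^sub>q\<^sup>-\<close> is \<open>words_alg X\<close> modulo \<open>serre_ideal X\<close>.  Below, its elements are handled through
  representatives in \<open>words_alg X\<close>, equality being congruence modulo \<open>serre_ideal X\<close>.\<close>

subsection \<open>Kashiwara operators\<close>

text \<open>Kashiwara's q-derivation \<open>e'\<^sub>i\<close>, with \<open>e'\<^sub>i 1 = 0\<close> and
  \<open>e'\<^sub>i f\<^sub>j = q\<^bsup>-a i j\<^esup> f\<^sub>j e'\<^sub>i + \<delta> i j\<close> (the type is simply laced, so \<open>q\<^sub>i = q\<close>).\<close>

primrec qder_word :: "etype \<Rightarrow> nat \<Rightarrow> nat list \<Rightarrow> free_alg" where
  "qder_word X i [] = 0"
| "qder_word X i (j # w) =
     (if i = j then Poly_Mapping.single w 1 else 0) +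
     scal (qq powi (- cartan X i j)) * gen j * qder_word X i w"

definition qder :: "etype \<Rightarrow> nat \<Rightarrow> free_alg \<Rightarrow> free_alg" where
  "qder X i u = (\<Sum>w\<in>Poly_Mapping.keys u. scal (Poly_Mapping.lookup u w) * qder_word X i w)"

text \<open>The decomposition of \<open>u\<close> as the sum of \<open>f\<^sub>i\<^bsup>(n)\<^esup> u\<^sub>n\<close> with \<open>e'\<^sub>i u\<^sub>n = 0\<close>; it exists and is
  unique in \<open>U\<^sub>q\<^sup>-\<close> (up to trailing zeros).\<close>

definition string_decomposition :: "etype \<Rightarrow> nat \<Rightarrow> free_alg \<Rightarrow> free_alg list \<Rightarrow> bool" where
  "string_decomposition X i u us \<longleftrightarrow>
    u \<in> words_alg X \<and> set us \<subseteq> words_alg X \<and>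
    (\<forall>v\<in>set us. qder X i v \<in> serre_ideal X) \<and>
    u - (\<Sum>n<length us. divided_power i n * us ! n) \<in> serre_ideal X"

definition kashiwara_e :: "etype \<Rightarrow> nat \<Rightarrow> free_alg \<Rightarrow> free_alg \<Rightarrow> bool" where
  "kashiwara_e X i u v \<longleftrightarrow> v \<in> words_alg X \<and>
    (\<exists>us. string_decomposition X i u us \<and>
      v - (\<Sum>n=1..<length us. divided_power i (n - 1) * us ! n) \<in> serre_ideal X)"

definition kashiwara_f :: "etype \<Rightarrow> nat \<Rightarrow> free_alg \<Rightarrow> free_alg \<Rightarrow> bool" where
  "kashiwara_f X i u v \<longleftrightarrow> v \<in> words_alg X \<and>
    (\<exists>us. string_decomposition X i u us \<and>
      v - (\<Sum>n<length us. divided_power i (n + 1) * us ! n) \<in> serre_ideal X)"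

subsection \<open>Crystal lattice and crystal base\<close>

text \<open>All representatives of the elements \<open>f\<^sub>i\<^sub>1 \<dots> f\<^sub>i\<^sub>l 1\<close> (Kashiwara operators).\<close>

inductive_set kashiwara_monomials :: "etype \<Rightarrow> free_alg set" for X :: etype where
  one: "u \<in> words_alg X \<Longrightarrow> u - 1 \<in> serre_ideal X \<Longrightarrow> u \<in> kashiwara_monomials X"
| step: "u \<in> kashiwara_monomials X \<Longrightarrow> i \<in> index_set X \<Longrightarrow> kashiwara_f X i u v \<Longrightarrow>
         v \<in> kashiwara_monomials X"

text \<open>Rational functions regular at \<open>q = 0\<close>.\<close>

definition regular_at_0 :: "qfield set" where
  "regular_at_0 = {Fract a b | a b. poly b 0 \<noteq> 0}"

inductive_set lattice :: "etype \<Rightarrow> free_alg set" for X :: etype where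
  ideal: "x \<in> serre_ideal X \<Longrightarrow> x \<in> lattice X"
| add: "x \<in> lattice X \<Longrightarrow> u \<in> kashiwara_monomials X \<Longrightarrow> a \<in> regular_at_0 \<Longrightarrow>
        x + scal a * u \<in> lattice X"

definition q_lattice :: "etype \<Rightarrow> free_alg set" where
  "q_lattice X = (\<lambda>u. scal qq * u) ` lattice X"

text \<open>Elements of \<open>L(\<infinity>) / q L(\<infinity>)\<close> are cosets; the zero coset is \<open>q_lattice X\<close>.\<close>

definition lattice_class :: "etype \<Rightarrow> free_alg \<Rightarrow> free_alg set" where
  "lattice_class X u = {v \<in> lattice X. v - u \<in> q_lattice X}"

definition B_infinity_elts :: "etype \<Rightarrow> free_alg set set" where
  "B_infinity_elts X = lattice_class X ` kashiwara_monomials X - {q_lattice X}"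

text \<open>The operator induced on \<open>B(\<infinity>) \<union> {0}\<close> by an operator on \<open>L(\<infinity>)\<close> (given by its graph).\<close>

definition induced_on_classes ::
  "etype \<Rightarrow> (free_alg \<Rightarrow> free_alg \<Rightarrow> bool) \<Rightarrow> free_alg set \<Rightarrow> free_alg set option" where
  "induced_on_classes X R b =
    (if \<exists>u\<in>b. \<exists>v\<in>q_lattice X. R u v then None
     else Some (THE c. c \<in> B_infinity_elts X \<and> (\<exists>u\<in>b. \<exists>v\<in>c. R u v)))"

definition word_weight :: "etype \<Rightarrow> nat list \<Rightarrow> weight" where
  "word_weight X w = (\<lambda>j. - (\<Sum>i\<leftarrow>w. simple_root X i j))"

definition class_weight :: "etype \<Rightarrow> free_alg set \<Rightarrow> weight" where
  "class_weight X b = (THE \<mu>. \<exists>u\<in>b. \<forall>w\<in>Poly_Mapping.keys u. word_weight X w = \<mu>)"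

definition B_infinity :: "etype \<Rightarrow> free_alg set crystal" where
  "B_infinity X =
    (let e = (\<lambda>i. induced_on_classes X (kashiwara_e X i));
         \<epsilon> = (\<lambda>i b. int (max_iterations (e i) b))
     in \<lparr>
      elts = B_infinity_elts X,
      wt = class_weight X,
      eps = (\<lambda>i b. Fin (\<epsilon> i b)),
      phi = (\<lambda>i b. Fin (\<epsilon> i b + class_weight X b i)),
      et = e,
      ft = (\<lambda>i. induced_on_classes X (kashiwara_f X i))\<rparr>)"

definition b_infinity :: "etype \<Rightarrow> free_alg set" where
  "b_infinity X = lattice_class X 1"


section \<open>The crystal containing the image\<close>

text \<open>The integer \<open>k\<close> stands for the element \<open>b\<^sub>i(k)\<close>.\<close>

definition elementary_crystal :: "etype \<Rightarrow> nat \<Rightarrow> int crystal" where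
  "elementary_crystal X i = \<lparr>
    elts = UNIV,
    wt = (\<lambda>k j. k * simple_root X i j),
    eps = (\<lambda>j k. if j = i then Fin (- k) else Minf),
    phi = (\<lambda>j k. if j = i then Fin k else Minf),
    et = (\<lambda>j k. if j = i then Some (k + 1) else None),
    ft = (\<lambda>j k. if j = i then Some (k - 1) else None)\<rparr>"

definition arrow_color :: "etype \<Rightarrow> weight \<Rightarrow> weight \<Rightarrow> nat" where
  "arrow_color X x x' = (THE i. arrow X i x x')"

definition arrow_group :: "etype \<Rightarrow> nat \<Rightarrow> weight \<Rightarrow> weight \<Rightarrow> weight" where
  "arrow_group X r x x' = (THE d. d \<in> reduced_nodes X r \<and> below X x' d \<and> \<not> below X x d)"

definition path_arrows :: "weight list \<Rightarrow> (weight \<times> weight) list" where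
  "path_arrows p = zip p (tl p)"

text \<open>A family \<open>p\<close> selects a source-to-sink path \<open>p r\<close> in every row graph.  The factors of
  \<open>K\<^sub>N \<otimes> \<dots> \<otimes> K\<^sub>1\<close>, from left to right, are listed by their rows and arrows; within a row the last
  arrow of the path comes first.\<close>

definition factor_arrows :: "etype \<Rightarrow> (nat \<Rightarrow> weight list) \<Rightarrow> (nat \<times> weight \<times> weight) list" where
  "factor_arrows X p =
    concat (map (\<lambda>r. map (Pair r) (rev (path_arrows (p r)))) (rev [1..<Suc (nrows X)]))"

definition ambient_crystal ::
  "etype \<Rightarrow> (nat \<Rightarrow> weight list) \<Rightarrow> (free_alg set + int) list crystal" where
  "ambient_crystal X p = tensor
    (transport_crystal Inl projl (B_infinity X) #
     map (\<lambda>(r, x, x'). transport_crystal Inr projr (elementary_crystal X (arrow_color X x x')))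
       (factor_arrows X p))"

definition K_element ::
  "etype \<Rightarrow> (nat \<Rightarrow> weight list) \<Rightarrow> (nat \<Rightarrow> weight \<Rightarrow> int) \<Rightarrow> (free_alg set + int) list" where
  "K_element X p s =
    Inl (b_infinity X) #
    map (\<lambda>(r, x, x'). Inr (- s r (arrow_group X r x x'))) (factor_arrows X p)"

definition K_infinity_elts ::
  "etype \<Rightarrow> (nat \<Rightarrow> weight list) \<Rightarrow> (free_alg set + int) list set" where
  "K_infinity_elts X p = {K_element X p s | s.
    (\<forall>r\<in>{1..nrows X}. \<forall>c\<in>reduced_nodes X r. s r c \<ge> 0) \<and>
    (\<forall>r\<in>{1..nrows X}. \<forall>c1\<in>reduced_nodes X r. \<forall>c2\<in>reduced_nodes X r.
       below X c1 c2 \<longrightarrow> s r c1 \<le> s r c2)}"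

definition K_infinity ::
  "etype \<Rightarrow> (nat \<Rightarrow> weight list) \<Rightarrow> (free_alg set + int) list crystal" where
  "K_infinity X p = restrict_crystal (ambient_crystal X p) (K_infinity_elts X p)"

definition tableau_to_K ::
  "etype \<Rightarrow> (nat \<Rightarrow> weight list) \<Rightarrow> tableau \<Rightarrow> (free_alg set + int) list" where
  "tableau_to_K X p T = K_element X p (\<lambda>r c. int (box_count X T r c))"

end

theory Submission
  imports Defs
begin

text \<open>
  Every node of the basic crystal is the highest weight minus a nonnegative combination of simple
  roots, and the path order is the componentwise order of the coefficient vectors (depth vectors).
  Each row graph is a distributive lattice: a node is determined by the set of reduced nodes
  (pivots) above it, an arrow adds one pivot of its own color, and pivots of equal or adjacent
  colors are comparable.  These facts are checked on explicit lists of depth vectors.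

  A row of a marginally large tableau is then the same thing as a monotone nonnegative function \<open>s\<close>
  on its pivots: the box with number \<open>m\<close> from the right contains the node with pivot set
  \<open>{d. m < s d}\<close>.  Fix a color \<open>i\<close> and read the boxes while recording minus the \<open>i\<close>-weight of the
  part already read.  The signature value of the factor \<open>B\<^sub>d\<close> is this height right after the \<open>s d\<close>
  boxes below \<open>d\<close>, and the first and the last maximum of the height are attained at such places:
  next to a box that moves along the arrow of group \<open>d\<close>, all boxes between it and that place have
  \<open>i\<close>-weight of one sign, and rows without the color \<open>i\<close> cannot make up for the drop caused by the
  source boxes of the last row with this color.  Hence both sides change the same count by one.

  Of \<open>B(\<infinity>)\<close> only \<open>b\<^sub>\<infinity>\<close> matters; that it is nonzero and of weight 0 follows from the augmentation
  of the free algebra, which maps the crystal lattice into the functions regular at 0.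
\<close>

section \<open>Depth vectors\<close>

text \<open>In the depth order, where the source is least, the reduced nodes are the
  join-irreducible elements, so describing a node by its pivots is Birkhoff's representation of a
  finite distributive lattice. From top to bottom the rows lose colors: row 4 omits color 1, row 3
  also color 2, row 2 also color 3, and row 1 keeps color 5 only. A maximum of the height must
  therefore be kept away from rows without the color i, and this is where marginal largeness enters:
  the last row with color i has source boxes of i-weight 1, one more of them than there are boxes in
  the next lower row.

  The start of the reading word, at height 0, corresponds to the leftmost tensor factor, whose
  element \<open>b_infinity X\<close> has signature value 0. Some peak is always at least 0, so
  \<open>ft\<close> always acts on a factor to its right, while \<open>et\<close> reaches the
  leftmost factor exactly when all peaks are at most 0, and then gives \<open>None\<close>.

  The crystal axioms are proved for \<open>K_infinity\<close>, where an operator changes a single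
  count and its effect on all peaks is explicit, and are then pulled back to tableaux.\<close>

fun rank :: "etype \<Rightarrow> nat" where
  "rank E6 = 6"
| "rank E7 = 7"

text \<open>The coefficients of the simple roots in the highest weight minus a node; the entry for color \<open>i\<close>
  is at list position \<open>i - 1\<close>, and type \<open>E\<^sub>6\<close> has a seventh entry that is always 0.\<close>

fun depth_vectors :: "etype \<Rightarrow> int list list" where
  "depth_vectors E6 = [
    [0,0,0,0,0,0,0], [1,0,0,0,0,0,0], [1,1,0,0,0,0,0], [1,1,1,0,0,0,0], [1,1,1,1,0,0,0],
    [1,1,1,0,0,1,0], [1,1,1,1,1,0,0], [1,1,1,1,0,1,0], [1,1,1,1,1,1,0], [1,1,2,1,0,1,0],
    [1,1,2,1,1,1,0], [1,2,2,1,0,1,0], [1,2,2,1,1,1,0], [1,1,2,2,1,1,0], [2,2,2,1,0,1,0],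
    [2,2,2,1,1,1,0], [1,2,2,2,1,1,0], [2,2,2,2,1,1,0], [1,2,3,2,1,1,0], [2,2,3,2,1,1,0],
    [1,2,3,2,1,2,0], [2,3,3,2,1,1,0], [2,2,3,2,1,2,0], [2,3,3,2,1,2,0], [2,3,4,2,1,2,0],
    [2,3,4,3,1,2,0], [2,3,4,3,2,2,0]]"
| "depth_vectors E7 = [
    [0,0,0,0,0,0,0], [0,0,0,0,0,0,1], [1,0,0,0,0,0,1], [1,1,0,0,0,0,1], [1,1,1,0,0,0,1],
    [1,1,1,1,0,0,1], [1,1,1,0,0,1,1], [1,1,1,1,1,0,1], [1,1,1,1,0,1,1], [1,1,1,1,1,1,1],
    [1,1,2,1,0,1,1], [1,1,2,1,1,1,1], [1,2,2,1,0,1,1], [1,2,2,1,1,1,1], [1,1,2,2,1,1,1],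
    [2,2,2,1,0,1,1], [2,2,2,1,1,1,1], [1,2,2,2,1,1,1], [2,2,2,1,0,1,2], [2,2,2,2,1,1,1],
    [2,2,2,1,1,1,2], [1,2,3,2,1,1,1], [2,2,3,2,1,1,1], [2,2,2,2,1,1,2], [1,2,3,2,1,2,1],
    [2,3,3,2,1,1,1], [2,2,3,2,1,2,1], [2,2,3,2,1,1,2], [2,3,3,2,1,2,1], [2,3,3,2,1,1,2],
    [2,2,3,2,1,2,2], [2,3,4,2,1,2,1], [2,3,3,2,1,2,2], [3,3,3,2,1,1,2], [2,3,4,3,1,2,1],
    [2,3,4,2,1,2,2], [3,3,3,2,1,2,2], [2,3,4,3,2,2,1], [2,3,4,3,1,2,2], [3,3,4,2,1,2,2],
    [2,3,4,3,2,2,2], [3,3,4,3,1,2,2], [3,4,4,2,1,2,2], [3,3,4,3,2,2,2], [3,4,4,3,1,2,2],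
    [3,4,4,3,2,2,2], [3,4,5,3,1,2,2], [3,4,5,3,2,2,2], [3,4,5,3,1,3,2], [3,4,5,4,2,2,2],
    [3,4,5,3,2,3,2], [3,4,5,4,2,3,2], [3,4,6,4,2,3,2], [3,5,6,4,2,3,2], [4,5,6,4,2,3,2],
    [4,5,6,4,2,3,3]]"

fun weight_coords :: "etype \<Rightarrow> int list \<Rightarrow> int list" where
  "weight_coords E6 [a,b,c,d,e,f,g] = [1-2*a+b+g, a-2*b+c, b-2*c+d+f, c-2*d+e, d-2*e, c-2*f, 0]"
| "weight_coords E7 [a,b,c,d,e,f,g] = [-2*a+b+g, a-2*b+c, b-2*c+d+f, c-2*d+e, d-2*e, c-2*f, 1-2*g+a]"
| "weight_coords _ _ = []"

definition le_vec :: "int list \<Rightarrow> int list \<Rightarrow> bool" where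
  "le_vec = list_all2 (\<le>)"

definition shift :: "nat \<Rightarrow> int \<Rightarrow> int list \<Rightarrow> int list" where
  "shift i z n = n[i - 1 := n ! (i - 1) + z]"

definition weight_of :: "etype \<Rightarrow> int list \<Rightarrow> weight" where
  "weight_of X n = (\<lambda>j. if j \<in> index_set X then weight_coords X n ! (j - 1) else 0)"

text \<open>From row 5 downwards, each source lies one arrow further along the colors 1, 2, 3, 4. In
  type \<open>E7\<close> rows 1 to 5 come after one arrow of color 7, hence the last entry 1 at both
  ends of the interval. The colors of a row are the coordinates in which its two ends
  differ.\<close>

definition top_vector :: "etype \<Rightarrow> nat \<Rightarrow> int list" where
  "top_vector X r =
    (if r = 6 then [0,0,0,0,0,0,0]
     else [[1,1,1,1,0,0], [1,1,1,0,0,0], [1,1,0,0,0,0], [1,0,0,0,0,0], [0,0,0,0,0,0]] ! (r - 1)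
       @ [case X of E6 \<Rightarrow> 0 | E7 \<Rightarrow> 1])"

definition bottom_vector :: "etype \<Rightarrow> nat \<Rightarrow> int list" where
  "bottom_vector X r =
    (if r = 6 then [4,5,6,4,2,3,3]
     else [[1,1,1,1,1,0], [1,1,1,1,1,1], [1,1,2,2,1,1], [1,2,3,2,1,2], [2,3,4,3,2,2]] ! (r - 1)
       @ [case X of E6 \<Rightarrow> 0 | E7 \<Rightarrow> 1])"

definition row_vectors :: "etype \<Rightarrow> nat \<Rightarrow> int list list" where
  "row_vectors X r =
    filter (\<lambda>n. le_vec (top_vector X r) n \<and> le_vec n (bottom_vector X r)) (depth_vectors X)"

definition colors :: "etype \<Rightarrow> nat list" where
  "colors X = [1..<Suc (rank X)]"

text \<open>The value -1 yields an incoming arrow of the whole crystal; the comparison with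
  \<open>top_vector\<close> keeps the start of this arrow inside the row.\<close>

definition in_colors :: "etype \<Rightarrow> nat \<Rightarrow> int list \<Rightarrow> nat list" where
  "in_colors X r n =
    filter (\<lambda>i. weight_coords X n ! (i - 1) = -1 \<and> top_vector X r ! (i - 1) < n ! (i - 1)) (colors X)"

definition out_colors :: "etype \<Rightarrow> nat \<Rightarrow> int list \<Rightarrow> nat list" where
  "out_colors X r n =
    filter (\<lambda>i. weight_coords X n ! (i - 1) = 1 \<and> n ! (i - 1) < bottom_vector X r ! (i - 1)) (colors X)"

definition pivots :: "etype \<Rightarrow> nat \<Rightarrow> (int list \<times> nat) list" where
  "pivots X r =
    map (\<lambda>n. (n, hd (in_colors X r n)))
      (filter (\<lambda>n. length (in_colors X r n) = 1) (row_vectors X r))"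

definition adjacent_or_equal :: "nat \<Rightarrow> nat \<Rightarrow> bool" where
  "adjacent_or_equal i j \<longleftrightarrow> i = j \<or>
     (i, j) \<in> set [(1,2), (2,1), (2,3), (3,2), (3,4), (4,3), (4,5), (5,4), (3,6), (6,3), (7,1), (1,7)]"

definition all_rows :: "(etype \<times> nat) list" where
  "all_rows = [(E6,1), (E6,2), (E6,3), (E6,4), (E6,5),
     (E7,1), (E7,2), (E7,3), (E7,4), (E7,5), (E7,6)]"

section \<open>Finite checks on the lists of depth vectors\<close>

lemma check_vectors: "list_all (\<lambda>X. list_all (\<lambda>n.
    length n = 7 \<and> list_all (\<lambda>a. 0 \<le> a) n \<and> (X = E6 \<longrightarrow> n ! 6 = 0) \<and>
    list_all (\<lambda>i. weight_coords X n ! (i - 1) = 0 \<or>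
      (weight_coords X n ! (i - 1) = 1 \<and> shift i 1 n \<in> set (depth_vectors X)) \<or>
      (weight_coords X n ! (i - 1) = -1 \<and> shift i (-1) n \<in> set (depth_vectors X))) (colors X) \<and>
    (n = replicate 7 0 \<or> list_ex (\<lambda>i. weight_coords X n ! (i - 1) = -1) (colors X)))
    (depth_vectors X)) [E6, E7]"
  by code_simp

text \<open>A step towards any larger vector is always available; this makes the componentwise order
  coincide with reachability, see \<open>le_vec_below\<close>.\<close>

lemma check_order: "list_all (\<lambda>X. list_all (\<lambda>n. list_all (\<lambda>m.
    n = m \<or> \<not> le_vec n m \<or>
    list_ex (\<lambda>i. n ! (i - 1) < m ! (i - 1) \<and> weight_coords X n ! (i - 1) = 1) (colors X))
    (depth_vectors X)) (depth_vectors X)) [E6, E7]"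
  by code_simp

lemma check_distinct: "list_all (\<lambda>X. distinct (map (weight_coords X) (depth_vectors X)) \<and>
    replicate 7 0 \<in> set (depth_vectors X)) [E6, E7]"
  by code_simp

lemma check_row_bounds: "list_all (\<lambda>(X, r).
    top_vector X r \<in> set (depth_vectors X) \<and> bottom_vector X r \<in> set (depth_vectors X) \<and>
    le_vec (top_vector X r) (bottom_vector X r)) all_rows \<and>
    row_vectors E6 5 = depth_vectors E6 \<and> row_vectors E7 6 = depth_vectors E7 \<and>
    list_all (\<lambda>X. row_vectors X 1 = [top_vector X 1, bottom_vector X 1]) [E6, E7]"
  by code_simp

lemma check_ends: "list_all (\<lambda>(X, r). list_all (\<lambda>n.
    (in_colors X r n = []) = (n = top_vector X r) \<and>
    (out_colors X r n = []) = (n = bottom_vector X r)) (row_vectors X r)) all_rows"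
  by code_simp

text \<open>Each pivot is the least vector of its row whose coordinate at the pivot's own color
  reaches the pivot's value, so a single coordinate decides the comparison.\<close>

lemma check_pivots: "list_all (\<lambda>(X, r). list_all (\<lambda>(d, i). list_all (\<lambda>n.
    le_vec d n = (d ! (i - 1) \<le> n ! (i - 1))) (row_vectors X r)) (pivots X r)) all_rows"
  by code_simp

text \<open>In effect there is one pivot of color i for each value of the i-th coordinate past that
  of the source; this recovers a depth vector from its pivots.\<close>

lemma check_count: "list_all (\<lambda>(X, r). list_all (\<lambda>i. list_all (\<lambda>n.
    length (filter (\<lambda>(d, j). j = i \<and> d ! (i - 1) \<le> n ! (i - 1)) (pivots X r)) =
      nat (n ! (i - 1) - top_vector X r ! (i - 1))) (row_vectors X r)) (colors X)) all_rows"
  by code_simp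

lemma check_closed: "list_all (\<lambda>(X, r). list_all (\<lambda>i.
    top_vector X r ! (i - 1) < bottom_vector X r ! (i - 1) \<longrightarrow> list_all (\<lambda>n.
    (weight_coords X n ! (i - 1) = 1 \<longrightarrow> n ! (i - 1) < bottom_vector X r ! (i - 1)) \<and>
    (weight_coords X n ! (i - 1) = -1 \<longrightarrow> top_vector X r ! (i - 1) < n ! (i - 1)))
    (row_vectors X r)) (colors X)) all_rows"
  by code_simp

lemma check_comparable: "list_all (\<lambda>(X, r). list_all (\<lambda>(d, i). list_all (\<lambda>(e, j).
    adjacent_or_equal i j \<longrightarrow> le_vec d e \<or> le_vec e d) (pivots X r)) (pivots X r)) all_rows"
  by code_simp

text \<open>The last row in reading order in which the color occurs.\<close>

definition color_row :: "etype \<Rightarrow> nat \<Rightarrow> nat" where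
  "color_row X i = [5,4,3,2,1,2,6] ! (i - 1)"

text \<open>The premise \<open>Suc r < color_row X i\<close> spares the row just below the last
  occurrence of the color: its source may have i-weight -1, which \<open>height_drop\<close> makes
  up for by the excess of source boxes.\<close>

lemma check_color_row: "list_all (\<lambda>X. list_all (\<lambda>i.
    1 \<le> color_row X i \<and> color_row X i \<le> nrows X \<and>
    weight_coords X (top_vector X (color_row X i)) ! (i - 1) = 1 \<and>
    list_all (\<lambda>r.
      (color_row X i \<le> r) = (top_vector X r ! (i - 1) < bottom_vector X r ! (i - 1)) \<and>
      (color_row X i < r \<longrightarrow> weight_coords X (top_vector X r) ! (i - 1) = 0) \<and>
      (Suc r < color_row X i \<longrightarrow> 0 \<le> weight_coords X (top_vector X r) ! (i - 1)))
      [1..<Suc (nrows X)]) (colors X)) [E6, E7]"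
  by code_simp

section \<open>Depth vectors as coordinates on the Weyl orbit\<close>

declare depth_vectors.simps [simp del]

lemma set_colors: "set (colors X) = index_set X"
  by (cases X) (auto simp: colors_def)

lemma finite_index_set [simp]: "finite (index_set X)"
  by (cases X) auto

lemma index_set_bounds: "i \<in> index_set X \<Longrightarrow> 1 \<le> i \<and> i \<le> 7"
  by (cases X) auto

lemma in_all_rows: "r \<in> {1..nrows X} \<Longrightarrow> (X, r) \<in> set all_rows"
proof -
  assume "r \<in> {1..nrows X}"
  then have "r = 1 \<or> r = 2 \<or> r = 3 \<or> r = 4 \<or> r = 5 \<or> X = E7 \<and> r = 6"
    by (cases X) auto
  then show ?thesis
    by (cases X) (elim disjE; simp add: all_rows_def)+
qed

lemma cartan_adjacent: "cartan X i j \<noteq> 0 \<Longrightarrow> adjacent_or_equal i j"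
  by (auto simp: cartan_def adjacent_or_equal_def dynkin_edges_def doubleton_eq_iff split: if_splits)

lemma cartan_nonpos: "i \<noteq> j \<Longrightarrow> cartan X i j \<le> 0"
  by (simp add: cartan_def)

lemma cartan_refl [simp]: "cartan X i i = 2"
  by (simp add: cartan_def)

lemma length_7E:
  assumes "length n = 7"
  obtains a b c d e f g where "n = [a, b, c, d, e, f, g]"
  using assms by (auto simp: length_Suc_conv eval_nat_numeral)

lemma index_cases: "i \<in> index_set X \<Longrightarrow>
    i = 1 \<or> i = 2 \<or> i = 3 \<or> i = 4 \<or> i = 5 \<or> i = 6 \<or> X = E7 \<and> i = 7"
  by (cases X) auto

lemma missing_index: "k < 7 \<Longrightarrow> Suc k \<notin> index_set X \<Longrightarrow> X = E6 \<and> k = 6"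
  by (cases X) auto

lemma sum_index_set:
  "sum h (index_set X) = h 1 + h 2 + h 3 + h 4 + h 5 + h 6 + (if X = E7 then h 7 else (0::int))"
proof -
  have "{1..6} = {1, 2, 3, 4, 5, 6::nat}" "{1..7} = {1, 2, 3, 4, 5, 6, 7::nat}" by auto
  then show ?thesis by (cases X) (auto simp del: One_nat_def)
qed

text \<open>The formulas of \<open>weight_coords\<close> are affine in the depth vector, with minus
  the Cartan matrix as linear part.\<close>

lemma weight_of_difference:
  assumes "length n = 7" "length m = 7" "X = E6 \<Longrightarrow> n ! 6 = m ! 6" "j \<in> index_set X"
  shows "weight_of X n j = weight_of X m j - (\<Sum>i\<in>index_set X. (n ! (i - 1) - m ! (i - 1)) * cartan X j i)"
proof -
  obtain a b c d e f g where n: "n = [a, b, c, d, e, f, g]" using length_7E[OF assms(1)] .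
  obtain a' b' c' d' e' f' g' where m: "m = [a', b', c', d', e', f', g']" using length_7E[OF assms(2)] .
  have "X = E6 \<Longrightarrow> g = g'" using assms(3) n m by simp
  then show ?thesis
    using assms(4) index_cases[OF assms(4)] n m unfolding sum_index_set
    by (cases X) (auto simp: weight_of_def cartan_def dynkin_edges_def doubleton_eq_iff)
qed

lemma length_depth_vector: "n \<in> set (depth_vectors X) \<Longrightarrow> length n = 7"
  using check_vectors by (cases X) (auto simp: list_all_iff)

lemma depth_vector_E6: "n \<in> set (depth_vectors X) \<Longrightarrow> X = E6 \<Longrightarrow> n ! 6 = 0"
  using check_vectors by (auto simp: list_all_iff)

lemma depth_vector_nonneg: "n \<in> set (depth_vectors X) \<Longrightarrow> a \<in> set n \<Longrightarrow> 0 \<le> a"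
  using check_vectors by (cases X) (auto simp: list_all_iff)

lemma depth_vector_cases:
  assumes "n \<in> set (depth_vectors X)" "i \<in> index_set X"
  shows "weight_of X n i = 0 \<or>
    weight_of X n i = 1 \<and> shift i 1 n \<in> set (depth_vectors X) \<or>
    weight_of X n i = -1 \<and> shift i (-1) n \<in> set (depth_vectors X)"
  using assms check_vectors
  by (cases X) (simp_all add: list_all_iff weight_of_def flip: set_colors)

lemma depth_vector_ascent:
  assumes "n \<in> set (depth_vectors X)" "n \<noteq> replicate 7 0"
  shows "\<exists>i\<in>index_set X. weight_of X n i = -1"
  using assms check_vectors
  by (cases X) (force simp: list_all_iff list_ex_iff weight_of_def simp flip: set_colors)+

lemma depth_vector_descent:
  assumes "n \<in> set (depth_vectors X)" "m \<in> set (depth_vectors X)" "n \<noteq> m" "le_vec n m"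
  shows "\<exists>i\<in>index_set X. n ! (i - 1) < m ! (i - 1) \<and> weight_of X n i = 1"
  using assms check_order
  by (cases X) (force simp: list_all_iff list_ex_iff weight_of_def simp flip: set_colors)+

lemma zero_depth_vector: "replicate 7 0 \<in> set (depth_vectors X)"
  using check_distinct by (cases X) (auto simp: list_all_iff)

lemma length_weight_coords: "length n = 7 \<Longrightarrow> length (weight_coords X n) = 7"
  by (cases X) (auto elim!: length_7E)

lemma weight_coords_E6: "length n = 7 \<Longrightarrow> weight_coords E6 n ! 6 = 0"
  by (auto elim!: length_7E)

lemma length_shift [simp]: "length (shift i z n) = length n"
  by (simp add: shift_def)

lemma nth_shift:
  assumes "length n = 7" "i \<in> index_set X" "j \<in> index_set X"
  shows "shift i z n ! (j - 1) = n ! (j - 1) + (if i = j then z else 0)"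
  using assms index_set_bounds[of i X] index_set_bounds[of j X]
  by (auto simp: shift_def nth_list_update)

lemma weight_of_shift:
  assumes "length n = 7" "i \<in> index_set X"
  shows "weight_of X (shift i z n) = (\<lambda>j. weight_of X n j - z * simple_root X i j)"
proof
  fix j
  show "weight_of X (shift i z n) j = weight_of X n j - z * simple_root X i j"
  proof (cases "j \<in> index_set X")
    case True
    have "weight_of X (shift i z n) j =
        weight_of X n j - (\<Sum>k\<in>index_set X. (shift i z n ! (k - 1) - n ! (k - 1)) * cartan X j k)"
      using assms True index_cases[OF assms(2)]
      by (intro weight_of_difference) (auto simp: shift_def)
    also have "(\<Sum>k\<in>index_set X. (shift i z n ! (k - 1) - n ! (k - 1)) * cartan X j k) =
        (\<Sum>k\<in>index_set X. if k = i then z * cartan X j k else 0)"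
      using assms by (intro sum.cong refl) (simp add: nth_shift del: One_nat_def)
    also have "\<dots> = z * simple_root X i j"
      using assms True by (simp add: simple_root_def)
    finally show ?thesis .
  qed (simp add: weight_of_def simple_root_def)
qed

lemma sum_list_shift: "length n = 7 \<Longrightarrow> i \<in> index_set X \<Longrightarrow> sum_list (shift i z n) = sum_list n + z"
  by (drule index_cases) (auto elim!: length_7E simp: shift_def)

lemma inj_weight_of: "inj_on (weight_of X) (set (depth_vectors X))"
proof (rule inj_onI)
  fix n m assume n: "n \<in> set (depth_vectors X)" and m: "m \<in> set (depth_vectors X)"
    and eq: "weight_of X n = weight_of X m"
  have "weight_coords X n ! k = weight_coords X m ! k" if "k < 7" for k
  proof (cases "Suc k \<in> index_set X")
    case True
    then show ?thesis using fun_cong[OF eq, of "Suc k"] by (simp add: weight_of_def)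
  next
    case False
    then have "X = E6" "k = 6" using missing_index that by blast+
    then show ?thesis
      using n m by (simp add: weight_coords_E6 length_depth_vector)
  qed
  then have "weight_coords X n = weight_coords X m"
    using n m by (intro nth_equalityI) (simp_all add: length_weight_coords length_depth_vector)
  moreover have "distinct (map (weight_coords X) (depth_vectors X))"
    using check_distinct by (cases X) (auto simp: list_all_iff)
  ultimately show "n = m"
    using n m by (auto simp: distinct_map inj_on_def)
qed

lemma minuscule_weight_eq: "minuscule_weight X = weight_of X (replicate 7 0)"
proof
  fix j
  show "minuscule_weight X j = weight_of X (replicate 7 0) j"
  proof (cases "j \<in> index_set X")
    case True
    then show ?thesis using index_cases[OF True]
      by (cases X) (auto simp: weight_of_def fundamental_weight_def eval_nat_numeral)
  qed (cases X; auto simp: weight_of_def fundamental_weight_def)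
qed

text \<open>A simple reflection shifts the depth vector by the i-weight, which is 0, 1 or -1, and
  the list is closed under these shifts. Conversely, a nonzero vector has a color of weight -1;
  reflecting there lowers the sum of the entries, so the highest weight is reached in finitely many
  steps.\<close>

lemma nodes_eq: "nodes X = weight_of X ` set (depth_vectors X)"
proof
  show "nodes X \<subseteq> weight_of X ` set (depth_vectors X)"
  proof
    fix c assume "c \<in> nodes X"
    then have "c \<in> weyl_orbit X (minuscule_weight X)" by (simp add: nodes_def)
    then show "c \<in> weight_of X ` set (depth_vectors X)"
    proof induction
      case base
      then show ?case using zero_depth_vector by (simp add: minuscule_weight_eq)
    next
      case (step \<nu> i)
      then obtain n where n: "n \<in> set (depth_vectors X)" "\<nu> = weight_of X n" by auto
      have "simple_reflection X i \<nu> = weight_of X (shift i (weight_of X n i) n)"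
        using n step.hyps by (simp add: simple_reflection_def weight_of_shift length_depth_vector)
      moreover have "shift i (weight_of X n i) n \<in> set (depth_vectors X)"
        using depth_vector_cases[OF n(1) step.hyps(2)] n(1) by (auto simp: shift_def)
      ultimately show ?case by auto
    qed
  qed
next
  have "weight_of X n \<in> nodes X" if "n \<in> set (depth_vectors X)" for n
    using that
  proof (induction "nat (sum_list n)" arbitrary: n rule: less_induct)
    case less
    note n = less.prems
    show ?case
    proof (cases "n = replicate 7 0")
      case True
      then show ?thesis
        by (simp add: nodes_def minuscule_weight_eq weyl_orbit.base)
    next
      case False
      then obtain i where i: "i \<in> index_set X" "weight_of X n i = -1"
        using depth_vector_ascent n by blast
      define m where "m = shift i (-1) n"
      have m: "m \<in> set (depth_vectors X)"
        using depth_vector_cases[OF n i(1)] i(2) by (auto simp: m_def)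
      have "sum_list m = sum_list n - 1"
        using i(1) length_depth_vector[OF n] by (simp add: m_def sum_list_shift)
      moreover have "0 \<le> sum_list m"
        using depth_vector_nonneg[OF m] by (intro sum_list_nonneg)
      ultimately have "weight_of X m \<in> nodes X"
        using less.hyps[of m] m by simp
      then have "simple_reflection X i (weight_of X m) \<in> nodes X"
        using i(1) by (auto simp: nodes_def intro: weyl_orbit.step)
      moreover have "weight_of X m = (\<lambda>j. weight_of X n j + simple_root X i j)"
        using n i(1) by (simp add: m_def weight_of_shift length_depth_vector)
      then have "simple_reflection X i (weight_of X m) = weight_of X n"
        using i by (auto simp: simple_reflection_def simple_root_def)
      ultimately show ?thesis by simp
    qed
  qed
  then show "weight_of X ` set (depth_vectors X) \<subseteq> nodes X" by blast
qed

section \<open>Arrows and the path order\<close>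

definition depth :: "etype \<Rightarrow> weight \<Rightarrow> nat \<Rightarrow> int" where
  "depth X c i = the_inv_into (set (depth_vectors X)) (weight_of X) c ! (i - 1)"

lemma depth_weight_of: "n \<in> set (depth_vectors X) \<Longrightarrow> depth X (weight_of X n) i = n ! (i - 1)"
  by (simp add: depth_def the_inv_into_f_f[OF inj_weight_of])

lemma node_cases:
  assumes "c \<in> nodes X"
  obtains n where "n \<in> set (depth_vectors X)" "c = weight_of X n"
  using assms by (auto simp: nodes_eq)

lemma finite_nodes [simp]: "finite (nodes X)"
  by (simp add: nodes_eq)

lemma node_value:
  assumes "c \<in> nodes X"
  shows "c i = 0 \<or> c i = 1 \<or> c i = -1"
proof (cases "i \<in> index_set X")
  case True
  then show ?thesis using assms depth_vector_cases by (elim node_cases) blast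
next
  case False
  then show ?thesis using assms by (elim node_cases) (simp add: weight_of_def)
qed

lemma node_outside: "c \<in> nodes X \<Longrightarrow> i \<notin> index_set X \<Longrightarrow> c i = 0"
  by (elim node_cases) (simp add: weight_of_def)

lemma arrowI:
  assumes "c \<in> nodes X" "i \<in> index_set X" "c i = 1"
  shows "arrow X i c (\<lambda>j. c j - simple_root X i j)"
proof -
  obtain n where n: "n \<in> set (depth_vectors X)" "c = weight_of X n" using assms(1) by (rule node_cases)
  then have "shift i 1 n \<in> set (depth_vectors X)"
    using depth_vector_cases[OF n(1) assms(2)] assms(3) by auto
  then have "weight_of X (shift i 1 n) \<in> nodes X" by (simp add: nodes_eq)
  then show ?thesis
    using assms n by (simp add: arrow_def weight_of_shift length_depth_vector)
qed

lemma arrow_to: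
  assumes "c \<in> nodes X" "i \<in> index_set X" "c i = -1"
  shows "arrow X i (\<lambda>j. c j + simple_root X i j) c"
proof -
  obtain n where n: "n \<in> set (depth_vectors X)" "c = weight_of X n" using assms(1) by (rule node_cases)
  then have "shift i (-1) n \<in> set (depth_vectors X)"
    using depth_vector_cases[OF n(1) assms(2)] assms(3) by auto
  then have "weight_of X (shift i (-1) n) \<in> nodes X" by (simp add: nodes_eq)
  then show ?thesis
    using assms n by (simp add: arrow_def weight_of_shift length_depth_vector simple_root_def)
qed

lemma arrowD:
  assumes "arrow X i c c'"
  shows "i \<in> index_set X" "c \<in> nodes X" "c' \<in> nodes X" "c i = 1" "c' i = -1"
    "c' = (\<lambda>j. c j - simple_root X i j)"
  using assms by (auto simp: arrow_def simple_root_def)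

lemma arrow_vectors:
  assumes "arrow X i c c'"
  obtains n where "n \<in> set (depth_vectors X)" "c = weight_of X n" "shift i 1 n \<in> set (depth_vectors X)"
    "c' = weight_of X (shift i 1 n)"
proof -
  note a = arrowD[OF assms]
  obtain n where n: "n \<in> set (depth_vectors X)" "c = weight_of X n" using a(2) by (rule node_cases)
  moreover have "shift i 1 n \<in> set (depth_vectors X)"
    using depth_vector_cases[OF n(1) a(1)] a(4) n by auto
  moreover have "c' = weight_of X (shift i 1 n)"
    using a(1,6) n by (simp add: weight_of_shift length_depth_vector)
  ultimately show thesis using that by blast
qed

lemma depth_arrow:
  assumes "arrow X i c c'" "j \<in> index_set X"
  shows "depth X c' j = depth X c j + (if i = j then 1 else 0)"
proof -
  obtain n where "n \<in> set (depth_vectors X)" "c = weight_of X n" "shift i 1 n \<in> set (depth_vectors X)"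
    "c' = weight_of X (shift i 1 n)" using assms(1) by (rule arrow_vectors)
  then show ?thesis
    using assms(2) arrowD(1)[OF assms(1)]
    by (simp add: depth_weight_of nth_shift[where X = X] length_depth_vector del: One_nat_def)
qed

text \<open>An arrow of color i lowers the i-coordinate of the weight by 2, while an arrow of
  another color never lowers it.\<close>

lemma arrow_color_unique: "arrow X i c c' \<Longrightarrow> arrow X j c c' \<Longrightarrow> i = j"
proof (rule ccontr)
  assume a: "arrow X i c c'" "arrow X j c c'" "i \<noteq> j"
  then have "c' i = c i - cartan X i j" "c' i = c i - 2" "i \<in> index_set X"
    using arrowD(1,6)[OF a(1)] fun_cong[OF arrowD(6)[OF a(2)], of i] by (auto simp: simple_root_def)
  then show False using cartan_nonpos[OF a(3), of X] by simp
qed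

lemma le_vec_iff:
  assumes "n \<in> set (depth_vectors X)" "m \<in> set (depth_vectors X)"
  shows "le_vec n m \<longleftrightarrow> (\<forall>i\<in>index_set X. n ! (i - 1) \<le> m ! (i - 1))"
proof -
  note [simp] = length_depth_vector[OF assms(1)] length_depth_vector[OF assms(2)]
  have "le_vec n m \<longleftrightarrow> (\<forall>k<7. n ! k \<le> m ! k)"
    by (simp add: le_vec_def list_all2_conv_all_nth)
  also have "\<dots> \<longleftrightarrow> (\<forall>i\<in>index_set X. n ! (i - 1) \<le> m ! (i - 1))"
  proof (intro iffI ballI allI impI)
    fix i assume "\<forall>k<7. n ! k \<le> m ! k" "i \<in> index_set X"
    then show "n ! (i - 1) \<le> m ! (i - 1)" using index_set_bounds[of i X] by auto
  next
    fix k :: nat assume *: "\<forall>i\<in>index_set X. n ! (i - 1) \<le> m ! (i - 1)" "k < 7"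
    show "n ! k \<le> m ! k"
    proof (cases "Suc k \<in> index_set X")
      case True
      then show ?thesis using *(1) by force
    next
      case False
      then have "X = E6" "k = 6" using missing_index *(2) by blast+
      then show ?thesis using depth_vector_E6 assms by simp
    qed
  qed
  finally show ?thesis .
qed

lemma below_refl [simp]: "below X c c"
  by (simp add: below_def)

lemma below_trans: "below X a b \<Longrightarrow> below X b c \<Longrightarrow> below X a c"
  unfolding below_def by (rule rtrancl_trans)

lemma arrow_below: "arrow X i c c' \<Longrightarrow> below X c' c"
  by (auto simp: below_def)

lemma below_depth:
  assumes "below X c' c" "i \<in> index_set X"
  shows "depth X c i \<le> depth X c' i"
  using assms(1) unfolding below_def
proof (induction rule: rtrancl_induct)
  case (step y z)
  then show ?case using depth_arrow assms(2) by fastforce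
qed simp

text \<open>Walk from n towards m: \<open>depth_vector_descent\<close> supplies an arrow raising a
  coordinate that is still smaller than in m, so the new vector stays below m and the difference of
  the sums drops by 1.\<close>

lemma le_vec_below:
  assumes "n \<in> set (depth_vectors X)" "m \<in> set (depth_vectors X)" "le_vec n m"
  shows "below X (weight_of X m) (weight_of X n)"
  using assms
proof (induction "nat (sum_list m - sum_list n)" arbitrary: n rule: less_induct)
  case less
  show ?case
  proof (cases "n = m")
    case False
    then obtain i where i: "i \<in> index_set X" "n ! (i - 1) < m ! (i - 1)" "weight_of X n i = 1"
      using depth_vector_descent less.prems by blast
    define n' where "n' = shift i 1 n"
    have n': "n' \<in> set (depth_vectors X)"
      using depth_vector_cases[OF less.prems(1) i(1)] i(3) by (auto simp: n'_def)
    have le: "le_vec n' m"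
      unfolding le_vec_iff[OF n' less.prems(2)]
    proof
      fix j assume j: "j \<in> index_set X"
      then have "n ! (j - 1) \<le> m ! (j - 1)" using less.prems by (simp add: le_vec_iff)
      then show "n' ! (j - 1) \<le> m ! (j - 1)"
        using i j less.prems(1) by (auto simp: n'_def nth_shift[where X = X] length_depth_vector
            simp del: One_nat_def)
    qed
    have "sum_list n' = sum_list n + 1"
      using i(1) length_depth_vector[OF less.prems(1)] by (simp add: n'_def sum_list_shift)
    moreover have "sum_list n' \<le> sum_list m"
      using le by (metis le_vec_def list_all2_conv_all_nth sum_list_mono2)
    ultimately have "below X (weight_of X m) (weight_of X n')"
      using less.hyps[of n'] n' le less.prems(2) by simp
    moreover have "arrow X i (weight_of X n) (weight_of X n')"
      using arrowI[of "weight_of X n" X i] less.prems(1) i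
      by (simp add: n'_def weight_of_shift length_depth_vector nodes_eq)
    ultimately show ?thesis using arrow_below below_trans by blast
  qed simp
qed

lemma below_iff_depth:
  assumes "c \<in> nodes X" "c' \<in> nodes X"
  shows "below X c' c \<longleftrightarrow> (\<forall>i\<in>index_set X. depth X c i \<le> depth X c' i)"
  using assms below_depth le_vec_below
  by (auto elim!: node_cases simp: depth_weight_of le_vec_iff)

lemma below_antisym:
  assumes "c \<in> nodes X" "c' \<in> nodes X" "below X c c'" "below X c' c"
  shows "c = c'"
proof -
  obtain n where n: "n \<in> set (depth_vectors X)" "c = weight_of X n" using assms(1) by (rule node_cases)
  obtain m where m: "m \<in> set (depth_vectors X)" "c' = weight_of X m" using assms(2) by (rule node_cases)
  have "le_vec n m" "le_vec m n"
    using below_depth[OF assms(3)] below_depth[OF assms(4)] n m by (auto simp: le_vec_iff depth_weight_of)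
  then have "n = m" unfolding le_vec_def by (auto simp: list_all2_conv_all_nth intro!: nth_equalityI order.antisym)
  then show ?thesis using n m by simp
qed

section \<open>Row graphs\<close>

lemma bar_weight_bottom:
  "weight_of X (bottom_vector X 1) = bar_weight [5] [6]"
  "weight_of X (bottom_vector X 2) = bar_weight [5, 6] [3]"
  "weight_of X (bottom_vector X 3) = bar_weight [4] [2]"
  "weight_of X (bottom_vector X 4) = bar_weight [6] [1]"
  "weight_of E7 (bottom_vector E7 5) = bar_weight [5] [7]"
  by (rule ext; cases X;
      auto simp: weight_of_def bottom_vector_def bar_weight_def fundamental_weight_def nth_Cons')+

lemma bar_weight_top:
  "weight_of X (top_vector X 1) = bar_weight [4] [5, 6]"
  "weight_of X (top_vector X 2) = bar_weight [3] [4, 6]"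
  "weight_of X (top_vector X 3) = bar_weight [2] [3]"
  "weight_of X (top_vector X 4) = bar_weight [1] [2]"
  "weight_of E7 (top_vector E7 5) = bar_weight [7] [1]"
  by (rule ext; cases X;
      auto simp: weight_of_def top_vector_def bar_weight_def fundamental_weight_def nth_Cons')+

lemma row_bounds_depth_vectors:
  assumes "r \<in> {1..nrows X}"
  shows "top_vector X r \<in> set (depth_vectors X)" "bottom_vector X r \<in> set (depth_vectors X)"
    "le_vec (top_vector X r) (bottom_vector X r)"
  using check_row_bounds in_all_rows[OF assms] by (auto simp: list_all_iff)

lemma between_eq:
  assumes "r \<in> {1..nrows X}"
  shows "between X (weight_of X (bottom_vector X r)) (weight_of X (top_vector X r)) =
    weight_of X ` set (row_vectors X r)"
proof -
  note b = row_bounds_depth_vectors[OF assms]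
  have "below X (weight_of X n) (weight_of X m) \<longleftrightarrow> le_vec m n"
    if "n \<in> set (depth_vectors X)" "m \<in> set (depth_vectors X)" for n m
    using that by (subst below_iff_depth) (auto simp: nodes_eq depth_weight_of le_vec_iff)
  then show ?thesis
    using b by (auto simp: between_def row_vectors_def nodes_eq)
qed

lemma row_nodes_eq:
  assumes "r \<in> {1..nrows X}"
  shows "row_nodes X r = weight_of X ` set (row_vectors X r)"
proof -
  have *: "row_vectors E6 5 = depth_vectors E6" "row_vectors E7 6 = depth_vectors E7"
    "row_vectors X 1 = [top_vector X 1, bottom_vector X 1]"
    using check_row_bounds by (cases X; simp add: list_all_iff)+
  have "r = 1 \<or> r = 2 \<or> r = 3 \<or> r = 4 \<or> r = 5 \<or> X = E7 \<and> r = 6"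
    using assms by (cases X) auto
  then show ?thesis
    using between_eq[OF assms] *
    by (cases X; elim disjE; simp add: row_nodes_def nodes_eq bar_weight_bottom bar_weight_top insert_commute
        flip: One_nat_def)
qed

lemma weight_of_nth: "i \<in> index_set X \<Longrightarrow> weight_of X n i = weight_coords X n ! (i - 1)"
  by (simp add: weight_of_def)

section \<open>Pivots as coordinates on a row\<close>

definition pivot_color :: "etype \<Rightarrow> nat \<Rightarrow> weight \<Rightarrow> nat" where
  "pivot_color X r d = (THE i. \<exists>x. row_arrow X r i x d)"

definition pivots_above :: "etype \<Rightarrow> nat \<Rightarrow> weight \<Rightarrow> weight set" where
  "pivots_above X r x = {d \<in> reduced_nodes X r. below X x d}"

context
  fixes X :: etype and r :: nat
  assumes r: "r \<in> {1..nrows X}"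
begin

lemma row_vectors_iff:
  "n \<in> set (row_vectors X r) \<longleftrightarrow> n \<in> set (depth_vectors X) \<and>
    (\<forall>i\<in>index_set X. top_vector X r ! (i - 1) \<le> n ! (i - 1) \<and> n ! (i - 1) \<le> bottom_vector X r ! (i - 1))"
  using row_bounds_depth_vectors[OF r] by (auto simp: row_vectors_def le_vec_iff)

lemma row_node_cases:
  assumes "c \<in> row_nodes X r"
  obtains n where "n \<in> set (row_vectors X r)" "n \<in> set (depth_vectors X)" "c = weight_of X n"
  using assms by (auto simp: row_nodes_eq[OF r] row_vectors_def)

lemma row_nodes_subset: "row_nodes X r \<subseteq> nodes X"
  by (auto elim!: row_node_cases simp: nodes_eq)

lemma finite_row_nodes: "finite (row_nodes X r)"
  using row_nodes_subset by (rule finite_subset) simp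

lemma row_nodes_iff:
  "c \<in> row_nodes X r \<longleftrightarrow> c \<in> nodes X \<and>
    (\<forall>i\<in>index_set X. top_vector X r ! (i - 1) \<le> depth X c i \<and> depth X c i \<le> bottom_vector X r ! (i - 1))"
  by (auto elim!: row_node_cases simp: row_vectors_iff depth_weight_of nodes_eq row_nodes_eq[OF r]
      simp del: One_nat_def)

lemma row_arrow_iff:
  "row_arrow X r i c c' \<longleftrightarrow> c \<in> row_nodes X r \<and> c' \<in> row_nodes X r \<and> arrow X i c c'"
  by (simp add: row_arrow_def)

lemma row_arrow_fromI:
  assumes c: "c \<in> row_nodes X r" and i: "i \<in> index_set X" "c i = 1" "depth X c i < bottom_vector X r ! (i - 1)"
  shows "row_arrow X r i c (\<lambda>j. c j - simple_root X i j)"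
proof -
  have a: "arrow X i c (\<lambda>j. c j - simple_root X i j)"
    using c i row_nodes_subset by (intro arrowI) auto
  have "(\<lambda>j. c j - simple_root X i j) \<in> row_nodes X r"
    using c i arrowD(3)[OF a] by (auto simp: row_nodes_iff depth_arrow[OF a] simp del: One_nat_def)
  then show ?thesis using a c by (simp add: row_arrow_iff)
qed

lemma row_arrow_toI:
  assumes c: "c \<in> row_nodes X r" and i: "i \<in> index_set X" "c i = -1" "top_vector X r ! (i - 1) < depth X c i"
  shows "row_arrow X r i (\<lambda>j. c j + simple_root X i j) c"
proof -
  define x where "x = (\<lambda>j. c j + simple_root X i j)"
  have a: "arrow X i x c"
    using c i row_nodes_subset unfolding x_def by (intro arrow_to) auto
  have "x \<in> row_nodes X r"
    unfolding row_nodes_iff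
  proof (intro conjI ballI)
    fix j assume j: "j \<in> index_set X"
    then show "top_vector X r ! (j - 1) \<le> depth X x j"
      using c i j depth_arrow[OF a j] by (cases "i = j") (fastforce simp: row_nodes_iff)+
    show "depth X x j \<le> bottom_vector X r ! (j - 1)"
      using c j depth_arrow[OF a j] by (cases "i = j") (fastforce simp: row_nodes_iff)+
  qed (use arrowD(2)[OF a] in simp)
  then show ?thesis using a c by (simp add: row_arrow_iff x_def)
qed

lemma in_colors_iff:
  assumes "n \<in> set (row_vectors X r)"
  shows "i \<in> set (in_colors X r n) \<longleftrightarrow> (\<exists>x. row_arrow X r i x (weight_of X n))"
proof -
  have n: "n \<in> set (depth_vectors X)" "weight_of X n \<in> row_nodes X r"
    using assms by (auto simp: row_nodes_eq[OF r] row_vectors_def)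
  show ?thesis
  proof
    assume "i \<in> set (in_colors X r n)"
    then have "i \<in> index_set X" "weight_of X n i = -1" "top_vector X r ! (i - 1) < depth X (weight_of X n) i"
      using n by (auto simp: in_colors_def set_colors weight_of_nth depth_weight_of)
    then show "\<exists>x. row_arrow X r i x (weight_of X n)"
      using row_arrow_toI n by blast
  next
    assume "\<exists>x. row_arrow X r i x (weight_of X n)"
    then obtain x where x: "x \<in> row_nodes X r" "arrow X i x (weight_of X n)" by (auto simp: row_arrow_iff)
    note i = arrowD(1)[OF x(2)]
    have "top_vector X r ! (i - 1) \<le> depth X x i" using x(1) i by (auto simp: row_nodes_iff)
    then have "top_vector X r ! (i - 1) < n ! (i - 1)"
      using depth_arrow[OF x(2) i] n by (simp add: depth_weight_of)
    then show "i \<in> set (in_colors X r n)"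
      using arrowD(5)[OF x(2)] i by (auto simp: in_colors_def set_colors weight_of_nth)
  qed
qed

lemma out_colors_iff:
  assumes "n \<in> set (row_vectors X r)"
  shows "i \<in> set (out_colors X r n) \<longleftrightarrow> (\<exists>x. row_arrow X r i (weight_of X n) x)"
proof -
  have n: "n \<in> set (depth_vectors X)" "weight_of X n \<in> row_nodes X r"
    using assms by (auto simp: row_nodes_eq[OF r] row_vectors_def)
  show ?thesis
  proof
    assume "i \<in> set (out_colors X r n)"
    then have "i \<in> index_set X" "weight_of X n i = 1" "depth X (weight_of X n) i < bottom_vector X r ! (i - 1)"
      using n by (auto simp: out_colors_def set_colors weight_of_nth depth_weight_of)
    then show "\<exists>x. row_arrow X r i (weight_of X n) x"
      using row_arrow_fromI n by blast
  next
    assume "\<exists>x. row_arrow X r i (weight_of X n) x"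
    then obtain x where x: "x \<in> row_nodes X r" "arrow X i (weight_of X n) x" by (auto simp: row_arrow_iff)
    note i = arrowD(1)[OF x(2)]
    have "depth X x i \<le> bottom_vector X r ! (i - 1)" using x(1) i by (auto simp: row_nodes_iff)
    then have "n ! (i - 1) < bottom_vector X r ! (i - 1)"
      using depth_arrow[OF x(2) i] n by (simp add: depth_weight_of)
    then show "i \<in> set (out_colors X r n)"
      using arrowD(4)[OF x(2)] i by (auto simp: out_colors_def set_colors weight_of_nth)
  qed
qed

lemma in_arrow_start: "row_arrow X r i x c \<Longrightarrow> x = (\<lambda>j. c j + simple_root X i j)"
  using arrowD(6)[of X i x c] by (auto simp: row_arrow_def)

text \<open>The color of an incoming arrow determines its start, so arrows can be counted by their
  colors.\<close>

lemma card_in_arrows: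
  assumes "n \<in> set (row_vectors X r)"
  shows "card {(i, x). row_arrow X r i x (weight_of X n)} = length (in_colors X r n)"
proof -
  have "{(i, x). row_arrow X r i x (weight_of X n)} =
      (\<lambda>i. (i, \<lambda>j. weight_of X n j + simple_root X i j)) ` set (in_colors X r n)"
    using in_arrow_start by (fastforce simp: in_colors_iff[OF assms])
  moreover have "inj_on (\<lambda>i. (i, \<lambda>j. weight_of X n j + simple_root X i j)) (set (in_colors X r n))"
    by (auto intro: inj_onI)
  moreover have "distinct (in_colors X r n)" by (simp add: in_colors_def colors_def)
  ultimately show ?thesis by (simp add: card_image distinct_card)
qed

lemma pivot_iff:
  assumes "n \<in> set (row_vectors X r)"
  shows "weight_of X n \<in> reduced_nodes X r \<longleftrightarrow> length (in_colors X r n) = 1"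
  using assms by (auto simp: reduced_nodes_def card_in_arrows row_nodes_eq[OF r])

lemma pivot_color_eq:
  assumes "n \<in> set (row_vectors X r)" "in_colors X r n = [i]"
  shows "pivot_color X r (weight_of X n) = i"
  using assms in_colors_iff[OF assms(1)] unfolding pivot_color_def by (intro the_equality) auto

lemma pivotsD:
  assumes "(d, i) \<in> set (pivots X r)"
  shows "d \<in> set (row_vectors X r)" "d \<in> set (depth_vectors X)" "in_colors X r d = [i]"
    "weight_of X d \<in> reduced_nodes X r" "pivot_color X r (weight_of X d) = i" "i \<in> index_set X"
proof -
  show d: "d \<in> set (row_vectors X r)" and i: "in_colors X r d = [i]"
    using assms by (auto simp: pivots_def length_Suc_conv)
  show "d \<in> set (depth_vectors X)" using d by (simp add: row_vectors_def)
  show "weight_of X d \<in> reduced_nodes X r" using d i by (simp add: pivot_iff)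
  show "pivot_color X r (weight_of X d) = i" using d i by (rule pivot_color_eq)
  have "i \<in> set (in_colors X r d)" using i by simp
  then show "i \<in> index_set X" by (simp add: in_colors_def set_colors)
qed

lemma reduced_node_cases:
  assumes "c \<in> reduced_nodes X r"
  obtains d where "(d, pivot_color X r c) \<in> set (pivots X r)" "c = weight_of X d"
proof -
  have "c \<in> row_nodes X r" using assms by (simp add: reduced_nodes_def)
  then obtain d where d: "d \<in> set (row_vectors X r)" "c = weight_of X d" by (rule row_node_cases)
  then have "length (in_colors X r d) = 1" using assms pivot_iff by simp
  then obtain i where i: "in_colors X r d = [i]" by (auto simp: length_Suc_conv)
  then have "(d, i) \<in> set (pivots X r)" using d by (force simp: pivots_def)
  moreover have "pivot_color X r c = i" using pivot_color_eq d i by simp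
  ultimately show thesis using that d by simp
qed

lemma reduced_nodes_subset: "reduced_nodes X r \<subseteq> row_nodes X r"
  by (auto simp: reduced_nodes_def)

lemma finite_reduced_nodes: "finite (reduced_nodes X r)"
  using reduced_nodes_subset finite_row_nodes by (rule finite_subset)

lemma pivot_color_index: "d \<in> reduced_nodes X r \<Longrightarrow> pivot_color X r d \<in> index_set X"
  by (elim reduced_node_cases) (use pivotsD in metis)

lemma below_pivot_iff:
  assumes "x \<in> row_nodes X r" "d \<in> reduced_nodes X r"
  shows "below X x d \<longleftrightarrow> depth X d (pivot_color X r d) \<le> depth X x (pivot_color X r d)"
proof -
  obtain n where n: "n \<in> set (row_vectors X r)" "n \<in> set (depth_vectors X)" "x = weight_of X n"
    using assms(1) by (rule row_node_cases)
  obtain e where e: "(e, pivot_color X r d) \<in> set (pivots X r)" "d = weight_of X e"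
    using assms(2) by (rule reduced_node_cases)
  note eD = pivotsD[OF e(1)]
  have "below X x d \<longleftrightarrow> le_vec e n"
    using n eD(2) e(2) by (subst below_iff_depth) (auto simp: nodes_eq depth_weight_of le_vec_iff)
  also have "\<dots> \<longleftrightarrow> e ! (pivot_color X r d - 1) \<le> n ! (pivot_color X r d - 1)"
    using bspec[OF bspec[OF check_pivots[unfolded list_all_iff] in_all_rows[OF r], unfolded prod.case] e(1)] n(1)
    by simp
  finally show ?thesis using n eD(2) e(2) by (simp add: depth_weight_of)
qed

text \<open>By \<open>below_pivot_iff\<close> a pivot of color i lies above x when its own i-th
  coordinate is at most that of x, which is the condition counted in \<open>check_count\<close>.
  Depths, and with them weights, thus become sums over pivots.\<close>

lemma card_pivots_above:
  assumes "x \<in> row_nodes X r" "i \<in> index_set X"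
  shows "int (card {d \<in> pivots_above X r x. pivot_color X r d = i}) = depth X x i - top_vector X r ! (i - 1)"
proof -
  obtain n where n: "n \<in> set (row_vectors X r)" "n \<in> set (depth_vectors X)" "x = weight_of X n"
    using assms(1) by (rule row_node_cases)
  define ds where "ds = filter (\<lambda>(d, j). j = i \<and> d ! (i - 1) \<le> n ! (i - 1)) (pivots X r)"
  have "{d \<in> pivots_above X r x. pivot_color X r d = i} = (\<lambda>(d, j). weight_of X d) ` set ds"
  proof (intro set_eqI iffI)
    fix c assume "c \<in> {d \<in> pivots_above X r x. pivot_color X r d = i}"
    then have c: "c \<in> reduced_nodes X r" "below X x c" "pivot_color X r c = i" by (auto simp: pivots_above_def)
    obtain d where d: "(d, i) \<in> set (pivots X r)" "c = weight_of X d"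
      using reduced_node_cases[OF c(1)] c(3) by metis
    have "d ! (i - 1) \<le> n ! (i - 1)"
      using below_pivot_iff[OF assms(1) c(1)] c n d pivotsD(2)[OF d(1)] by (simp add: depth_weight_of)
    then have "(d, i) \<in> set ds" using d by (simp add: ds_def)
    then show "c \<in> (\<lambda>(d, j). weight_of X d) ` set ds" using d by force
  next
    fix c assume "c \<in> (\<lambda>(d, j). weight_of X d) ` set ds"
    then obtain d where d: "(d, i) \<in> set (pivots X r)" "d ! (i - 1) \<le> n ! (i - 1)" "c = weight_of X d"
      by (auto simp: ds_def)
    then show "c \<in> {d \<in> pivots_above X r x. pivot_color X r d = i}"
      using pivotsD[OF d(1)] below_pivot_iff[OF assms(1), of c] n
      by (simp add: depth_weight_of pivots_above_def)
  qed
  moreover have "inj_on (\<lambda>(d, j). weight_of X d) (set ds)"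
  proof (rule inj_onI)
    fix p q assume p: "p \<in> set ds" and q: "q \<in> set ds"
      and eq: "(case p of (d, j) \<Rightarrow> weight_of X d) = (case q of (d, j) \<Rightarrow> weight_of X d)"
    obtain d e where "p = (d, i)" "q = (e, i)" "(d, i) \<in> set (pivots X r)" "(e, i) \<in> set (pivots X r)"
      using p q by (auto simp: ds_def)
    then show "p = q" using inj_onD[OF inj_weight_of] eq pivotsD(2) by auto
  qed
  moreover have "distinct (depth_vectors X)"
    using check_distinct by (cases X) (auto simp: list_all_iff distinct_map)
  then have "distinct ds" by (auto simp: ds_def pivots_def distinct_map inj_on_def row_vectors_def)
  ultimately have "card {d \<in> pivots_above X r x. pivot_color X r d = i} = length ds"
    by (simp add: card_image distinct_card)
  also have "\<dots> = nat (n ! (i - 1) - top_vector X r ! (i - 1))"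
    using bspec[OF check_count[unfolded list_all_iff] in_all_rows[OF r]] assms(2) n(1)
    by (simp add: ds_def set_colors)
  finally show ?thesis
    using assms n by (simp add: depth_weight_of row_nodes_iff)
qed


lemma pivots_above_subset: "pivots_above X r x \<subseteq> reduced_nodes X r"
  by (auto simp: pivots_above_def)

lemma finite_pivots_above: "finite (pivots_above X r x)"
  using pivots_above_subset finite_reduced_nodes by (rule finite_subset)

text \<open>Grouping the pivots by color turns the sum of Cartan entries into the depth of x
  relative to the source, applied to the Cartan matrix.\<close>

lemma row_weight_top:
  assumes "x \<in> row_nodes X r" "j \<in> index_set X"
  shows "x j = weight_of X (top_vector X r) j - (\<Sum>d\<in>pivots_above X r x. cartan X j (pivot_color X r d))"
proof -
  obtain n where n: "n \<in> set (row_vectors X r)" "n \<in> set (depth_vectors X)" "x = weight_of X n"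
    using assms(1) by (rule row_node_cases)
  note b = row_bounds_depth_vectors[OF r]
  have "(\<Sum>d\<in>pivots_above X r x. cartan X j (pivot_color X r d)) =
      (\<Sum>i\<in>index_set X. \<Sum>d\<in>{d \<in> pivots_above X r x. pivot_color X r d = i}. cartan X j (pivot_color X r d))"
    using finite_pivots_above pivot_color_index
    by (intro sum.group[symmetric]) (auto simp: pivots_above_def)
  also have "\<dots> = (\<Sum>i\<in>index_set X. (n ! (i - 1) - top_vector X r ! (i - 1)) * cartan X j i)"
    using card_pivots_above[OF assms(1)] n by (intro sum.cong refl) (simp add: depth_weight_of)
  finally show ?thesis
    using weight_of_difference[of n "top_vector X r" X j] n b assms(2)
      depth_vector_E6[OF n(2)] depth_vector_E6[OF b(1)]
    by (simp add: length_depth_vector)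
qed

text \<open>Only the i-th coordinate changes, and by 1. Relations to pivots of other colors depend
  on other coordinates and persist, while the number of pivots of color i grows by exactly
  one.\<close>

lemma row_arrow_pivot:
  assumes "row_arrow X r i x x'"
  shows "\<exists>d\<in>reduced_nodes X r. pivot_color X r d = i \<and> d \<notin> pivots_above X r x \<and>
    pivots_above X r x' = insert d (pivots_above X r x)"
proof -
  have x: "x \<in> row_nodes X r" "x' \<in> row_nodes X r" and a: "arrow X i x x'"
    using assms by (auto simp: row_arrow_iff)
  note i = arrowD(1)[OF a]
  define D where "D y = {d \<in> pivots_above X r y. pivot_color X r d = i}" for y
  have fin: "finite (D y)" for y using finite_pivots_above by (simp add: D_def)
  have sub: "pivots_above X r x \<subseteq> pivots_above X r x'"
    using arrow_below[OF a] below_trans by (auto simp: pivots_above_def)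
  have "int (card (D x')) = int (card (D x)) + 1"
    using card_pivots_above[OF x(1) i] card_pivots_above[OF x(2) i] depth_arrow[OF a i] by (simp add: D_def)
  then have "card (D x' - D x) = 1"
    using sub fin by (subst card_Diff_subset) (auto simp: D_def)
  then obtain d where d: "D x' - D x = {d}" by (auto simp: card_1_singleton_iff)
  have other: "e \<in> pivots_above X r x" if e: "e \<in> pivots_above X r x'" "pivot_color X r e \<noteq> i" for e
  proof -
    have "e \<in> reduced_nodes X r" using e by (simp add: pivots_above_def)
    then show ?thesis
      using e below_pivot_iff[OF x(1)] below_pivot_iff[OF x(2)] depth_arrow[OF a pivot_color_index]
      by (auto simp: pivots_above_def)
  qed
  have dD: "d \<in> D x'" "d \<notin> D x" using d by auto
  then have dm: "d \<in> reduced_nodes X r" "pivot_color X r d = i" "d \<in> pivots_above X r x'" "d \<notin> pivots_above X r x"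
    by (auto simp: D_def pivots_above_def)
  have "pivots_above X r x' = insert d (pivots_above X r x)"
  proof
    show "pivots_above X r x' \<subseteq> insert d (pivots_above X r x)"
    proof
      fix e assume e: "e \<in> pivots_above X r x'"
      show "e \<in> insert d (pivots_above X r x)"
      proof (cases "pivot_color X r e = i")
        case True
        then have "e \<in> D x'" using e by (simp add: D_def)
        then have "e \<in> D x \<or> e = d" using d by blast
        then show ?thesis by (auto simp: D_def)
      qed (use e other in blast)
    qed
  qed (use sub dm in blast)
  then show ?thesis using dm by blast
qed

lemma pivot_range:
  assumes d: "d \<in> reduced_nodes X r"
  shows "top_vector X r ! (pivot_color X r d - 1) < bottom_vector X r ! (pivot_color X r d - 1)"
proof -
  define i where "i = pivot_color X r d"
  have i: "i \<in> index_set X" using pivot_color_index[OF d] by (simp add: i_def)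
  have m: "d \<in> row_nodes X r" using d reduced_nodes_subset by blast
  have "d \<in> {e \<in> pivots_above X r d. pivot_color X r e = i}"
    using d by (simp add: pivots_above_def i_def)
  then have "0 < card {e \<in> pivots_above X r d. pivot_color X r e = i}"
    using finite_pivots_above by (auto simp: card_gt_0_iff)
  then have "top_vector X r ! (i - 1) < depth X d i" using card_pivots_above[OF m i] by simp
  also have "depth X d i \<le> bottom_vector X r ! (i - 1)" using m i by (auto simp: row_nodes_iff)
  finally show ?thesis by (simp add: i_def)
qed

text \<open>A box chosen by a Kashiwara operator of color i moves along an arrow of the whole
  crystal; this lemma keeps it in its row as soon as the row has a pivot of color i.\<close>

lemma row_closed:
  assumes d: "d \<in> reduced_nodes X r" and y: "y \<in> row_nodes X r"
  shows "y (pivot_color X r d) = 1 \<Longrightarrow> \<exists>y'. row_arrow X r (pivot_color X r d) y y'"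
    and "y (pivot_color X r d) = -1 \<Longrightarrow> \<exists>y'. row_arrow X r (pivot_color X r d) y' y"
proof -
  define i where "i = pivot_color X r d"
  have i: "i \<in> index_set X" using pivot_color_index[OF d] by (simp add: i_def)
  obtain n where n: "n \<in> set (row_vectors X r)" "n \<in> set (depth_vectors X)" "y = weight_of X n"
    using y by (rule row_node_cases)
  have "i \<in> set (colors X)" "top_vector X r ! (i - 1) < bottom_vector X r ! (i - 1)"
    using i pivot_range[OF d] by (simp_all only: set_colors i_def)
  then have "(weight_coords X n ! (i - 1) = 1 \<longrightarrow> n ! (i - 1) < bottom_vector X r ! (i - 1)) \<and>
      (weight_coords X n ! (i - 1) = -1 \<longrightarrow> top_vector X r ! (i - 1) < n ! (i - 1))"
    using bspec[OF bspec[OF check_closed[unfolded list_all_iff] in_all_rows[OF r], unfolded prod.case], of i] n(1)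
    by blast
  then have *: "y i = 1 \<Longrightarrow> depth X y i < bottom_vector X r ! (i - 1)"
      "y i = -1 \<Longrightarrow> top_vector X r ! (i - 1) < depth X y i"
    using n i by (simp_all add: weight_of_nth depth_weight_of)
  show "y (pivot_color X r d) = 1 \<Longrightarrow> \<exists>y'. row_arrow X r (pivot_color X r d) y y'"
    using row_arrow_fromI[OF y i] *(1) unfolding i_def by blast
  show "y (pivot_color X r d) = -1 \<Longrightarrow> \<exists>y'. row_arrow X r (pivot_color X r d) y' y"
    using row_arrow_toI[OF y i] *(2) unfolding i_def by blast
qed

lemma pivots_comparable:
  assumes "d \<in> reduced_nodes X r" "e \<in> reduced_nodes X r"
    and "cartan X (pivot_color X r d) (pivot_color X r e) \<noteq> 0"
  shows "below X d e \<or> below X e d"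
proof -
  obtain m where m: "(m, pivot_color X r d) \<in> set (pivots X r)" "d = weight_of X m"
    using assms(1) by (rule reduced_node_cases)
  obtain n where n: "(n, pivot_color X r e) \<in> set (pivots X r)" "e = weight_of X n"
    using assms(2) by (rule reduced_node_cases)
  have "adjacent_or_equal (pivot_color X r d) (pivot_color X r e)" using assms(3) by (rule cartan_adjacent)
  then have "le_vec m n \<or> le_vec n m"
    using bspec[OF bspec[OF bspec[OF check_comparable[unfolded list_all_iff] in_all_rows[OF r],
      unfolded prod.case] m(1), unfolded prod.case] n(1), unfolded prod.case] by blast
  then show ?thesis
    using m(2) n(2) le_vec_below pivotsD(2)[OF m(1)] pivotsD(2)[OF n(1)] by blast
qed

lemma top_in_row: "weight_of X (top_vector X r) \<in> row_nodes X r"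
  using row_bounds_depth_vectors[OF r]
  by (auto simp: row_nodes_eq[OF r] row_vectors_iff le_vec_iff)

lemma bottom_in_row: "weight_of X (bottom_vector X r) \<in> row_nodes X r"
  using row_bounds_depth_vectors[OF r]
  by (auto simp: row_nodes_eq[OF r] row_vectors_iff le_vec_iff)

lemma row_ends:
  assumes "n \<in> set (row_vectors X r)"
  shows "in_colors X r n = [] \<longleftrightarrow> n = top_vector X r" "out_colors X r n = [] \<longleftrightarrow> n = bottom_vector X r"
  using bspec[OF check_ends[unfolded list_all_iff] in_all_rows[OF r]] assms by auto

lemma no_in_arrow_iff:
  assumes "c \<in> row_nodes X r"
  shows "(\<exists>i x. row_arrow X r i x c) \<longleftrightarrow> c \<noteq> weight_of X (top_vector X r)"
proof -
  obtain n where n: "n \<in> set (row_vectors X r)" "n \<in> set (depth_vectors X)" "c = weight_of X n"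
    using assms by (rule row_node_cases)
  have "(\<exists>i x. row_arrow X r i x c) \<longleftrightarrow> set (in_colors X r n) \<noteq> {}"
    unfolding n(3) in_colors_iff[OF n(1), symmetric] by (simp add: ex_in_conv)
  also have "\<dots> \<longleftrightarrow> n \<noteq> top_vector X r" using row_ends[OF n(1)] by simp
  finally show ?thesis
    using n inj_onD[OF inj_weight_of] row_bounds_depth_vectors[OF r] by auto
qed

lemma no_out_arrow_iff:
  assumes "c \<in> row_nodes X r"
  shows "(\<exists>i x. row_arrow X r i c x) \<longleftrightarrow> c \<noteq> weight_of X (bottom_vector X r)"
proof -
  obtain n where n: "n \<in> set (row_vectors X r)" "n \<in> set (depth_vectors X)" "c = weight_of X n"
    using assms by (rule row_node_cases)
  have "(\<exists>i x. row_arrow X r i c x) \<longleftrightarrow> set (out_colors X r n) \<noteq> {}"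
    unfolding n(3) out_colors_iff[OF n(1), symmetric] by (simp add: ex_in_conv)
  also have "\<dots> \<longleftrightarrow> n \<noteq> bottom_vector X r" using row_ends[OF n(1)] by simp
  finally show ?thesis
    using n inj_onD[OF inj_weight_of] row_bounds_depth_vectors[OF r] by auto
qed

lemma source_eq: "source X r = weight_of X (top_vector X r)"
  unfolding source_def using no_in_arrow_iff top_in_row by (intro the_equality) blast+

lemma sink_eq: "sink X r = weight_of X (bottom_vector X r)"
  unfolding sink_def using no_out_arrow_iff bottom_in_row by (intro the_equality) blast+

lemma source_in_row: "source X r \<in> row_nodes X r"
  by (simp add: source_eq top_in_row)

lemma below_source:
  assumes "x \<in> row_nodes X r"
  shows "below X x (source X r)"
proof -
  have "source X r \<in> nodes X" "x \<in> nodes X" using assms source_in_row row_nodes_subset by auto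
  then show ?thesis
    using assms row_bounds_depth_vectors[OF r]
    by (auto simp: source_eq below_iff_depth depth_weight_of row_nodes_iff)
qed

lemma row_weight:
  assumes "x \<in> row_nodes X r" "j \<in> index_set X"
  shows "x j = source X r j - (\<Sum>d\<in>pivots_above X r x. cartan X j (pivot_color X r d))"
  using row_weight_top[OF assms] by (simp add: source_eq)

text \<open>A pivot above the source would be the source itself, which has no incoming
  arrow.\<close>

lemma pivots_above_source: "pivots_above X r (source X r) = {}"
proof -
  have "False" if d: "d \<in> reduced_nodes X r" "below X (source X r) d" for d
  proof -
    have m: "d \<in> row_nodes X r" using d reduced_nodes_subset by blast
    then have "d = source X r"
      using below_antisym below_source d source_in_row row_nodes_subset by blast
    then have "{(i, x). row_arrow X r i x d} = {}"
      using no_in_arrow_iff[OF m] by (auto simp: source_eq)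
    then show False using d by (simp add: reduced_nodes_def)
  qed
  then show ?thesis by (auto simp: pivots_above_def)
qed

end

lemma color_row:
  assumes "i \<in> index_set X"
  shows "color_row X i \<in> {1..nrows X}" "source X (color_row X i) i = 1"
    and "\<And>r. r \<in> {1..nrows X} \<Longrightarrow> color_row X i \<le> r \<longleftrightarrow> (\<exists>d\<in>reduced_nodes X r. pivot_color X r d = i)"
    and "\<And>r. r \<in> {1..nrows X} \<Longrightarrow> color_row X i < r \<Longrightarrow> source X r i = 0"
    and "\<And>r. r \<in> {1..nrows X} \<Longrightarrow> Suc r < color_row X i \<Longrightarrow> 0 \<le> source X r i"
proof -
  have *: "1 \<le> color_row X i \<and> color_row X i \<le> nrows X \<and>
    weight_coords X (top_vector X (color_row X i)) ! (i - 1) = 1 \<and>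
    (\<forall>r\<in>{1..nrows X}.
      (color_row X i \<le> r) = (top_vector X r ! (i - 1) < bottom_vector X r ! (i - 1)) \<and>
      (color_row X i < r \<longrightarrow> weight_coords X (top_vector X r) ! (i - 1) = 0) \<and>
      (Suc r < color_row X i \<longrightarrow> 0 \<le> weight_coords X (top_vector X r) ! (i - 1)))"
  proof -
    have "X \<in> set [E6, E7]" "set [1..<Suc (nrows X)] = {1..nrows X}" by (cases X; auto)+
    then show ?thesis
      using bspec[OF bspec[OF check_color_row[unfolded list_all_iff], of X], of i] assms
      unfolding set_colors by simp
  qed
  show 1: "color_row X i \<in> {1..nrows X}" using * by simp
  show "source X (color_row X i) i = 1"
    using * assms 1 by (simp add: source_eq weight_of_nth)
  fix r assume r: "r \<in> {1..nrows X}"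
  show "color_row X i < r \<Longrightarrow> source X r i = 0" "Suc r < color_row X i \<Longrightarrow> 0 \<le> source X r i"
    using * r assms by (auto simp: source_eq weight_of_nth)
  show "color_row X i \<le> r \<longleftrightarrow> (\<exists>d\<in>reduced_nodes X r. pivot_color X r d = i)"
  proof
    assume "color_row X i \<le> r"
    then have "top_vector X r ! (i - 1) < bottom_vector X r ! (i - 1)" using * r by blast
    then have "0 < card {d \<in> pivots_above X r (weight_of X (bottom_vector X r)). pivot_color X r d = i}"
      using card_pivots_above[OF r bottom_in_row[OF r] assms] row_bounds_depth_vectors[OF r]
      by (simp add: depth_weight_of)
    then show "\<exists>d\<in>reduced_nodes X r. pivot_color X r d = i"
      by (auto simp: card_gt_0_iff pivots_above_def)
  next
    assume "\<exists>d\<in>reduced_nodes X r. pivot_color X r d = i"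
    then show "color_row X i \<le> r" using pivot_range[OF r] * r by auto
  qed
qed

section \<open>Nodes of a row as up-closed sets of pivots\<close>

definition up_closed :: "etype \<Rightarrow> nat \<Rightarrow> weight set \<Rightarrow> bool" where
  "up_closed X r U \<longleftrightarrow> U \<subseteq> reduced_nodes X r \<and>
    (\<forall>d\<in>U. \<forall>e\<in>reduced_nodes X r. below X d e \<longrightarrow> e \<in> U)"

definition node_of :: "etype \<Rightarrow> nat \<Rightarrow> weight set \<Rightarrow> weight" where
  "node_of X r U = (THE x. x \<in> row_nodes X r \<and> pivots_above X r x = U)"

lemma up_closed_pivots_above: "up_closed X r (pivots_above X r x)"
  using below_trans by (auto simp: up_closed_def pivots_above_def)

context
  fixes X :: etype and r :: nat
  assumes r: "r \<in> {1..nrows X}"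
begin

lemma pivot_in_row: "d \<in> reduced_nodes X r \<Longrightarrow> d \<in> row_nodes X r"
  by (simp add: reduced_nodes_def)

lemma pivot_node: "d \<in> reduced_nodes X r \<Longrightarrow> d \<in> nodes X"
  using pivot_in_row row_nodes_subset[OF r] by blast

lemma pivots_antisym:
  "d \<in> reduced_nodes X r \<Longrightarrow> e \<in> reduced_nodes X r \<Longrightarrow> below X d e \<Longrightarrow> below X e d \<Longrightarrow> d = e"
  using below_antisym pivot_node by blast

text \<open>The incoming arrow adds exactly one pivot. Since d is a pivot above d but not above the
  start of the arrow, the added pivot is d.\<close>

lemma pivot_arrow:
  assumes d: "d \<in> reduced_nodes X r"
  shows "\<exists>x. row_arrow X r (pivot_color X r d) x d \<and> pivots_above X r x = pivots_above X r d - {d}"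
proof -
  have "card {(i, x). row_arrow X r i x d} = 1" using d by (simp add: reduced_nodes_def)
  then have "{(i, x). row_arrow X r i x d} \<noteq> {}" by (metis card.empty zero_neq_one)
  then obtain i x where a: "row_arrow X r i x d" by auto
  then obtain g where g: "pivot_color X r g = i" "g \<notin> pivots_above X r x"
      "pivots_above X r d = insert g (pivots_above X r x)"
    using row_arrow_pivot[OF r] by blast
  have ax: "arrow X i x d" using a by (simp add: row_arrow_def)
  have "d \<notin> pivots_above X r x"
  proof
    assume "d \<in> pivots_above X r x"
    then have "x = d"
      using below_antisym arrow_below[OF ax] arrowD(2,3)[OF ax] by (auto simp: pivots_above_def)
    then show False using arrowD(4,5)[OF ax] by simp
  qed
  moreover have "d \<in> pivots_above X r d" using d by (simp add: pivots_above_def)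
  ultimately have "g = d" using g by auto
  then show ?thesis using a g by auto
qed

lemma pivot_value: "d \<in> reduced_nodes X r \<Longrightarrow> d (pivot_color X r d) = -1"
  using pivot_arrow arrowD(5) by (fastforce simp: row_arrow_def)

text \<open>Compare x with the start x0 of the arrow into d, whose i-weight is 1 for the color i of
  d. The pivots of x missing at x0 are incomparable with d, so their Cartan entries with i vanish
  and x also has i-weight 1. The arrow of color i out of x adds a pivot g of the same color, hence
  comparable with d; since all pivots strictly above d are present already and d is not, g must be
  d.\<close>

lemma row_step:
  assumes x: "x \<in> row_nodes X r" and d: "d \<in> reduced_nodes X r" "d \<notin> pivots_above X r x"
    and above: "\<And>e. e \<in> reduced_nodes X r \<Longrightarrow> below X d e \<Longrightarrow> e \<noteq> d \<Longrightarrow> e \<in> pivots_above X r x"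
  shows "\<exists>x'. row_arrow X r (pivot_color X r d) x x' \<and> pivots_above X r x' = insert d (pivots_above X r x)"
proof -
  define i where "i = pivot_color X r d"
  have i: "i \<in> index_set X" using pivot_color_index[OF r d(1)] by (simp add: i_def)
  obtain x0 where x0: "row_arrow X r i x0 d" "pivots_above X r x0 = pivots_above X r d - {d}"
    using pivot_arrow[OF d(1)] by (auto simp: i_def)
  have sub: "pivots_above X r x0 \<subseteq> pivots_above X r x"
    using above unfolding x0(2) by (auto simp: pivots_above_def[of X r d])
  have "(\<Sum>e\<in>pivots_above X r x. cartan X i (pivot_color X r e)) =
      (\<Sum>e\<in>pivots_above X r x0. cartan X i (pivot_color X r e))"
  proof (rule sum.mono_neutral_right[OF finite_pivots_above[OF r] sub], rule ballI)
    fix e assume e: "e \<in> pivots_above X r x - pivots_above X r x0"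
    then have eJ: "e \<in> reduced_nodes X r" "below X x e" by (auto simp: pivots_above_def)
    have "\<not> below X d e"
    proof
      assume "below X d e"
      then have "e \<in> pivots_above X r d - {d}" using e eJ d(2) by (auto simp: pivots_above_def)
      then show False using e by (simp add: x0(2))
    qed
    moreover have "\<not> below X e d" using e eJ d below_trans by (auto simp: pivots_above_def)
    ultimately show "cartan X i (pivot_color X r e) = 0"
      using pivots_comparable[OF r d(1) eJ(1)] by (auto simp: i_def)
  qed
  moreover have "x0 \<in> row_nodes X r" "x0 i = 1"
    using x0(1) arrowD(4) by (auto simp: row_arrow_def)
  ultimately have "x i = 1" using row_weight[OF r x i] row_weight[OF r _ i, of x0] by simp
  then obtain x' where x': "row_arrow X r i x x'"
    using row_closed(1)[OF r d(1) x] by (auto simp: i_def)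
  then obtain g where g: "g \<in> reduced_nodes X r" "pivot_color X r g = i" "g \<notin> pivots_above X r x"
      "pivots_above X r x' = insert g (pivots_above X r x)"
    using row_arrow_pivot[OF r] by blast
  have "below X d g \<or> below X g d"
    using pivots_comparable[OF r d(1) g(1)] g(2) by (simp add: i_def)
  then have "g = d"
  proof
    assume "below X d g"
    then show ?thesis using above g by blast
  next
    assume "below X g d"
    moreover have "below X x' g" using g(4) by (auto simp: pivots_above_def)
    ultimately have "d \<in> pivots_above X r x'" using d(1) below_trans by (auto simp: pivots_above_def)
    then show ?thesis using g d(2) by auto
  qed
  then show ?thesis using x' g by (auto simp: i_def)
qed

text \<open>By \<open>row_weight\<close> the pivots above a node determine every coordinate of its
  weight.\<close>

lemma pivots_above_inj:
  assumes "x \<in> row_nodes X r" "y \<in> row_nodes X r" "pivots_above X r x = pivots_above X r y"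
  shows "x = y"
proof
  fix j
  show "x j = y j"
  proof (cases "j \<in> index_set X")
    case True
    then show ?thesis using assms by (simp add: row_weight[OF r])
  next
    case False
    then show ?thesis using assms row_nodes_subset[OF r] node_outside[of _ X j] by (metis subsetD)
  qed
qed

lemma up_closed_step:
  assumes x: "x \<in> row_nodes X r" and U: "up_closed X r U" "pivots_above X r x \<subset> U"
  shows "\<exists>d\<in>U - pivots_above X r x. \<exists>i x'. row_arrow X r i x x' \<and>
    pivots_above X r x' = insert d (pivots_above X r x)"
proof -
  have "finite (U - pivots_above X r x)"
    using U finite_reduced_nodes[OF r] by (auto simp: up_closed_def intro: finite_subset)
  \<comment> \<open>A missing pivot with the fewest pivots above it: anything strictly above it lies
    in U and has fewer, so it is present already and \<open>row_step\<close> applies.\<close>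
  then obtain d where d: "d \<in> U - pivots_above X r x"
      and min: "\<And>e. e \<in> U - pivots_above X r x \<Longrightarrow> card (pivots_above X r d) \<le> card (pivots_above X r e)"
    using ex_min_if_finite[of "(\<lambda>d. card (pivots_above X r d)) ` (U - pivots_above X r x)"] U(2)
    by (auto simp: not_less)
  have dJ: "d \<in> reduced_nodes X r" using d U by (auto simp: up_closed_def)
  have "e \<in> pivots_above X r x" if e: "e \<in> reduced_nodes X r" "below X d e" "e \<noteq> d" for e
  proof (rule ccontr)
    assume "e \<notin> pivots_above X r x"
    moreover have "e \<in> U" using e d U by (auto simp: up_closed_def)
    ultimately have "card (pivots_above X r d) \<le> card (pivots_above X r e)" using min by blast
    moreover have "pivots_above X r e \<subset> pivots_above X r d"
    proof
      show "pivots_above X r e \<subseteq> pivots_above X r d"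
        using e below_trans by (auto simp: pivots_above_def)
      show "pivots_above X r e \<noteq> pivots_above X r d"
      proof
        assume eq: "pivots_above X r e = pivots_above X r d"
        have "d \<in> pivots_above X r e" unfolding eq using dJ by (simp add: pivots_above_def)
        then have "below X e d" by (simp add: pivots_above_def)
        then show False using e dJ pivots_antisym by blast
      qed
    qed
    then have "card (pivots_above X r e) < card (pivots_above X r d)"
      by (rule psubset_card_mono[OF finite_pivots_above[OF r]])
    ultimately show False by linarith
  qed
  then show ?thesis using row_step[OF x dJ] d by blast
qed

lemma row_reach:
  assumes "x \<in> row_nodes X r" "up_closed X r U" "pivots_above X r x \<subseteq> U"
  shows "\<exists>y\<in>row_nodes X r. pivots_above X r y = U \<and> below X y x"
  using assms
proof (induction "card (U - pivots_above X r x)" arbitrary: x rule: less_induct)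
  case less
  show ?case
  proof (cases "pivots_above X r x = U")
    case False
    then obtain d i x' where d: "d \<in> U - pivots_above X r x" "row_arrow X r i x x'"
        "pivots_above X r x' = insert d (pivots_above X r x)"
      using up_closed_step less.prems by blast
    have "finite U" using less.prems finite_reduced_nodes[OF r] by (auto simp: up_closed_def intro: finite_subset)
    then have "card (U - pivots_above X r x') < card (U - pivots_above X r x)"
      using d by (intro psubset_card_mono) auto
    moreover have "x' \<in> row_nodes X r" "pivots_above X r x' \<subseteq> U" "below X x' x"
      using d less.prems arrow_below by (auto simp: row_arrow_def)
    ultimately show ?thesis using less.hyps less.prems(2) below_trans by blast
  qed (use less.prems in auto)
qed

text \<open>For the converse, a path from y reaches a node with the pivots of x, and that node is x
  by injectivity.\<close>

lemma below_iff_pivots: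
  assumes "x \<in> row_nodes X r" "y \<in> row_nodes X r"
  shows "below X x y \<longleftrightarrow> pivots_above X r y \<subseteq> pivots_above X r x"
proof
  assume "below X x y"
  then show "pivots_above X r y \<subseteq> pivots_above X r x"
    using below_trans by (auto simp: pivots_above_def)
next
  assume "pivots_above X r y \<subseteq> pivots_above X r x"
  then obtain z where "z \<in> row_nodes X r" "pivots_above X r z = pivots_above X r x" "below X z y"
    using row_reach[OF assms(2) up_closed_pivots_above] by blast
  then show "below X x y" using pivots_above_inj assms(1) by blast
qed

lemma node_of:
  assumes "up_closed X r U"
  shows "node_of X r U \<in> row_nodes X r" "pivots_above X r (node_of X r U) = U"
proof -
  have "\<exists>!x. x \<in> row_nodes X r \<and> pivots_above X r x = U"
    using row_reach[OF source_in_row[OF r] assms] pivots_above_source[OF r] pivots_above_inj by auto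
  from theI'[OF this] show "node_of X r U \<in> row_nodes X r" "pivots_above X r (node_of X r U) = U"
    by (auto simp: node_of_def)
qed

lemma node_of_pivots_above: "x \<in> row_nodes X r \<Longrightarrow> node_of X r (pivots_above X r x) = x"
  using node_of[OF up_closed_pivots_above] pivots_above_inj by blast

lemma eq_source_iff: "x \<in> row_nodes X r \<Longrightarrow> x = source X r \<longleftrightarrow> pivots_above X r x = {}"
  using pivots_above_inj source_in_row[OF r] pivots_above_source[OF r] by metis

text \<open>If a pivot were missing, \<open>up_closed_step\<close> would give an arrow out of the
  sink.\<close>

lemma pivots_above_sink: "pivots_above X r (sink X r) = reduced_nodes X r"
proof (rule ccontr)
  assume "pivots_above X r (sink X r) \<noteq> reduced_nodes X r"
  then have "pivots_above X r (sink X r) \<subset> reduced_nodes X r" by (auto simp: pivots_above_def)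
  moreover have "up_closed X r (reduced_nodes X r)" by (simp add: up_closed_def)
  ultimately have "\<exists>i x. row_arrow X r i (sink X r) x"
    using up_closed_step bottom_in_row[OF r] sink_eq[OF r] by metis
  then show False using no_out_arrow_iff[OF r bottom_in_row[OF r]] by (simp add: sink_eq[OF r])
qed

lemma arrow_group:
  assumes "row_arrow X r i x x'"
  shows "arrow_group X r x x' \<in> reduced_nodes X r" "pivot_color X r (arrow_group X r x x') = i"
    "arrow_group X r x x' \<notin> pivots_above X r x"
    "pivots_above X r x' = insert (arrow_group X r x x') (pivots_above X r x)"
    "arrow_color X x x' = i"
proof -
  obtain g where g: "g \<in> reduced_nodes X r" "pivot_color X r g = i" "g \<notin> pivots_above X r x"
      "pivots_above X r x' = insert g (pivots_above X r x)"
    using row_arrow_pivot[OF r assms] by blast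
  have "d \<in> reduced_nodes X r \<and> below X x' d \<and> \<not> below X x d \<longleftrightarrow> d \<in> pivots_above X r x' - pivots_above X r x"
    for d by (auto simp: pivots_above_def)
  moreover have "pivots_above X r x' - pivots_above X r x = {g}" using g by auto
  ultimately have "arrow_group X r x x' = g" by (simp add: arrow_group_def)
  then show "arrow_group X r x x' \<in> reduced_nodes X r" "pivot_color X r (arrow_group X r x x') = i"
    "arrow_group X r x x' \<notin> pivots_above X r x"
    "pivots_above X r x' = insert (arrow_group X r x x') (pivots_above X r x)"
    using g by simp_all
  show "arrow_color X x x' = i"
    unfolding arrow_color_def using assms arrow_color_unique by (intro the_equality) (auto simp: row_arrow_def)
qed

text \<open>The pivots above the k-th node of the path are the groups of its first k arrows. At the
  sink this gives all groups. The group of an arrow cannot lie above an earlier one, since by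
  transitivity it would then already lie above the start of its own arrow.\<close>

lemma full_path_pivots:
  assumes p: "full_path X r p"
  defines "gs \<equiv> map (\<lambda>(x, x'). arrow_group X r x x') (path_arrows p)"
  shows "set gs = reduced_nodes X r" "sorted_wrt (\<lambda>d e. \<not> below X d e) gs"
    "\<And>x x'. (x, x') \<in> set (path_arrows p) \<Longrightarrow> \<exists>i. row_arrow X r i x x'"
proof -
  have len: "length gs = length p - 1" by (simp add: gs_def path_arrows_def)
  have ne: "p \<noteq> []" "p ! 0 = source X r" "p ! (length p - 1) = sink X r"
    using p by (auto simp: full_path_def hd_conv_nth last_conv_nth)
  have gnth: "gs ! k = arrow_group X r (p ! k) (p ! Suc k)" if "Suc k < length p" for k
    using that by (simp add: gs_def path_arrows_def nth_tl)
  have arr: "\<exists>i. row_arrow X r i (p ! k) (p ! Suc k)" if "Suc k < length p" for k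
    using that p by (simp add: full_path_def)
  show "\<And>x x'. (x, x') \<in> set (path_arrows p) \<Longrightarrow> \<exists>i. row_arrow X r i x x'"
    using arr by (auto simp: path_arrows_def set_zip nth_tl)
  have pre: "pivots_above X r (p ! k) = set (take k gs)" if "k < length p" for k
    using that
  proof (induction k)
    case 0
    then show ?case using ne pivots_above_source[OF r] by simp
  next
    case (Suc k)
    then obtain i where "row_arrow X r i (p ! k) (p ! Suc k)" using arr by blast
    from arrow_group(4)[OF this] show ?case
      using Suc len by (simp add: take_Suc_conv_app_nth gnth)
  qed
  show "set gs = reduced_nodes X r"
    using pre[of "length p - 1"] ne pivots_above_sink len by simp
  show "sorted_wrt (\<lambda>d e. \<not> below X d e) gs"
    unfolding sorted_wrt_iff_nth_less
  proof (intro allI impI notI)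
    fix u v assume uv: "u < v" "v < length gs" and b: "below X (gs ! u) (gs ! v)"
    obtain i where a: "row_arrow X r i (p ! v) (p ! Suc v)" using arr uv len by (metis less_diff_conv add.commute plus_1_eq_Suc)
    have "gs ! u \<in> set (take v gs)" using uv by (auto simp: in_set_conv_nth intro!: exI[of _ u])
    then have "gs ! u \<in> pivots_above X r (p ! v)" using pre[of v] uv len by simp
    then have "gs ! v \<in> pivots_above X r (p ! v)"
      using b arrow_group(1)[OF a] gnth[of v] uv len below_trans by (auto simp: pivots_above_def)
    then show False using arrow_group(3)[OF a] gnth[of v] uv len by simp
  qed
qed

end

section \<open>Tableaux and counts\<close>

definition count_family :: "etype \<Rightarrow> (nat \<Rightarrow> weight \<Rightarrow> int) \<Rightarrow> bool" where
  "count_family X s \<longleftrightarrow>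
    (\<forall>r\<in>{1..nrows X}. \<forall>c\<in>reduced_nodes X r. s r c \<ge> 0) \<and>
    (\<forall>r\<in>{1..nrows X}. \<forall>c1\<in>reduced_nodes X r. \<forall>c2\<in>reduced_nodes X r.
       below X c1 c2 \<longrightarrow> s r c1 \<le> s r c2)"

definition level :: "etype \<Rightarrow> (nat \<Rightarrow> weight \<Rightarrow> int) \<Rightarrow> nat \<Rightarrow> nat \<Rightarrow> weight set" where
  "level X s r m = {d \<in> reduced_nodes X r. int m < s r d}"

definition box :: "etype \<Rightarrow> (nat \<Rightarrow> weight \<Rightarrow> int) \<Rightarrow> nat \<Rightarrow> nat \<Rightarrow> weight" where
  "box X s r m = node_of X r (level X s r m)"

text \<open>The number of boxes of the row that do not contain the source; see
  \<open>box_source_iff\<close>.\<close>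

definition filled :: "etype \<Rightarrow> (nat \<Rightarrow> weight \<Rightarrow> int) \<Rightarrow> nat \<Rightarrow> nat" where
  "filled X s r = nat (Max (insert 0 (s r ` reduced_nodes X r)))"

text \<open>Forced by marginal largeness: the source boxes of row q outnumber the boxes of row q - 1
  by one, so each row is longer than the one below it by \<open>Suc (filled X s q)\<close>.\<close>

definition row_length :: "etype \<Rightarrow> (nat \<Rightarrow> weight \<Rightarrow> int) \<Rightarrow> nat \<Rightarrow> nat" where
  "row_length X s r = (\<Sum>q=1..r. Suc (filled X s q))"

text \<open>Boxes are numbered from the right end of a row, starting with 0, so that the boxes counted by
  \<open>s r d\<close> are those with a number less than \<open>s r d\<close>.\<close>

definition tableau_of :: "etype \<Rightarrow> (nat \<Rightarrow> weight \<Rightarrow> int) \<Rightarrow> tableau" where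
  "tableau_of X s r = (if r \<in> {1..nrows X}
    then map (\<lambda>k. box X s r (row_length X s r - Suc k)) [0..<row_length X s r] else [])"

definition incr :: "(nat \<Rightarrow> weight \<Rightarrow> int) \<Rightarrow> nat \<Rightarrow> weight \<Rightarrow> int \<Rightarrow> nat \<Rightarrow> weight \<Rightarrow> int" where
  "incr s r d z = s(r := (s r)(d := s r d + z))"

lemma count_familyD:
  assumes "count_family X s" "r \<in> {1..nrows X}"
  shows "\<And>c. c \<in> reduced_nodes X r \<Longrightarrow> 0 \<le> s r c"
    and "\<And>c1 c2. c1 \<in> reduced_nodes X r \<Longrightarrow> c2 \<in> reduced_nodes X r \<Longrightarrow> below X c1 c2 \<Longrightarrow> s r c1 \<le> s r c2"
  using assms by (auto simp: count_family_def)

lemma row_length_Suc: "row_length X s (Suc r) = row_length X s r + Suc (filled X s (Suc r))"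
  by (simp add: row_length_def)

lemma row_length_pred: "1 \<le> r \<Longrightarrow> row_length X s r = row_length X s (r - 1) + Suc (filled X s r)"
  using row_length_Suc[of X s "r - 1"] by simp

lemma row_length_pos: "1 \<le> r \<Longrightarrow> 0 < row_length X s r"
  by (simp add: row_length_pred)

lemma length_tableau_of: "r \<in> {1..nrows X} \<Longrightarrow> length (tableau_of X s r) = row_length X s r"
  by (simp add: tableau_of_def)

lemma nth_tableau_of: "r \<in> {1..nrows X} \<Longrightarrow> k < row_length X s r \<Longrightarrow>
    tableau_of X s r ! k = box X s r (row_length X s r - Suc k)"
  by (simp add: tableau_of_def)

lemma level_antimono: "m \<le> m' \<Longrightarrow> level X s r m' \<subseteq> level X s r m"
  by (auto simp: level_def)

lemma level_empty_iff:
  assumes "r \<in> {1..nrows X}"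
  shows "level X s r m = {} \<longleftrightarrow> filled X s r \<le> m"
proof -
  have "filled X s r \<le> m \<longleftrightarrow> Max (insert 0 (s r ` reduced_nodes X r)) \<le> int m"
    by (simp add: filled_def nat_le_iff)
  also have "\<dots> \<longleftrightarrow> (\<forall>d\<in>reduced_nodes X r. s r d \<le> int m)"
    using finite_reduced_nodes[OF assms] by simp
  finally show ?thesis by (auto simp: level_def not_less)
qed

lemma filled_eqI:
  assumes "r \<in> {1..nrows X}" "\<And>m. level X s r m = {} \<longleftrightarrow> n \<le> m"
  shows "filled X s r = n"
  using assms level_empty_iff[OF assms(1), of s] by (metis order_antisym order_refl)

lemma filled_ge:
  assumes "r \<in> {1..nrows X}" "d \<in> reduced_nodes X r"
  shows "s r d \<le> int (filled X s r)"
proof -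
  have "d \<notin> level X s r (filled X s r)" using level_empty_iff[OF assms(1), of s "filled X s r"] by blast
  then show ?thesis using assms by (simp add: level_def)
qed

lemma filled_less: "1 \<le> r \<Longrightarrow> filled X s r < row_length X s r"
  by (simp add: row_length_pred)

lemma count_less_row_length:
  "r \<in> {1..nrows X} \<Longrightarrow> d \<in> reduced_nodes X r \<Longrightarrow> s r d < int (row_length X s r)"
  using filled_ge[of r X d s] filled_less[of r X s] by auto

context
  fixes X :: etype and s :: "nat \<Rightarrow> weight \<Rightarrow> int"
  assumes s: "count_family X s"
begin

lemma up_closed_level: "r \<in> {1..nrows X} \<Longrightarrow> up_closed X r (level X s r m)"
  using count_familyD(2)[OF s] by (fastforce simp: up_closed_def level_def)

lemma box_in_row: "r \<in> {1..nrows X} \<Longrightarrow> box X s r m \<in> row_nodes X r"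
  unfolding box_def by (rule node_of(1)[OF _ up_closed_level])

lemma pivots_above_box: "r \<in> {1..nrows X} \<Longrightarrow> pivots_above X r (box X s r m) = level X s r m"
  unfolding box_def by (rule node_of(2)[OF _ up_closed_level])

lemma box_source_iff: "r \<in> {1..nrows X} \<Longrightarrow> box X s r m = source X r \<longleftrightarrow> filled X s r \<le> m"
  using eq_source_iff[OF _ box_in_row] pivots_above_box level_empty_iff by metis

lemma box_below: "r \<in> {1..nrows X} \<Longrightarrow> m \<le> m' \<Longrightarrow> below X (box X s r m) (box X s r m')"
  using below_iff_pivots[OF _ box_in_row box_in_row] pivots_above_box level_antimono by metis

lemma count_source_tableau_of:
  assumes r: "r \<in> {1..nrows X}"
  shows "count_list (tableau_of X s r) (source X r) = row_length X s r - filled X s r"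
proof -
  let ?L = "row_length X s r"
  have "count_list (tableau_of X s r) (source X r) =
      length (filter (\<lambda>k. source X r = box X s r (?L - Suc k)) [0..<?L])"
    using r by (simp add: tableau_of_def count_list_eq_length_filter filter_map o_def)
  also have "\<dots> = card {k. k < ?L \<and> filled X s r \<le> ?L - Suc k}"
    unfolding eq_commute[of "source X r"] box_source_iff[OF r]
    by (subst length_filter_conv_card) (intro arg_cong[of _ _ card] Collect_cong, auto)
  also have "{k. k < ?L \<and> filled X s r \<le> ?L - Suc k} = {..<?L - filled X s r}" by auto
  finally show ?thesis by simp
qed

lemma tableau_of_row:
  assumes r: "r \<in> {1..nrows X}"
  shows "set (tableau_of X s r) \<subseteq> row_nodes X r"
    and "sorted_wrt (\<lambda>x y. below X y x) (tableau_of X s r)"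
    and "hd (tableau_of X s r) = source X r"
proof -
  show "set (tableau_of X s r) \<subseteq> row_nodes X r"
    using r box_in_row by (auto simp: tableau_of_def)
  show "sorted_wrt (\<lambda>x y. below X y x) (tableau_of X s r)"
    using r box_below by (auto simp: sorted_wrt_iff_nth_less length_tableau_of nth_tableau_of)
  have "hd (tableau_of X s r) = tableau_of X s r ! 0"
    using row_length_pos[of r X s] r length_tableau_of[OF r, of s] by (intro hd_conv_nth) auto
  then show "hd (tableau_of X s r) = source X r"
    using row_length_pos[of r X s] filled_less[of r X s] r by (simp add: nth_tableau_of box_source_iff)
qed

lemma length_tableau_of_below:
  assumes "r \<in> {1..nrows X}"
  shows "length (tableau_of X s (r - 1)) = row_length X s (r - 1)"
proof (cases "r = 1")
  case True
  then show ?thesis by (simp add: tableau_of_def row_length_def)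
next
  case False
  then have "r - 1 \<in> {1..nrows X}" using assms by auto
  then show ?thesis by (rule length_tableau_of)
qed

lemma marginally_large_tableau_of: "marginally_large X (tableau_of X s)"
proof -
  have "\<forall>x\<in>set (tableau_of X s r). \<forall>y\<in>set (tableau_of X s r). below X x y \<or> below X y x"
    if "r \<in> {1..nrows X}" for r
    using that box_below[OF that] by (auto simp: tableau_of_def) (meson nat_le_linear)
  then show ?thesis
    using tableau_of_row count_source_tableau_of length_tableau_of_below row_length_pred[of _ X s]
    unfolding marginally_large_def large_def by (auto simp: tableau_of_def)
qed

lemma box_count_tableau_of:
  assumes r: "r \<in> {1..nrows X}" and c: "c \<in> reduced_nodes X r"
  shows "int (box_count X (tableau_of X s) r c) = s r c"
proof -
  let ?L = "row_length X s r"
  have "box_count X (tableau_of X s) r c =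
      length (filter (\<lambda>k. below X (box X s r (?L - Suc k)) c) [0..<?L])"
    using r box_in_row by (simp add: box_count_def tableau_of_def filter_map o_def)
  also have "\<dots> = card {k. k < ?L \<and> int (?L - Suc k) < s r c}"
  proof -
    have "below X (box X s r m) c \<longleftrightarrow> int m < s r c" for m
      using pivots_above_box[OF r, of m] c by (auto simp: pivots_above_def level_def)
    then show ?thesis by (simp add: length_filter_conv_card conj_commute cong: conj_cong)
  qed
  also have "{k. k < ?L \<and> int (?L - Suc k) < s r c} = {?L - nat (s r c)..<?L}"
    using count_less_row_length[OF r c, of s] count_familyD(1)[OF s r c] by auto
  finally show ?thesis
    using count_less_row_length[OF r c, of s] count_familyD(1)[OF s r c] by simp
qed

end

lemma count_family_box_count: "count_family X (\<lambda>r c. int (box_count X T r c))"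
proof -
  have "box_count X T r c1 \<le> box_count X T r c2" if "below X c1 c2" for r c1 c2
  proof -
    have "card {k. k < length (T r) \<and> T r ! k \<in> row_nodes X r \<and> below X (T r ! k) c1}
        \<le> card {k. k < length (T r) \<and> T r ! k \<in> row_nodes X r \<and> below X (T r ! k) c2}"
      using that below_trans by (intro card_mono) auto
    then show ?thesis by (simp add: box_count_def length_filter_conv_card)
  qed
  then show ?thesis by (simp add: count_family_def)
qed

text \<open>Entries go down from left to right, so the boxes below a pivot c form a right end
  segment, and the box numbered m from the right belongs to it iff m is less than the count of c.
  Every entry therefore has the right level set as its set of pivots. The row lengths agree by
  induction from the bottom row, using the number of source boxes.\<close>

lemma tableau_of_box_count:
  assumes T: "marginally_large X T"
  shows "tableau_of X (\<lambda>r c. int (box_count X T r c)) = T"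
proof -
  define s where "s = (\<lambda>r c. int (box_count X T r c))"
  have s: "count_family X s" unfolding s_def by (rule count_family_box_count)
  have row: "set (T r) \<subseteq> row_nodes X r" "sorted_wrt (\<lambda>x y. below X y x) (T r)"
      "count_list (T r) (source X r) = length (T (r - 1)) + 1" if "r \<in> {1..nrows X}" for r
    using T that by (auto simp: marginally_large_def large_def)
  have out: "T r = []" if "r \<notin> {1..nrows X}" for r
    using T that by (auto simp: marginally_large_def large_def)
  have entry: "T r ! k = box X s r (length (T r) - Suc k)" if r: "r \<in> {1..nrows X}" and k: "k < length (T r)" for r k
  proof -
    let ?n = "length (T r)"
    have in_row: "T r ! j \<in> row_nodes X r" if "j < ?n" for j using row(1)[OF r] that nth_mem by blast
    have "pivots_above X r (T r ! k) = level X s r (?n - Suc k)"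
    proof -
      have "below X (T r ! k) c \<longleftrightarrow> int (?n - Suc k) < s r c" if c: "c \<in> reduced_nodes X r" for c
      proof -
        define B where "B = {j. j < ?n \<and> below X (T r ! j) c}"
        have cB: "box_count X T r c = card B"
          unfolding box_count_def B_def length_filter_conv_card using in_row by (metis (no_types, lifting))
        have up: "j' \<in> B" if "j \<in> B" "j \<le> j'" "j' < ?n" for j j'
          using row(2)[OF r] that below_trans[of X "T r ! j'" "T r ! j" c] by (cases "j = j'") (auto simp: B_def sorted_wrt_iff_nth_less)
        show ?thesis
        proof
          assume "below X (T r ! k) c"
          then have "{k..<?n} \<subseteq> B" using up[of k] k by (auto simp: B_def)
          then have "card {k..<?n} \<le> card B" by (rule card_mono[rotated]) (simp add: B_def)
          then show "int (?n - Suc k) < s r c" using k by (simp add: s_def cB)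
        next
          assume *: "int (?n - Suc k) < s r c"
          show "below X (T r ! k) c"
          proof (rule ccontr)
            assume "\<not> below X (T r ! k) c"
            then have "k \<notin> B" by (simp add: B_def)
            then have "B \<subseteq> {Suc k..<?n}" using up[of _ k] k by (force simp: B_def not_less_eq_eq)
            then have "card B \<le> card {Suc k..<?n}" by (rule card_mono[rotated]) simp
            then show False using * by (simp add: s_def cB)
          qed
        qed
      qed
      then show ?thesis by (auto simp: pivots_above_def level_def)
    qed
    then show ?thesis using node_of_pivots_above[OF r in_row[OF k]] by (simp add: box_def)
  qed
  have len: "length (T r) = row_length X s r" if "r \<le> nrows X" for r
    using that
  proof (induction r)
    case 0
    then show ?case using out[of 0] by (simp add: row_length_def)
  next
    case (Suc r)
    then have r: "Suc r \<in> {1..nrows X}" by simp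
    let ?n = "length (T (Suc r))"
    have "{k. k < ?n \<and> source X (Suc r) = T (Suc r) ! k} = {..<?n - filled X s (Suc r)}"
    proof -
      have "k < ?n \<and> source X (Suc r) = T (Suc r) ! k \<longleftrightarrow> k < ?n \<and> filled X s (Suc r) \<le> ?n - Suc k" for k
        using entry[OF r, of k] box_source_iff[OF s r, of "?n - Suc k"] by metis
      then show ?thesis unfolding set_eq_iff mem_Collect_eq lessThan_iff by arith
    qed
    then have "count_list (T (Suc r)) (source X (Suc r)) = ?n - filled X s (Suc r)"
      by (simp add: count_list_eq_length_filter length_filter_conv_card)
    then show ?case using row(3)[OF r] Suc row_length_Suc[of X s r] by simp
  qed
  have "tableau_of X s r = T r" for r
  proof (cases "r \<in> {1..nrows X}")
    case True
    then show ?thesis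
      using len[of r] entry[OF True] by (intro nth_equalityI) (simp_all add: length_tableau_of nth_tableau_of)
  next
    case False
    then show ?thesis using out[OF False] by (auto simp: tableau_of_def)
  qed
  then show ?thesis by (auto simp: s_def)
qed

text \<open>The only box that changes is the one just left of the \<open>s r d\<close> boxes counted for \<open>d\<close>; it moves along
  an arrow of group \<open>d\<close>.\<close>

lemma tableau_of_incr:
  assumes s: "count_family X s" and s': "count_family X (incr s r d 1)"
    and r: "r \<in> {1..nrows X}" and d: "d \<in> reduced_nodes X r" and m: "int m = s r d"
  defines "T' \<equiv> put_box (tableau_of X s) r (row_length X s r - Suc m) (box X (incr s r d 1) r m)"
  shows "tableau_of X (incr s r d 1) = (if box X s r m = source X r then insert_column X r T' else T')"
    and "row_length X (incr s r d 1) q =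
      row_length X s q + (if box X s r m = source X r \<and> r \<le> q then 1 else 0)"
    and "level X (incr s r d 1) r m = insert d (level X s r m)" "d \<notin> level X s r m"
    and "q \<noteq> r \<or> m' \<noteq> m \<Longrightarrow> box X (incr s r d 1) q m' = box X s q m'"
proof -
  let ?s = "incr s r d 1"
  show lev: "level X ?s r m = insert d (level X s r m)" "d \<notin> level X s r m"
    using d m by (auto simp: level_def incr_def)
  have lev': "level X ?s q m' = level X s q m'" if "q \<noteq> r \<or> m' \<noteq> m" for q m'
    using that m by (auto simp: level_def incr_def)
  show box: "box X ?s q m' = box X s q m'" if "q \<noteq> r \<or> m' \<noteq> m" for q m'
    using lev'[OF that] by (simp add: box_def)
  have fq: "filled X ?s q = filled X s q" if "q \<noteq> r" for q
    using that by (simp add: filled_def incr_def)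
  have fr: "filled X ?s r = filled X s r + (if box X s r m = source X r then 1 else 0)"
  proof (cases "box X s r m = source X r")
    case True
    then have "filled X s r \<le> m" using box_source_iff[OF s r] by simp
    moreover have "int m \<le> int (filled X s r)" using filled_ge[OF r d, of s] m by simp
    ultimately have eq: "filled X s r = m" by simp
    have "filled X ?s r = Suc m"
    proof (rule filled_eqI[OF r])
      fix n show "level X ?s r n = {} \<longleftrightarrow> Suc m \<le> n"
        using lev lev'[of r n] level_empty_iff[OF r, of s n] eq by (cases "n = m") auto
    qed
    then show ?thesis using True eq by simp
  next
    case False
    have "filled X ?s r = filled X s r"
    proof (rule filled_eqI[OF r])
      fix n show "level X ?s r n = {} \<longleftrightarrow> filled X s r \<le> n"
        using lev lev'[of r n] level_empty_iff[OF r, of s n] False box_source_iff[OF s r] by (cases "n = m") auto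
    qed
    then show ?thesis using False by simp
  qed
  show len: "row_length X ?s q = row_length X s q + (if box X s r m = source X r \<and> r \<le> q then 1 else 0)" for q
  proof (induction q)
    case (Suc q)
    then show ?case using fq[of "Suc q"] fr by (cases "Suc q = r") (auto simp: row_length_Suc)
  qed (use r in \<open>simp add: row_length_def\<close>)
  have mL: "m < row_length X s r" using count_less_row_length[OF r d, of s] m by simp
  have inr: "q \<in> {1..nrows X}" if "r \<le> q" "q \<le> nrows X" for q using that r by auto
  show "tableau_of X ?s = (if box X s r m = source X r then insert_column X r T' else T')"
  proof
    fix q
    show "tableau_of X ?s q = (if box X s r m = source X r then insert_column X r T' else T') q"
    proof (cases "q \<in> {1..nrows X}")
      case False
      then show ?thesis using r by (auto simp: tableau_of_def insert_column_def T'_def put_box_def)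
    next
      case q: True
      have row: "T' q ! k = box X ?s q (row_length X s q - Suc k)" if "k < row_length X s q" for k
      proof (cases "q = r \<and> k = row_length X s r - Suc m")
        case True
        then show ?thesis using mL by (simp add: T'_def put_box_def length_tableau_of[OF r])
      next
        case False
        then have "q \<noteq> r \<or> row_length X s q - Suc k \<noteq> m" using that by auto
        moreover have "T' q ! k = tableau_of X s q ! k" using False by (auto simp: T'_def put_box_def)
        ultimately show ?thesis using nth_tableau_of[OF q that] box by simp
      qed
      have lenT': "length (T' q) = row_length X s q"
        using length_tableau_of[OF q, of s] by (auto simp: T'_def put_box_def)
      show ?thesis
      proof (cases "box X s r m = source X r \<and> r \<le> q")
        case True
        \<comment> \<open>Numbered from the right, all old boxes keep their numbers; the one extra
          box is at the left end, has number \<open>row_length X s q\<close> and contains the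
          source.\<close>
        have "filled X ?s q \<le> row_length X s q" using filled_less[of q X ?s] len[of q] q True by simp
        then have "box X ?s q (row_length X s q) = source X q" using box_source_iff[OF s' q] by simp
        then have "tableau_of X ?s q = source X q # T' q"
          using True lenT' row len[of q]
          by (intro nth_equalityI) (auto simp: length_tableau_of[OF q] nth_tableau_of[OF q] nth_Cons split: nat.split)
        then show ?thesis using True q by (simp add: insert_column_def)
      next
        case False
        then have "tableau_of X ?s q = T' q"
          using lenT' row len[of q]
          by (intro nth_equalityI) (auto simp: length_tableau_of[OF q] nth_tableau_of[OF q])
        then show ?thesis using False by (auto simp: insert_column_def)
      qed
    qed
  qed
qed

section \<open>Signatures of tableaux\<close>

text \<open>Uniqueness makes the description in \<open>f_position\<close> meaningful: among equal
  maxima the last one is chosen.\<close>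

lemma ex1_last_argmax:
  fixes f :: "nat \<Rightarrow> 'b::linorder"
  assumes "0 < n"
  shows "\<exists>!k. k < n \<and> (\<forall>v<k. f v \<le> f k) \<and> (\<forall>v<n. k < v \<longrightarrow> f v < f k)"
proof (rule ex_ex1I)
  define M where "M = Max (f ` {..<n})"
  define k where "k = Max {k. k < n \<and> f k = M}"
  have le: "f v \<le> M" if "v < n" for v using that by (auto simp: M_def)
  have "M \<in> f ` {..<n}" unfolding M_def using assms by (intro Max_in) auto
  then have "k \<in> {k. k < n \<and> f k = M}" unfolding k_def by (intro Max_in) auto
  then have k: "k < n" "f k = M" by auto
  have "f v < f k" if "v < n" "k < v" for v
  proof -
    have "f v \<noteq> M"
    proof
      assume "f v = M"
      then have "v \<le> k" unfolding k_def using that by (intro Max_ge) auto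
      then show False using that by simp
    qed
    then show ?thesis using le[OF that(1)] k by simp
  qed
  then show "\<exists>k. k < n \<and> (\<forall>v<k. f v \<le> f k) \<and> (\<forall>v<n. k < v \<longrightarrow> f v < f k)"
    using k le by (intro exI[of _ k]) auto
next
  fix k l
  assume "k < n \<and> (\<forall>v<k. f v \<le> f k) \<and> (\<forall>v<n. k < v \<longrightarrow> f v < f k)"
    and "l < n \<and> (\<forall>v<l. f v \<le> f l) \<and> (\<forall>v<n. l < v \<longrightarrow> f v < f l)"
  then show "k = l" by (metis leD nat_neq_iff)
qed

lemma ex1_first_argmax:
  fixes f :: "nat \<Rightarrow> 'b::linorder"
  assumes "0 < n"
  shows "\<exists>!k. k < n \<and> (\<forall>v<k. f v < f k) \<and> (\<forall>v<n. k < v \<longrightarrow> f v \<le> f k)"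
proof (rule ex_ex1I)
  define M where "M = Max (f ` {..<n})"
  have le: "f v \<le> M" if "v < n" for v using that by (auto simp: M_def)
  have "M \<in> f ` {..<n}" unfolding M_def using assms by (intro Max_in) auto
  then have ex: "\<exists>k. k < n \<and> f k = M" by auto
  define k where "k = (LEAST k. k < n \<and> f k = M)"
  have k: "k < n" "f k = M" using LeastI_ex[OF ex] by (auto simp: k_def)
  have "f v < f k" if "v < k" for v
    using not_less_Least[of v "\<lambda>k. k < n \<and> f k = M"] that k le[of v] by (auto simp: k_def[symmetric])
  then show "\<exists>k. k < n \<and> (\<forall>v<k. f v < f k) \<and> (\<forall>v<n. k < v \<longrightarrow> f v \<le> f k)"
    using k le by (intro exI[of _ k]) auto
next
  fix k l
  assume "k < n \<and> (\<forall>v<k. f v < f k) \<and> (\<forall>v<n. k < v \<longrightarrow> f v \<le> f k)"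
    and "l < n \<and> (\<forall>v<l. f v < f l) \<and> (\<forall>v<n. l < v \<longrightarrow> f v \<le> f l)"
  then show "k = l" by (metis leD nat_neq_iff)
qed

lemma sorted_wrt_index:
  assumes "sorted_wrt R P" "\<And>a b. R a b \<Longrightarrow> \<not> R b a" "v < length P" "w < length P"
  shows "R (P ! w) (P ! v) \<longleftrightarrow> w < v"
  using assms by (metis linorder_neqE_nat sorted_wrt_nth_less)

text \<open>Turns a partial sum along a sorted list into a sum over the set of predecessors.
  Asymmetry of R makes the entries distinct, so nothing is counted twice.\<close>

lemma sum_sorted_prefix:
  assumes "sorted_wrt R P" "\<And>a b. R a b \<Longrightarrow> \<not> R b a" "v < length P"
  shows "(\<Sum>u<v. g (P ! u)) = (\<Sum>b\<in>{b \<in> set P. R b (P ! v)}. g b)"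
proof -
  have "inj_on ((!) P) {..<v}"
  proof (rule inj_onI)
    fix a b assume ab: "a \<in> {..<v}" "b \<in> {..<v}" "P ! a = P ! b"
    then show "a = b"
      using sorted_wrt_index[OF assms(1,2), of a b] sorted_wrt_index[OF assms(1,2), of b a]
        sorted_wrt_index[OF assms(1,2), of a a] assms(3) by auto
  qed
  moreover have "(!) P ` {..<v} = {b \<in> set P. R b (P ! v)}"
  proof (intro equalityI subsetI)
    fix b assume "b \<in> (!) P ` {..<v}"
    then obtain u where "u < v" "b = P ! u" by auto
    then show "b \<in> {b \<in> set P. R b (P ! v)}"
      using sorted_wrt_index[OF assms(1,2,3), of u] assms(3) by auto
  next
    fix b assume "b \<in> {b \<in> set P. R b (P ! v)}"
    then show "b \<in> (!) P ` {..<v}"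
      using sorted_wrt_index[OF assms(1,2,3)] by (auto simp: in_set_conv_nth)
  qed
  ultimately show ?thesis by (metis (no_types, lifting) sum.reindex_cong)
qed

lemma sorted_wrt_rows:
  fixes rs :: "nat list"
  assumes "\<And>r. r \<in> set rs \<Longrightarrow> sorted_wrt (Q r) (row r)" "sorted_wrt (>) rs"
  shows "sorted_wrt (\<lambda>(r, a) (q, b). q < r \<or> q = r \<and> Q r a b) (concat (map (\<lambda>r. map (Pair r) (row r)) rs))"
  using assms by (induction rs) (auto simp: sorted_wrt_append sorted_wrt_map)

lemma sorted_wrt_rev_upt: "sorted_wrt (>) (rev [m..<n])"
  by (simp add: sorted_wrt_rev)

lemma ft_basic_crystal: "arrow X i c c' \<Longrightarrow> ft (basic_crystal X) i c = Some c'"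
  by (auto simp: basic_crystal_def arrow_def)

lemma et_basic_crystal:
  assumes "arrow X i c c'"
  shows "et (basic_crystal X) i c' = Some c"
proof -
  have "(THE c. arrow X i c c') = c"
    using assms by (intro the_equality) (auto simp: arrow_def fun_eq_iff algebra_simps)
  then show ?thesis using assms by (auto simp: basic_crystal_def)
qed

lemma et_basic_crystal_None: "c i \<noteq> -1 \<Longrightarrow> et (basic_crystal X) i c = None"
  using arrowD(5) by (fastforce simp: basic_crystal_def)

text \<open>Minus the i-weight of the m rightmost boxes of the row: a pivot e lies above
  \<open>min (int m) (s r e)\<close> of them.\<close>

definition row_height :: "etype \<Rightarrow> (nat \<Rightarrow> weight \<Rightarrow> int) \<Rightarrow> nat \<Rightarrow> nat \<Rightarrow> nat \<Rightarrow> int" where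
  "row_height X s i r m =
    (\<Sum>e\<in>reduced_nodes X r. cartan X i (pivot_color X r e) * min (int m) (s r e)) - int m * source X r i"

text \<open>Minus the \<open>i\<close>-weight of the part of the reading word preceding box \<open>m\<close> of row \<open>r\<close>.  The
  signature value of that box is the larger of the heights before and after it.\<close>

definition height :: "etype \<Rightarrow> (nat \<Rightarrow> weight \<Rightarrow> int) \<Rightarrow> nat \<Rightarrow> nat \<Rightarrow> nat \<Rightarrow> int" where
  "height X s i r m =
    (\<Sum>q\<in>{r<..nrows X}. row_height X s i q (row_length X s q)) + row_height X s i r m"

definition box_sig :: "etype \<Rightarrow> (nat \<Rightarrow> weight \<Rightarrow> int) \<Rightarrow> nat \<Rightarrow> nat \<Rightarrow> nat \<Rightarrow> int" where
  "box_sig X s i r m = max (height X s i r m) (height X s i r (Suc m))"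

text \<open>The signature value of the factor \<open>B\<^sub>d\<close> of the element with exponents \<open>- s\<close>; it does not depend
  on the chosen path, since pivots of equal or adjacent colors are comparable.\<close>

definition peak :: "etype \<Rightarrow> (nat \<Rightarrow> weight \<Rightarrow> int) \<Rightarrow> nat \<Rightarrow> nat \<Rightarrow> weight \<Rightarrow> int" where
  "peak X s i r d = s r d +
    (\<Sum>q\<in>{r<..nrows X}. \<Sum>e\<in>reduced_nodes X q. cartan X i (pivot_color X q e) * s q e) +
    (\<Sum>e\<in>{e \<in> reduced_nodes X r. below X e d \<and> e \<noteq> d}. cartan X i (pivot_color X r e) * s r e)"

text \<open>The order of the tensor factors as far as it is independent of the paths: higher rows
  come first, and within a row the group of a later arrow, which is lower, comes first.\<close>

definition earlier :: "etype \<Rightarrow> nat \<Rightarrow> weight \<Rightarrow> nat \<Rightarrow> weight \<Rightarrow> bool" where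
  "earlier X q e r d \<longleftrightarrow> r < q \<or> q = r \<and> below X e d \<and> e \<noteq> d"

definition factors_of_color :: "etype \<Rightarrow> nat \<Rightarrow> (nat \<times> weight) set" where
  "factors_of_color X i = {(r, d). r \<in> {1..nrows X} \<and> d \<in> reduced_nodes X r \<and> pivot_color X r d = i}"

text \<open>The condition for \<open>ft\<close> to act on the factor of d. The comparison with 0 is
  that with the leftmost factor; it is weak here and strict in \<open>first_peak\<close>, because
  \<open>ft\<close> prefers the rightmost and \<open>et\<close> the leftmost maximum.\<close>

definition last_peak :: "etype \<Rightarrow> (nat \<Rightarrow> weight \<Rightarrow> int) \<Rightarrow> nat \<Rightarrow> nat \<Rightarrow> weight \<Rightarrow> bool" where
  "last_peak X s i r d \<longleftrightarrow> (r, d) \<in> factors_of_color X i \<and> 0 \<le> peak X s i r d \<and>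
    (\<forall>(q, e)\<in>factors_of_color X i.
      (earlier X q e r d \<longrightarrow> peak X s i q e \<le> peak X s i r d) \<and>
      (earlier X r d q e \<longrightarrow> peak X s i q e < peak X s i r d))"

definition first_peak :: "etype \<Rightarrow> (nat \<Rightarrow> weight \<Rightarrow> int) \<Rightarrow> nat \<Rightarrow> nat \<Rightarrow> weight \<Rightarrow> bool" where
  "first_peak X s i r d \<longleftrightarrow> (r, d) \<in> factors_of_color X i \<and> 0 < peak X s i r d \<and>
    (\<forall>(q, e)\<in>factors_of_color X i.
      (earlier X q e r d \<longrightarrow> peak X s i q e < peak X s i r d) \<and>
      (earlier X r d q e \<longrightarrow> peak X s i q e \<le> peak X s i r d))"

lemma height_end: "1 < r \<Longrightarrow> r \<le> nrows X \<Longrightarrow>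
    height X s i (r - 1) m = height X s i r (row_length X s r) + row_height X s i (r - 1) m"
proof -
  assume "1 < r" "r \<le> nrows X"
  then have "{r - 1<..nrows X} = insert r {r<..nrows X}" by auto
  then show ?thesis by (simp add: height_def)
qed

section \<open>Heights along the reading word and their maxima\<close>

context
  fixes X :: etype and s :: "nat \<Rightarrow> weight \<Rightarrow> int" and i :: nat
  assumes s: "count_family X s" and i: "i \<in> index_set X"
begin

lemma row_height_0: "r \<in> {1..nrows X} \<Longrightarrow> row_height X s i r 0 = 0"
  using count_familyD(1)[OF s] by (simp add: row_height_def min_def)

lemma height_top: "height X s i (nrows X) 0 = 0"
  using row_height_0[of "nrows X"] by (cases X) (simp_all add: height_def)

lemma height_start: "1 < r \<Longrightarrow> r \<le> nrows X \<Longrightarrow>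
    height X s i (r - 1) 0 = height X s i r (row_length X s r)"
proof -
  assume r: "1 < r" "r \<le> nrows X"
  then have "r - 1 \<in> {1..nrows X}" by auto
  then show ?thesis using row_height_0 height_end[OF r, of s i 0] by simp
qed

text \<open>From m to m + 1 the term \<open>min (int m) (s r d)\<close> grows by 1 exactly for the
  pivots d of the level set, which are those above the box.\<close>

lemma box_value:
  assumes r: "r \<in> {1..nrows X}"
  shows "box X s r m i = row_height X s i r m - row_height X s i r (Suc m)"
proof -
  have "(\<Sum>d\<in>level X s r m. cartan X i (pivot_color X r d)) =
      (\<Sum>d\<in>reduced_nodes X r. if int m < s r d then cartan X i (pivot_color X r d) else 0)"
    using finite_reduced_nodes[OF r] by (simp add: level_def sum.inter_filter)
  also have "\<dots> = (\<Sum>d\<in>reduced_nodes X r. cartan X i (pivot_color X r d) * min (int (Suc m)) (s r d)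
      - cartan X i (pivot_color X r d) * min (int m) (s r d))"
    by (intro sum.cong refl) (auto simp: min_def algebra_simps)
  finally have "(\<Sum>d\<in>level X s r m. cartan X i (pivot_color X r d)) =
      row_height X s i r (Suc m) - row_height X s i r m + source X r i"
    by (simp add: row_height_def sum_subtractf algebra_simps)
  then show ?thesis
    using row_weight[OF r box_in_row[OF s r] i, of m] pivots_above_box[OF s r, of m] by simp
qed

lemma box_value_height: "r \<in> {1..nrows X} \<Longrightarrow> box X s r m i = height X s i r m - height X s i r (Suc m)"
  by (simp add: box_value height_def)

lemma sum_boxes: "r \<in> {1..nrows X} \<Longrightarrow> (\<Sum>k<m. box X s r k i) = - row_height X s i r m"
  by (induction m) (simp_all add: row_height_0 box_value)

lemma box_unit:
  assumes "r \<in> {1..nrows X}"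
  shows "box X s r m i = 0 \<or> box X s r m i = 1 \<or> box X s r m i = -1"
  using node_value box_in_row[OF s assms] row_nodes_subset[OF assms] by blast

lemma reading_positions_sorted:
  "sorted_wrt (\<lambda>(r, k) (q, l). q < r \<or> q = r \<and> l < k) (reading_positions X T)"
  unfolding reading_positions_def by (intro sorted_wrt_rows sorted_wrt_rev_upt)

lemma set_reading_positions:
  "set (reading_positions X (tableau_of X s)) = {(r, k). r \<in> {1..nrows X} \<and> k < row_length X s r}"
  by (auto simp: reading_positions_def length_tableau_of)

text \<open>The part read before the box consists of the higher rows and the boxes to its right; its
  i-weight is minus the height. Adding \<open>eps\<close>, the negative part of the i-weight of the
  box, gives the larger of the heights before and after it.\<close>

lemma signature_reading:
  assumes v: "v < length (reading_positions X (tableau_of X s))"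
    and rk: "reading_positions X (tableau_of X s) ! v = (r, k)"
  defines "T \<equiv> tableau_of X s"
  shows "signature_value (reading_factors X T) i (reading_word X T) v =
    Fin (box_sig X s i r (row_length X s r - Suc k))"
proof -
  let ?P = "reading_positions X T"
  let ?L = "row_length X s"
  have len: "length (reading_word X T) = length ?P" by (simp add: reading_word_def)
  have "(r, k) \<in> set ?P" using v rk nth_mem unfolding T_def by metis
  then have r: "r \<in> {1..nrows X}" and k: "k < ?L r" by (auto simp: T_def set_reading_positions)
  have word: "reading_word X T ! u = (case ?P ! u of (q, l) \<Rightarrow> T q ! l)" if "u < length ?P" for u
    using that by (simp add: reading_word_def)
  have fac: "reading_factors X T ! u = basic_crystal X" if "u < length ?P" for u
    using that by (simp add: reading_factors_def len)
  have wtb: "wt (basic_crystal X) c = c" and epsb: "eps (basic_crystal X) i c = Fin (max 0 (- c i))" for c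
    by (simp_all add: basic_crystal_def)
  have "(\<Sum>u<v. wt (reading_factors X T ! u) (reading_word X T ! u) i) =
      (\<Sum>u<v. (case ?P ! u of (q, l) \<Rightarrow> (T q ! l) i))"
    using v by (intro sum.cong refl) (simp add: T_def[symmetric] fac word wtb split: prod.split)
  also have "\<dots> = (\<Sum>b\<in>{b \<in> set ?P. (\<lambda>(r, k) (q, l). q < r \<or> q = r \<and> l < k) b (?P ! v)}.
      (case b of (q, l) \<Rightarrow> (T q ! l) i))"
    using v by (intro sum_sorted_prefix reading_positions_sorted) (auto simp: T_def)
  also have "{b \<in> set ?P. (\<lambda>(r, k) (q, l). q < r \<or> q = r \<and> l < k) b (?P ! v)} =
      Sigma {r<..nrows X} (\<lambda>q. {..<?L q}) \<union> {r} \<times> {k<..<?L r}"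
    using r rk by (auto simp: T_def set_reading_positions)
  also have "(\<Sum>b\<in>\<dots>. (case b of (q, l) \<Rightarrow> (T q ! l) i)) =
      (\<Sum>q\<in>{r<..nrows X}. \<Sum>l<?L q. (T q ! l) i) + (\<Sum>l\<in>{k<..<?L r}. (T r ! l) i)"
  proof -
    have "(\<Sum>b\<in>{r} \<times> {k<..<?L r}. case b of (q, l) \<Rightarrow> (T q ! l) i) = (\<Sum>l\<in>{k<..<?L r}. (T r ! l) i)"
      by (rule sum.reindex_bij_witness[of _ "Pair r" snd]) auto
    then show ?thesis by (subst sum.union_disjoint) (auto simp: sum.Sigma)
  qed
  also have "(\<Sum>q\<in>{r<..nrows X}. \<Sum>l<?L q. (T q ! l) i) =
      (\<Sum>q\<in>{r<..nrows X}. - row_height X s i q (?L q))"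
  proof (intro sum.cong refl)
    fix q assume "q \<in> {r<..nrows X}"
    then have q: "q \<in> {1..nrows X}" by auto
    have "(\<Sum>l<?L q. (T q ! l) i) = (\<Sum>l<?L q. box X s q (?L q - Suc l) i)"
      using q by (intro sum.cong refl) (simp add: T_def nth_tableau_of)
    also have "\<dots> = (\<Sum>l<?L q. box X s q l i)" by (rule sum.nat_diff_reindex)
    finally show "(\<Sum>l<?L q. (T q ! l) i) = - row_height X s i q (?L q)" using sum_boxes[OF q] by simp
  qed
  also have "(\<Sum>l\<in>{k<..<?L r}. (T r ! l) i) = (\<Sum>m<?L r - Suc k. box X s r m i)"
    using r k by (intro sum.reindex_bij_witness[of _ "\<lambda>m. ?L r - Suc m" "\<lambda>l. ?L r - Suc l"])
      (auto simp: T_def nth_tableau_of)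
  also have "\<dots> = - row_height X s i r (?L r - Suc k)" by (rule sum_boxes[OF r])
  finally have "- (\<Sum>u<v. wt (reading_factors X T ! u) (reading_word X T ! u) i) =
      height X s i r (?L r - Suc k)"
    by (simp add: height_def sum_negf)
  moreover have "reading_word X T ! v = box X s r (?L r - Suc k)"
    using v rk word[of v] nth_tableau_of[OF r k] by (simp add: T_def)
  ultimately show ?thesis
    using v fac[of v] box_value_height[OF r, of "?L r - Suc k"]
    by (simp add: T_def signature_value_def epsb box_sig_def max_def)
qed

lemma position_of_box:
  assumes "r \<in> {1..nrows X}" "m < row_length X s r"
  obtains v where "v < length (reading_positions X (tableau_of X s))"
    "reading_positions X (tableau_of X s) ! v = (r, row_length X s r - Suc m)"
proof -
  have "(r, row_length X s r - Suc m) \<in> set (reading_positions X (tableau_of X s))"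
    using assms by (simp add: set_reading_positions)
  then show thesis using that by (auto simp: in_set_conv_nth)
qed

lemma box_of_position:
  assumes "v < length (reading_positions X (tableau_of X s))"
  obtains r m where "r \<in> {1..nrows X}" "m < row_length X s r"
    "reading_positions X (tableau_of X s) ! v = (r, row_length X s r - Suc m)"
proof -
  obtain r k where rk: "reading_positions X (tableau_of X s) ! v = (r, k)" by fastforce
  then have "(r, k) \<in> set (reading_positions X (tableau_of X s))" using assms nth_mem by metis
  then have "r \<in> {1..nrows X}" "k < row_length X s r" by (auto simp: set_reading_positions)
  then show thesis using that[of r "row_length X s r - Suc k"] rk by simp
qed

lemma position_less_iff:
  assumes "v < length (reading_positions X (tableau_of X s))"
    "reading_positions X (tableau_of X s) ! v = (r, row_length X s r - Suc m)" "m < row_length X s r"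
    and "w < length (reading_positions X (tableau_of X s))"
    "reading_positions X (tableau_of X s) ! w = (q, row_length X s q - Suc n)" "n < row_length X s q"
  shows "w < v \<longleftrightarrow> r < q \<or> q = r \<and> n < m"
  using sorted_wrt_index[OF reading_positions_sorted _ assms(1,4)] assms by fastforce

lemma positions_nonempty: "0 < length (reading_positions X (tableau_of X s))"
proof -
  have "1 \<in> {1..nrows X}" by (cases X) auto
  then obtain v where "v < length (reading_positions X (tableau_of X s))"
    using position_of_box[of 1 0] row_length_pos[of 1 X s] by blast
  then show ?thesis by linarith
qed

lemma length_reading_word: "length (reading_word X T) = length (reading_positions X T)"
  by (simp add: reading_word_def)

lemma box_signature:
  assumes "q \<in> {1..nrows X}" "n < row_length X s q"
  obtains w where "w < length (reading_positions X (tableau_of X s))"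
    "reading_positions X (tableau_of X s) ! w = (q, row_length X s q - Suc n)"
    "signature_value (reading_factors X (tableau_of X s)) i (reading_word X (tableau_of X s)) w =
      Fin (box_sig X s i q n)"
proof -
  obtain w where w: "w < length (reading_positions X (tableau_of X s))"
      "reading_positions X (tableau_of X s) ! w = (q, row_length X s q - Suc n)"
    using position_of_box assms by blast
  then show thesis using that signature_reading[OF w] assms(2) by simp
qed

lemma f_position_box:
  obtains r m where "r \<in> {1..nrows X}" "m < row_length X s r"
    "reading_positions X (tableau_of X s) !
      f_position (reading_factors X (tableau_of X s)) i (reading_word X (tableau_of X s)) =
      (r, row_length X s r - Suc m)"
    "\<And>q n. q \<in> {1..nrows X} \<Longrightarrow> n < row_length X s q \<Longrightarrow> box_sig X s i q n \<le> box_sig X s i r m"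
    "\<And>q n. q \<in> {1..nrows X} \<Longrightarrow> n < row_length X s q \<Longrightarrow> q < r \<or> q = r \<and> m < n \<Longrightarrow>
      box_sig X s i q n < box_sig X s i r m"
proof -
  let ?T = "tableau_of X s"
  let ?P = "reading_positions X ?T"
  let ?sig = "signature_value (reading_factors X ?T) i (reading_word X ?T)"
  define v where "v = f_position (reading_factors X ?T) i (reading_word X ?T)"
  have v: "v < length ?P" "\<And>w. w < v \<Longrightarrow> ?sig w \<le> ?sig v" "\<And>w. w < length ?P \<Longrightarrow> v < w \<Longrightarrow> ?sig w < ?sig v"
    using theI'[OF ex1_last_argmax[OF positions_nonempty, of ?sig]]
    unfolding v_def f_position_def length_reading_word by blast+
  obtain r m where rm: "r \<in> {1..nrows X}" "m < row_length X s r" "?P ! v = (r, row_length X s r - Suc m)"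
    using v(1) by (rule box_of_position)
  have sv: "?sig v = Fin (box_sig X s i r m)" using signature_reading[OF v(1) rm(3)] rm(2) by simp
  have "box_sig X s i q n \<le> box_sig X s i r m \<and>
      (q < r \<or> q = r \<and> m < n \<longrightarrow> box_sig X s i q n < box_sig X s i r m)"
    if q: "q \<in> {1..nrows X}" "n < row_length X s q" for q n
  proof -
    obtain w where w: "w < length ?P" "?P ! w = (q, row_length X s q - Suc n)"
        "?sig w = Fin (box_sig X s i q n)" using box_signature[OF q] .
    have "?sig w \<le> ?sig v" using v(2)[of w] v(3)[of w] w(1) by (cases w v rule: linorder_cases) auto
    moreover have "?sig w < ?sig v" if "q < r \<or> q = r \<and> m < n"
      using v(3) w(1) position_less_iff[OF w(1,2) q(2) v(1) rm(3,2)] that by auto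
    ultimately show ?thesis using w(3) sv by auto
  qed
  then show thesis using that rm unfolding v_def by blast
qed

lemma e_position_box:
  obtains r m where "r \<in> {1..nrows X}" "m < row_length X s r"
    "reading_positions X (tableau_of X s) !
      e_position (reading_factors X (tableau_of X s)) i (reading_word X (tableau_of X s)) =
      (r, row_length X s r - Suc m)"
    "\<And>q n. q \<in> {1..nrows X} \<Longrightarrow> n < row_length X s q \<Longrightarrow> box_sig X s i q n \<le> box_sig X s i r m"
    "\<And>q n. q \<in> {1..nrows X} \<Longrightarrow> n < row_length X s q \<Longrightarrow> r < q \<or> q = r \<and> n < m \<Longrightarrow>
      box_sig X s i q n < box_sig X s i r m"
proof -
  let ?T = "tableau_of X s"
  let ?P = "reading_positions X ?T"
  let ?sig = "signature_value (reading_factors X ?T) i (reading_word X ?T)"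
  define v where "v = e_position (reading_factors X ?T) i (reading_word X ?T)"
  have v: "v < length ?P" "\<And>w. w < v \<Longrightarrow> ?sig w < ?sig v" "\<And>w. w < length ?P \<Longrightarrow> v < w \<Longrightarrow> ?sig w \<le> ?sig v"
    using theI'[OF ex1_first_argmax[OF positions_nonempty, of ?sig]]
    unfolding v_def e_position_def length_reading_word by blast+
  obtain r m where rm: "r \<in> {1..nrows X}" "m < row_length X s r" "?P ! v = (r, row_length X s r - Suc m)"
    using v(1) by (rule box_of_position)
  have sv: "?sig v = Fin (box_sig X s i r m)" using signature_reading[OF v(1) rm(3)] rm(2) by simp
  have "box_sig X s i q n \<le> box_sig X s i r m \<and>
      (r < q \<or> q = r \<and> n < m \<longrightarrow> box_sig X s i q n < box_sig X s i r m)"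
    if q: "q \<in> {1..nrows X}" "n < row_length X s q" for q n
  proof -
    obtain w where w: "w < length ?P" "?P ! w = (q, row_length X s q - Suc n)"
        "?sig w = Fin (box_sig X s i q n)" using box_signature[OF q] .
    have "?sig w \<le> ?sig v" using v(2)[of w] v(3)[of w] w(1) by (cases w v rule: linorder_cases) auto
    moreover have "?sig w < ?sig v" if "r < q \<or> q = r \<and> n < m"
      using v(2) position_less_iff[OF v(1) rm(3,2) w(1,2) q(2)] that by auto
    ultimately show ?thesis using w(3) sv by auto
  qed
  then show thesis using that rm unfolding v_def by blast
qed

text \<open>The height at the end of a row does not precede any of its boxes but follows the last
  one. The bound k \<le> n preserves the position for strict comparisons.\<close>

lemma height_le_box_sig:
  assumes "q \<in> {1..nrows X}" "n \<le> row_length X s q"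
  obtains k where "k < row_length X s q" "k \<le> n" "height X s i q n \<le> box_sig X s i q k"
proof (cases "n < row_length X s q")
  case True
  then show ?thesis by (intro that[of n]) (simp_all add: box_sig_def)
next
  case False
  then show ?thesis using assms row_length_pos[of q X s] by (intro that[of "n - 1"]) (auto simp: box_sig_def)
qed

text \<open>The pivots lost between the two boxes have colors other than i, hence nonpositive Cartan
  entries, and losing them cannot raise the i-weight.\<close>

lemma box_value_antimono:
  assumes r: "r \<in> {1..nrows X}" and "n \<le> n'"
    and same: "\<And>e. e \<in> level X s r n \<Longrightarrow> pivot_color X r e = i \<Longrightarrow> e \<in> level X s r n'"
  shows "box X s r n' i \<le> box X s r n i"
proof -
  have sub: "level X s r n' \<subseteq> level X s r n" using assms(2) by (rule level_antimono)
  have "(\<Sum>e\<in>level X s r n. cartan X i (pivot_color X r e)) =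
      (\<Sum>e\<in>level X s r n - level X s r n'. cartan X i (pivot_color X r e)) +
      (\<Sum>e\<in>level X s r n'. cartan X i (pivot_color X r e))"
    using sub finite_reduced_nodes[OF r] by (intro sum.subset_diff) (auto simp: level_def)
  moreover have "(\<Sum>e\<in>level X s r n - level X s r n'. cartan X i (pivot_color X r e)) \<le> 0"
    using same by (intro sum_nonpos cartan_nonpos) auto
  ultimately show ?thesis
    using row_weight[OF r box_in_row[OF s r] i] pivots_above_box[OF s r] by simp
qed

lemma row_height_filled:
  assumes r: "r \<in> {1..nrows X}" and m: "filled X s r \<le> m"
  shows "row_height X s i r m =
    (\<Sum>e\<in>reduced_nodes X r. cartan X i (pivot_color X r e) * s r e) - int m * source X r i"
proof -
  have "min (int m) (s r e) = s r e" if "e \<in> reduced_nodes X r" for e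
    using filled_ge[OF r that, of s] m by simp
  then show ?thesis by (simp add: row_height_def)
qed

text \<open>Split the pivots of row r. Those strictly below d have counts at most
  \<open>s r d\<close> and enter in full. Those at or above d enter with \<open>s r d\<close>; as d
  has i-weight -1, their Cartan entries add up to the i-weight of the source plus 1, so after
  cancelling the source term just \<open>s r d\<close> remains. Those incomparable with d have
  Cartan entry 0. In higher rows the source has i-weight 0, so only full counts remain.\<close>

lemma peak_eq_height:
  assumes rd: "(r, d) \<in> factors_of_color X i"
  shows "peak X s i r d = height X s i r (nat (s r d))"
proof -
  have r: "r \<in> {1..nrows X}" and d: "d \<in> reduced_nodes X r" "pivot_color X r d = i"
    using rd by (auto simp: factors_of_color_def)
  define a where "a e = cartan X i (pivot_color X r e)" for e
  have upper: "row_height X s i q (row_length X s q) =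
      (\<Sum>e\<in>reduced_nodes X q. cartan X i (pivot_color X q e) * s q e)" if q: "q \<in> {r<..nrows X}" for q
  proof -
    have "color_row X i \<le> r" using color_row(3)[OF i r] d by blast
    then have "source X q i = 0" using color_row(4)[OF i, of q] q by auto
    moreover have "q \<in> {1..nrows X}" "filled X s q \<le> row_length X s q" using q filled_less[of q X s] by auto
    ultimately show ?thesis using row_height_filled by simp
  qed
  have t: "int (nat (s r d)) = s r d" using count_familyD(1)[OF s r d(1)] by simp
  let ?lower = "{e \<in> reduced_nodes X r. below X e d \<and> e \<noteq> d}"
  have fin: "finite ?lower" "finite (pivots_above X r d)"
    using finite_reduced_nodes[OF r] finite_pivots_above[OF r] by auto
  have "(\<Sum>e\<in>reduced_nodes X r. a e * min (s r d) (s r e)) =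
      (\<Sum>e\<in>?lower \<union> pivots_above X r d. a e * min (s r d) (s r e))"
  proof (rule sum.mono_neutral_right[OF finite_reduced_nodes[OF r]])
    show "\<forall>e\<in>reduced_nodes X r - (?lower \<union> pivots_above X r d). a e * min (s r d) (s r e) = 0"
    proof
      fix e assume e: "e \<in> reduced_nodes X r - (?lower \<union> pivots_above X r d)"
      then have "\<not> below X e d" "\<not> below X d e" by (auto simp: pivots_above_def)
      then have "a e = 0" using pivots_comparable[OF r d(1), of e] e d(2) by (auto simp: a_def)
      then show "a e * min (s r d) (s r e) = 0" by simp
    qed
  qed (auto simp: pivots_above_def)
  also have "\<dots> = (\<Sum>e\<in>?lower. a e * min (s r d) (s r e)) + (\<Sum>e\<in>pivots_above X r d. a e * min (s r d) (s r e))"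
    using fin pivots_antisym[OF r _ d(1)] d(1) by (intro sum.union_disjoint) (auto simp: pivots_above_def)
  also have "(\<Sum>e\<in>?lower. a e * min (s r d) (s r e)) = (\<Sum>e\<in>?lower. a e * s r e)"
    using count_familyD(2)[OF s r _ d(1)] by (intro sum.cong refl) (simp add: min_absorb2)
  also have "(\<Sum>e\<in>pivots_above X r d. a e * min (s r d) (s r e)) = (\<Sum>e\<in>pivots_above X r d. a e) * s r d"
    unfolding sum_distrib_right
    using count_familyD(2)[OF s r d(1)] by (intro sum.cong refl) (simp add: min_absorb1 pivots_above_def)
  also have "(\<Sum>e\<in>pivots_above X r d. a e) = source X r i + 1"
    using row_weight[OF r pivot_in_row[OF r d(1)] i] pivot_value[OF r d(1)] d(2) by (simp add: a_def)
  finally have "row_height X s i r (nat (s r d)) = s r d + (\<Sum>e\<in>?lower. a e * s r e)"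
    unfolding row_height_def t by (simp add: a_def algebra_simps)
  then show ?thesis by (simp add: peak_def height_def upper a_def)
qed

text \<open>The rows below the last row in which the color occurs cannot make up for the
  drop caused by the source boxes of that row.\<close>

lemma height_drop:
  assumes r: "r \<in> {1..nrows X}" and m: "m \<le> row_length X s r"
    and below_row: "r < color_row X i \<or> r = color_row X i \<and> m = row_length X s r"
  shows "\<exists>n<row_length X s (color_row X i). height X s i r m < height X s i (color_row X i) n"
proof -
  let ?c = "color_row X i"
  let ?L = "row_length X s"
  have c: "?c \<in> {1..nrows X}" by (rule color_row(1)[OF i])
  \<comment> \<open>Each source box of this row has i-weight 1, and there are
    \<open>Suc (?L (?c - 1))\<close> of them.\<close>
  have "row_height X s i ?c (?L ?c) = row_height X s i ?c (filled X s ?c) - int (?L ?c - filled X s ?c)"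
    using c filled_less[of ?c X s] by (simp add: row_height_filled color_row(2)[OF i] of_nat_diff)
  then have drop: "height X s i ?c (?L ?c) + int (Suc (?L (?c - 1))) = height X s i ?c (filled X s ?c)"
    using c by (simp add: height_def row_length_pred[of ?c X s])
  \<comment> \<open>Of the lower rows only the first can raise the height, by at most 1 per box, so
    the total rise is at most its length.\<close>
  have low: "height X s i r m \<le> height X s i ?c (?L ?c) + int (?L (?c - 1))"
    if "1 \<le> r" "r \<le> ?c - 1" "m \<le> ?L r" for r m
    using that(2,1,3)
  proof (induction arbitrary: m rule: inc_induct)
    case base
    then have q: "?c - 1 \<in> {1..nrows X}" "1 < ?c" using c by auto
    have "- 1 \<le> box X s (?c - 1) k i" for k using box_unit[OF q(1), of k] by auto
    then have "(\<Sum>k<m. - 1) \<le> (\<Sum>k<m. box X s (?c - 1) k i)" by (rule sum_mono)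
    then have "row_height X s i (?c - 1) m \<le> int m" using sum_boxes[OF q(1), of m] by simp
    then show ?case using height_end[OF q(2), of X s i m] c base by simp
  next
    case (step q)
    then have q: "q \<in> {1..nrows X}" "Suc q < ?c" "Suc q \<le> nrows X" using c by auto
    \<comment> \<open>The source has nonnegative i-weight here, and without pivots of color i only
      nonpositive Cartan entries are subtracted from it.\<close>
    have "0 \<le> box X s q k i" for k
    proof -
      have "cartan X i (pivot_color X q e) \<le> 0" if "e \<in> pivots_above X q (box X s q k)" for e
        using color_row(3)[OF i q(1)] q(2) that by (intro cartan_nonpos) (auto simp: pivots_above_def)
      then have "(\<Sum>e\<in>pivots_above X q (box X s q k). cartan X i (pivot_color X q e)) \<le> 0"
        by (rule sum_nonpos)
      then show ?thesis
        using row_weight[OF q(1) box_in_row[OF s q(1)] i, of k] color_row(5)[OF i q(1,2)] by simp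
    qed
    then have "row_height X s i q m \<le> 0" using sum_boxes[OF q(1), of m] by (metis neg_0_le_iff_le sum_nonneg)
    moreover have "height X s i (Suc q) (?L (Suc q)) \<le> height X s i ?c (?L ?c) + int (?L (?c - 1))"
      by (rule step.IH) simp_all
    moreover have "height X s i q m = height X s i (Suc q) (?L (Suc q)) + row_height X s i q m"
      using height_end[of "Suc q" X s i m] q by simp
    ultimately show ?case by simp
  qed
  have "height X s i r m \<le> height X s i ?c (?L ?c) + int (?L (?c - 1))"
  proof (cases "r < ?c")
    case True
    then show ?thesis using low[of r m] r m by simp
  next
    case False
    then show ?thesis using below_row by simp
  qed
  then have "height X s i r m < height X s i ?c (filled X s ?c)" using drop by simp
  then show ?thesis using filled_less[of ?c X s] c by auto
qed

lemma factor_of_color_row: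
  assumes "r \<in> {1..nrows X}" "color_row X i \<le> r"
  obtains d where "d \<in> reduced_nodes X r" "pivot_color X r d = i"
  using color_row(3)[OF i assms(1)] assms(2) by blast

text \<open>The last maximum of the heights is attained just before the chosen box, so this box has
  i-weight 1 and moves along an arrow of some group d. The core is that its number m equals
  \<open>s r d\<close>; the conditions on peaks and on the new counts then follow from comparing
  heights and counts.\<close>

lemma tableau_f_tableau_of:
  "\<exists>r d. last_peak X s i r d \<and> count_family X (incr s r d 1) \<and>
    tableau_f X i (tableau_of X s) = Some (tableau_of X (incr s r d 1))"
proof -
  let ?L = "row_length X s"
  let ?H = "height X s i"
  obtain r m where r: "r \<in> {1..nrows X}" and m: "m < ?L r"
    and pos: "reading_positions X (tableau_of X s) !
      f_position (reading_factors X (tableau_of X s)) i (reading_word X (tableau_of X s)) = (r, ?L r - Suc m)"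
    and le: "\<And>q n. q \<in> {1..nrows X} \<Longrightarrow> n < ?L q \<Longrightarrow> box_sig X s i q n \<le> box_sig X s i r m"
    and less: "\<And>q n. q \<in> {1..nrows X} \<Longrightarrow> n < ?L q \<Longrightarrow> q < r \<or> q = r \<and> m < n \<Longrightarrow>
      box_sig X s i q n < box_sig X s i r m"
    by (rule f_position_box) blast
  define M where "M = box_sig X s i r m"
  have H_le: "?H q n \<le> M" if q: "q \<in> {1..nrows X}" "n \<le> ?L q" for q n
  proof -
    obtain k where "k < ?L q" "?H q n \<le> box_sig X s i q k" using height_le_box_sig[OF q] by blast
    then show ?thesis using le[OF q(1), of k] by (simp add: M_def)
  qed
  have H_drop: "?H q n < M"
    if q: "q \<in> {1..nrows X}" "n \<le> ?L q" "q < color_row X i \<or> q = color_row X i \<and> n = ?L q" for q n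
    using height_drop[OF q] H_le[OF color_row(1)[OF i] less_imp_le] order_less_le_trans by blast
  have H_less: "?H q n < M" if q: "q \<in> {1..nrows X}" "n \<le> ?L q" "q < r \<or> q = r \<and> m < n" for q n
  proof (cases "n < ?L q")
    case True
    then show ?thesis using less[OF q(1) True q(3)] by (simp add: box_sig_def M_def)
  next
    case False
    then have n: "n = ?L q" using q by simp
    show ?thesis
    proof (cases "q = 1")
      \<comment> \<open>No lower row starts here; the end of the reading word is excluded by
        \<open>height_drop\<close>.\<close>
      case True
      then show ?thesis using H_drop[OF q(1,2)] color_row(1)[OF i] n by fastforce
    next
      case False
      \<comment> \<open>The height after this row is the one before box 0 of the next lower row,
        where strictness is known.\<close>
      then have "q - 1 \<in> {1..nrows X}" "0 < ?L (q - 1)" "q - 1 < r" "1 < q" "q \<le> nrows X"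
        using q row_length_pos[of "q - 1" X s] by auto
      then have "?H (q - 1) 0 < M" using less[of "q - 1" 0] by (simp add: box_sig_def M_def)
      then show ?thesis using height_start[of q] \<open>1 < q\<close> \<open>q \<le> nrows X\<close> n by simp
    qed
  qed
  have Hm: "?H r m = M" "?H r (Suc m) < M"
    using H_less[OF r, of "Suc m"] m by (auto simp: box_sig_def M_def)
  have cr: "color_row X i \<le> r"
    using H_drop[OF r, of m] Hm m by force
  obtain d0 where d0: "d0 \<in> reduced_nodes X r" "pivot_color X r d0 = i"
    using factor_of_color_row[OF r cr] .
  define y where "y = box X s r m"
  have y: "y \<in> row_nodes X r" "pivots_above X r y = level X s r m"
    unfolding y_def using box_in_row[OF s r] pivots_above_box[OF s r] by auto
  have yi: "y i = 1"
    using box_value_height[OF r, of m] Hm box_unit[OF r, of m] by (simp add: y_def)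
  obtain y' where y': "row_arrow X r i y y'"
    using row_closed(1)[OF r d0(1) y(1)] yi d0(2) by auto
  obtain d where d: "d \<in> reduced_nodes X r" "pivot_color X r d = i" "d \<notin> level X s r m"
      "pivots_above X r y' = insert d (level X s r m)"
    using row_arrow_pivot[OF r y'] y(2) by auto
  have above_d: "e \<in> level X s r m" if "e \<in> reduced_nodes X r" "below X d e" "e \<noteq> d" for e
    using up_closed_pivots_above[of X r y'] that d by (auto simp: up_closed_def)
  have sd0: "0 \<le> s r d" by (rule count_familyD(1)[OF s r d(1)])
  have sd: "s r d \<le> int m" using d by (simp add: level_def)
  \<comment> \<open>A pivot of color i in the level set at n has a larger count than d and is
    comparable with d, so it lies above d and also belongs to the level set at m. Only pivots of
    other colors are lost from n to m.\<close>
  have climb: "1 \<le> box X s r n i" if n: "s r d \<le> int n" "n < m" for n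
  proof -
    have "e \<in> level X s r m" if e: "e \<in> level X s r n" "pivot_color X r e = i" for e
    proof -
      have eJ: "e \<in> reduced_nodes X r" "e \<noteq> d" "\<not> s r e \<le> s r d" using e n by (auto simp: level_def)
      then have "below X d e" using pivots_comparable[OF r d(1), of e] count_familyD(2)[OF s r] d e by auto
      then show ?thesis using above_d eJ by blast
    qed
    then show ?thesis using box_value_antimono[OF r, of n m] n yi by (simp add: y_def)
  qed
  have sdm: "s r d = int m"
  proof (rule ccontr)
    assume "s r d \<noteq> int m"
    then have lt: "nat (s r d) < m" using sd sd0 by simp
    \<comment> \<open>Going back from m to \<open>s r d\<close>, each box raises the height by at
      least 1, which would exceed the maximum.\<close>
    have "?H r m + int (m - n) \<le> ?H r n" if "nat (s r d) \<le> n" "n \<le> m" for n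
      using that(2,1)
    proof (induction rule: inc_induct)
      case (step n)
      then have "s r d \<le> int n" by simp
      then have "1 \<le> ?H r n - ?H r (Suc n)"
        using climb[of n] step.hyps box_value_height[OF r, of n] by simp
      moreover have "?H r m + int (m - Suc n) \<le> ?H r (Suc n)"
        using step by simp
      ultimately show ?case using step.hyps by (simp add: of_nat_diff)
    qed simp
    from this[of "nat (s r d)"] have "M < ?H r (nat (s r d))" using lt Hm sd0 by simp
    then show False using H_le[OF r, of "nat (s r d)"] lt m by simp
  qed
  have rd: "(r, d) \<in> factors_of_color X i" using r d by (simp add: factors_of_color_def)
  have pM: "peak X s i r d = M" using peak_eq_height[OF rd] sdm Hm by simp
  have "last_peak X s i r d"
    unfolding last_peak_def pM
  proof (intro conjI rd)
    show "0 \<le> M" using H_le[of "nrows X" 0] height_top by (cases X) auto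
    show "\<forall>(q, e)\<in>factors_of_color X i. (earlier X q e r d \<longrightarrow> peak X s i q e \<le> M) \<and>
        (earlier X r d q e \<longrightarrow> peak X s i q e < M)"
    proof safe
      fix q e assume qe: "(q, e) \<in> factors_of_color X i"
      then have q: "q \<in> {1..nrows X}" and e: "e \<in> reduced_nodes X q" by (auto simp: factors_of_color_def)
      have len: "nat (s q e) \<le> ?L q" using count_less_row_length[OF q e, of s] by simp
      show "peak X s i q e \<le> M" using peak_eq_height[OF qe] H_le[OF q len] by simp
      assume "earlier X r d q e"
      \<comment> \<open>A later factor of the same row lies strictly above d, so its count already
        exceeds m.\<close>
      then have "q < r \<or> q = r \<and> m < nat (s q e)"
        using above_d[of e] e by (auto simp: earlier_def level_def)
      then show "peak X s i q e < M" using peak_eq_height[OF qe] H_less[OF q len] by simp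
    qed
  qed
  moreover have s': "count_family X (incr s r d 1)"
    unfolding count_family_def
  proof (intro conjI ballI impI)
    fix q c assume "q \<in> {1..nrows X}" "c \<in> reduced_nodes X q"
    then show "0 \<le> incr s r d 1 q c" using count_familyD(1)[OF s, of q c] by (auto simp: incr_def)
  next
    \<comment> \<open>Only a pivot strictly above d could be overtaken by the raised count, but its
      count already exceeds m.\<close>
    fix q c1 c2 assume q: "q \<in> {1..nrows X}" and c: "c1 \<in> reduced_nodes X q" "c2 \<in> reduced_nodes X q" "below X c1 c2"
    then show "incr s r d 1 q c1 \<le> incr s r d 1 q c2"
      using count_familyD(2)[OF s q c] above_d[of c2] sdm by (auto simp: incr_def level_def)
  qed
  moreover have "tableau_f X i (tableau_of X s) = Some (tableau_of X (incr s r d 1))"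
  proof -
    have inc: "level X (incr s r d 1) r m = insert d (level X s r m)"
      using tableau_of_incr(3)[OF s s' r d(1)] sdm by simp
    have y'_eq: "y' = box X (incr s r d 1) r m"
      using node_of_pivots_above[OF r, of y'] y' d(4) inc by (simp add: box_def row_arrow_def)
    have "tableau_of X s r ! (?L r - Suc m) = y"
      using nth_tableau_of[OF r, of "?L r - Suc m" s] m by (simp add: y_def)
    moreover have "ft (basic_crystal X) i y = Some y'"
      using y' by (intro ft_basic_crystal) (simp add: row_arrow_def)
    ultimately show ?thesis
      using tableau_of_incr(1)[OF s s' r d(1)] sdm by (simp add: tableau_f_def pos y'_eq y_def)
  qed
  ultimately show ?thesis by blast
qed

text \<open>The operator picks the first maximum. If it is attained before the chosen box, this is
  the very first box, since otherwise an earlier box would share the maximum; then the maximum is 0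
  and the result is \<open>None\<close>. Otherwise the box has i-weight -1, and the argument for
  \<open>tableau_f_tableau_of\<close> runs in the opposite direction.\<close>

lemma tableau_e_tableau_of:
  "(\<exists>r d. first_peak X s i r d \<and> count_family X (incr s r d (-1)) \<and>
      tableau_e X i (tableau_of X s) = Some (tableau_of X (incr s r d (-1)))) \<or>
    (\<forall>(r, d)\<in>factors_of_color X i. peak X s i r d \<le> 0) \<and> tableau_e X i (tableau_of X s) = None"
proof -
  let ?L = "row_length X s"
  let ?H = "height X s i"
  obtain r m where r: "r \<in> {1..nrows X}" and m: "m < ?L r"
    and pos: "reading_positions X (tableau_of X s) !
      e_position (reading_factors X (tableau_of X s)) i (reading_word X (tableau_of X s)) = (r, ?L r - Suc m)"
    and le: "\<And>q n. q \<in> {1..nrows X} \<Longrightarrow> n < ?L q \<Longrightarrow> box_sig X s i q n \<le> box_sig X s i r m"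
    and less: "\<And>q n. q \<in> {1..nrows X} \<Longrightarrow> n < ?L q \<Longrightarrow> r < q \<or> q = r \<and> n < m \<Longrightarrow>
      box_sig X s i q n < box_sig X s i r m"
    by (rule e_position_box) blast
  define M where "M = box_sig X s i r m"
  have H_le: "?H q n \<le> M" if q: "q \<in> {1..nrows X}" "n \<le> ?L q" for q n
  proof -
    obtain k where "k < ?L q" "?H q n \<le> box_sig X s i q k" using height_le_box_sig[OF q] by blast
    then show ?thesis using le[OF q(1), of k] by (simp add: M_def)
  qed
  have H_less: "?H q n < M" if q: "q \<in> {1..nrows X}" "n \<le> ?L q" "r < q \<or> q = r \<and> n < m" for q n
  proof -
    obtain k where "k < ?L q" "k \<le> n" "?H q n \<le> box_sig X s i q k"
      using height_le_box_sig[OF q(1,2)] by blast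
    then show ?thesis using less[OF q(1), of k] q(3) unfolding M_def by linarith
  qed
  have len: "nat (s q e) \<le> ?L q" if "(q, e) \<in> factors_of_color X i" for q e
    using that count_less_row_length[of q X e s] by (auto simp: factors_of_color_def)
  have M0: "0 \<le> M" using H_le[of "nrows X" 0] height_top by (cases X) auto
  define y where "y = box X s r m"
  have entry: "tableau_of X s r ! (?L r - Suc m) = y"
    using nth_tableau_of[OF r, of "?L r - Suc m" s] m by (simp add: y_def)
  show ?thesis
  proof (cases "?H r m = M")
    case True
    have "r = nrows X \<and> m = 0"
    proof (rule ccontr)
      assume not: "\<not> (r = nrows X \<and> m = 0)"
      show False
      proof (cases "m = 0")
        case True
        then have q: "Suc r \<in> {1..nrows X}" using not r by auto
        then have "?H (Suc r) (?L (Suc r)) < M" by (intro H_less) auto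
        then show False using height_start[of "Suc r"] q r \<open>?H r m = M\<close> True by simp
      next
        case False
        then have "box_sig X s i r (m - 1) < M" using less[OF r, of "m - 1"] m by (simp add: M_def)
        then show False using \<open>?H r m = M\<close> False by (simp add: box_sig_def)
      qed
    qed
    then have "M = 0" using True height_top by simp
    then have "peak X s i q e \<le> 0" if "(q, e) \<in> factors_of_color X i" for q e
      using peak_eq_height[OF that] H_le[OF _ len[OF that]] that by (simp add: factors_of_color_def)
    moreover have "0 \<le> y i"
      using True H_le[OF r, of "Suc m"] m box_value_height[OF r, of m] by (simp add: y_def)
    then have "tableau_e X i (tableau_of X s) = None"
      by (simp add: tableau_e_def pos entry et_basic_crystal_None)
    ultimately show ?thesis by blast
  next
    case False
    then have Hm: "?H r m < M" "?H r (Suc m) = M"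
      using H_le[OF r, of m] m by (auto simp: box_sig_def M_def max_def split: if_splits)
    have cr: "color_row X i \<le> r"
    proof (rule ccontr)
      assume "\<not> color_row X i \<le> r"
      then obtain n where "n < ?L (color_row X i)" "?H r (Suc m) < ?H (color_row X i) n"
        using height_drop[OF r, of "Suc m"] m by auto
      then show False using H_le[OF color_row(1)[OF i], of n] Hm by simp
    qed
    obtain d0 where d0: "d0 \<in> reduced_nodes X r" "pivot_color X r d0 = i"
      using factor_of_color_row[OF r cr] .
    have y: "y \<in> row_nodes X r" "pivots_above X r y = level X s r m"
      unfolding y_def using box_in_row[OF s r] pivots_above_box[OF s r] by auto
    have yi: "y i = -1"
      using box_value_height[OF r, of m] Hm box_unit[OF r, of m] by (simp add: y_def)
    obtain y' where y': "row_arrow X r i y' y"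
      using row_closed(2)[OF r d0(1) y(1)] yi d0(2) by auto
    obtain d where d: "d \<in> reduced_nodes X r" "pivot_color X r d = i" "d \<notin> pivots_above X r y'"
        "level X s r m = insert d (pivots_above X r y')"
      using row_arrow_pivot[OF r y'] y(2) by auto
    have below_d: "e \<notin> level X s r m" if "e \<in> reduced_nodes X r" "below X e d" "e \<noteq> d" for e
      using up_closed_pivots_above[of X r y'] that d by (auto simp: up_closed_def)
    have sd: "int m < s r d" using d(4) by (auto simp: level_def)
    \<comment> \<open>A pivot of color i lost between m and n would have a smaller count than d,
      hence lie strictly below d; the level set at m contains no such pivot.\<close>
    have climb: "box X s r n i \<le> - 1" if n: "m < n" "int n < s r d" for n
    proof -
      have "e \<in> level X s r n" if e: "e \<in> level X s r m" "pivot_color X r e = i" for e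
      proof (rule ccontr)
        assume "e \<notin> level X s r n"
        then have eJ: "e \<in> reduced_nodes X r" "e \<noteq> d" "\<not> s r d \<le> s r e" using e n by (auto simp: level_def)
        then have "below X e d" using pivots_comparable[OF r d(1), of e] count_familyD(2)[OF s r] d e by auto
        then show False using below_d eJ e by blast
      qed
      then show ?thesis using box_value_antimono[OF r, of m n] n yi by (simp add: y_def)
    qed
    have sdm: "s r d = int (Suc m)"
    proof (rule ccontr)
      assume "s r d \<noteq> int (Suc m)"
      then have lt: "Suc m < nat (s r d)" using sd by simp
      have "?H r (Suc m) + int (n - Suc m) \<le> ?H r n" if "Suc m \<le> n" "n \<le> nat (s r d)" for n
        using that
      proof (induction rule: dec_induct)
        case (step n)
        then have "int n < s r d" "m < n" by auto
        then have "?H r n + 1 \<le> ?H r (Suc n)"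
          using climb[of n] box_value_height[OF r, of n] by simp
        moreover have "?H r (Suc m) + int (n - Suc m) \<le> ?H r n"
          using step by simp
        ultimately show ?case using step.hyps by (simp add: of_nat_diff)
      qed simp
      from this[of "nat (s r d)"] have "M < ?H r (nat (s r d))" using lt Hm sd by simp
      moreover have "nat (s r d) \<le> ?L r" using count_less_row_length[OF r d(1), of s] by linarith
      ultimately show False using H_le[OF r, of "nat (s r d)"] by simp
    qed
    have rd: "(r, d) \<in> factors_of_color X i" using r d by (simp add: factors_of_color_def)
    have "nat (s r d) = Suc m" using sdm by simp
    then have pM: "peak X s i r d = M" using peak_eq_height[OF rd] Hm by simp
    \<comment> \<open>With M = 0 the maximum would already occur at the start of the reading
      word.\<close>
    have "0 < M"
    proof (rule ccontr)
      assume "\<not> 0 < M"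
      then have "?H (nrows X) 0 = M" using M0 height_top by simp
      moreover have "nrows X \<in> {1..nrows X}" using r by auto
      ultimately have "\<not> (r < nrows X \<or> nrows X = r \<and> 0 < m)"
        using H_less[of "nrows X" 0] by (metis less_irrefl zero_le)
      then have rm: "r = nrows X" "\<not> 0 < m" using r by (metis atLeastAtMost_iff le_neq_implies_less)+
      then have "m = 0" by simp
      then show False using \<open>?H (nrows X) 0 = M\<close> Hm rm by simp
    qed
    then have "first_peak X s i r d"
      unfolding first_peak_def pM
    proof (intro conjI rd)
      show "\<forall>(q, e)\<in>factors_of_color X i. (earlier X q e r d \<longrightarrow> peak X s i q e < M) \<and>
          (earlier X r d q e \<longrightarrow> peak X s i q e \<le> M)"
      proof safe
        fix q e assume qe: "(q, e) \<in> factors_of_color X i"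
        then have q: "q \<in> {1..nrows X}" and e: "e \<in> reduced_nodes X q" by (auto simp: factors_of_color_def)
        show "peak X s i q e \<le> M" using peak_eq_height[OF qe] H_le[OF q len[OF qe]] by simp
        assume "earlier X q e r d"
        then have "r < q \<or> q = r \<and> nat (s q e) \<le> m"
          using below_d[of e] e by (auto simp: earlier_def level_def)
        then show "peak X s i q e < M"
          using peak_eq_height[OF qe] H_less[OF q len[OF qe]] Hm by (cases "q = r \<and> nat (s q e) = m") auto
      qed
    qed
    moreover define s' where "s' = incr s r d (-1)"
    have s's: "incr s' r d 1 = s" by (simp add: s'_def incr_def)
    have s': "count_family X s'"
      unfolding count_family_def
    proof (intro conjI ballI impI)
      fix q c assume "q \<in> {1..nrows X}" "c \<in> reduced_nodes X q"
      then show "0 \<le> s' q c" using count_familyD(1)[OF s, of q c] sd by (auto simp: incr_def s'_def)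
    next
      fix q c1 c2 assume q: "q \<in> {1..nrows X}" and c: "c1 \<in> reduced_nodes X q" "c2 \<in> reduced_nodes X q" "below X c1 c2"
      then show "s' q c1 \<le> s' q c2"
        using count_familyD(2)[OF s q c] below_d[of c1] sdm by (auto simp: incr_def level_def s'_def)
    qed
    moreover have "tableau_e X i (tableau_of X s) = Some (tableau_of X s')"
    proof -
      have ms': "int m = s' r d" using sdm by (simp add: s'_def incr_def)
      \<comment> \<open>Lowering a count is treated as the inverse of raising it: the lemma is
        applied to the step from s' to s.\<close>
      note inc = tableau_of_incr[OF s' _ r d(1) ms', unfolded s's, OF s]
      have "level X s' r m = pivots_above X r y'"
        using inc(3,4) d(3,4) by auto
      then have y'_eq: "y' = box X s' r m"
        using node_of_pivots_above[OF r, of y'] y' by (simp add: box_def row_arrow_def)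
      have "et (basic_crystal X) i y = Some y'"
        using y' by (intro et_basic_crystal) (simp add: row_arrow_def)
      moreover have "(if y' = source X r then remove_column X r (put_box (tableau_of X s) r (?L r - Suc m) y')
          else put_box (tableau_of X s) r (?L r - Suc m) y') = tableau_of X s'"
      proof -
        let ?L' = "row_length X s'"
        have m': "m < ?L' r" using count_less_row_length[OF r d(1), of s'] ms' by simp
        have y'_nth: "(tableau_of X s' r)[?L' r - Suc m := y'] = tableau_of X s' r"
          using nth_tableau_of[OF r, of "?L' r - Suc m" s'] m' by (simp add: y'_eq list_update_same_conv length_tableau_of[OF r])
        show ?thesis
        proof (cases "y' = source X r")
          case True
          have eq: "tableau_of X s =
              insert_column X r (put_box (tableau_of X s') r (?L' r - Suc m) y)"
            using inc(1) True by (simp add: y'_eq y_def)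
          \<comment> \<open>The inserted column shifts row r by one place. The rows from r upwards
            begin with the inserted source boxes, and these are what \<open>remove1\<close>
            deletes.\<close>
          have "?L r = Suc (?L' r)" using inc(2)[of r] True by (simp add: y'_eq)
          then have k: "?L r - Suc m = Suc (?L' r - Suc m)" using m' by simp
          show ?thesis
          proof
            fix q
            show "(if y' = source X r then remove_column X r (put_box (tableau_of X s) r (?L r - Suc m) y')
                else put_box (tableau_of X s) r (?L r - Suc m) y') q = tableau_of X s' q"
              using True y'_nth r unfolding k eq
              by (auto simp: remove_column_def insert_column_def put_box_def)
          qed
        next
          case False
          have eq: "tableau_of X s = put_box (tableau_of X s') r (?L' r - Suc m) y"
            using inc(1) False by (simp add: y'_eq y_def)
          have k: "?L r = ?L' r" using inc(2)[of r] False by (simp add: y'_eq)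
          show ?thesis
            using False y'_nth unfolding k eq by (auto simp: put_box_def)
        qed
      qed
      ultimately show ?thesis by (auto simp: tableau_e_def pos entry)
    qed
    ultimately show ?thesis unfolding s'_def by blast
  qed
qed

end

section \<open>The highest weight element\<close>

abbreviation augmentation :: "free_alg \<Rightarrow> qfield" where
  "augmentation u \<equiv> Poly_Mapping.lookup u []"

text \<open>A concatenation is empty only if both words are, so the constant term is
  multiplicative.\<close>

lemma augmentation_mult: "augmentation (u * v) = augmentation u * augmentation v"
proof -
  have *: "[] = l + q \<longleftrightarrow> l = [] \<and> q = []" for l q :: "nat list"
    by (auto simp: plus_list_def)
  have "(\<Sum>q. Poly_Mapping.lookup v q when [] = l + q) = (augmentation v when l = [])" for l
    unfolding * by (cases "l = []") simp_all
  then show ?thesis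
    by (simp add: lookup_mult mult_when)
qed

lemma augmentation_scal [simp]: "augmentation (scal a) = a"
  by (simp add: scal_def)

lemma augmentation_one [simp]: "augmentation 1 = 1"
  by (simp add: lookup_one zero_list_def)

lemma augmentation_gen [simp]: "augmentation (gen i) = 0"
  by (simp add: gen_def lookup_single)

lemma augmentation_power: "augmentation (u ^ n) = augmentation u ^ n"
  by (induction n) (simp_all add: augmentation_mult)

lemma augmentation_divided_power: "0 < n \<Longrightarrow> augmentation (divided_power i n) = 0"
  by (simp add: divided_power_def augmentation_mult augmentation_power)

lemma divided_power_0: "divided_power i 0 = 1"
  by (simp add: divided_power_def qfact_def scal_def zero_list_def[symmetric])

text \<open>Every summand of a Serre element contains the factor \<open>gen j\<close>, whose
  constant term is 0.\<close>

lemma augmentation_serre_ideal: "u \<in> serre_ideal X \<Longrightarrow> augmentation u = 0"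
  by (induction rule: serre_ideal.induct)
    (simp_all add: lookup_add augmentation_mult serre_def lookup_sum)

text \<open>Representatives of 1 have constant term 1. After an application of
  \<open>kashiwara_f\<close> every divided power is positive, so the constant term is 0.\<close>

lemma augmentation_kashiwara_monomial:
  "u \<in> kashiwara_monomials X \<Longrightarrow> augmentation u = 0 \<or> augmentation u = 1"
proof (induction rule: kashiwara_monomials.induct)
  case (one u)
  then show ?case using augmentation_serre_ideal by (fastforce simp: lookup_minus)
next
  case (step u i v)
  then obtain us where "v - (\<Sum>n<length us. divided_power i (n + 1) * us ! n) \<in> serre_ideal X"
    by (auto simp: kashiwara_f_def)
  from augmentation_serre_ideal[OF this] show ?case
    by (simp add: lookup_minus lookup_sum augmentation_mult augmentation_divided_power)
qed

lemma regular_at_0_add: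
  assumes "a \<in> regular_at_0" "b \<in> regular_at_0"
  shows "a + b \<in> regular_at_0"
proof -
  obtain p q p' q' where *: "a = Fract p q" "poly q 0 \<noteq> 0" "b = Fract p' q'" "poly q' 0 \<noteq> 0"
    using assms by (auto simp: regular_at_0_def)
  then have "q \<noteq> 0" "q' \<noteq> 0" by auto
  then have "a + b = Fract (p * q' + p' * q) (q * q')" using * by simp
  moreover have "poly (q * q') 0 \<noteq> 0" using * by simp
  ultimately show ?thesis unfolding regular_at_0_def by blast
qed

lemma zero_regular_at_0: "0 \<in> regular_at_0"
  unfolding regular_at_0_def Zero_fract_def
  by (intro CollectI exI[of _ "0 :: rat poly"] exI[of _ "1 :: rat poly"]) simp

lemma augmentation_lattice: "u \<in> lattice X \<Longrightarrow> augmentation u \<in> regular_at_0"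
proof (induction rule: lattice.induct)
  case (ideal x)
  then show ?case by (simp add: augmentation_serre_ideal zero_regular_at_0)
next
  case (add x u a)
  then show ?case
    using augmentation_kashiwara_monomial[of u X]
    by (auto simp: lookup_add augmentation_mult intro: regular_at_0_add)
qed

text \<open>The value is q times a function regular at 0 and so vanishes at q = 0, unlike 1 and -1.
  The case -1 serves for differences u - 1, by which membership in \<open>b_infinity X\<close> is
  defined.\<close>

lemma augmentation_q_lattice:
  assumes "u \<in> q_lattice X"
  shows "augmentation u \<noteq> 1" "augmentation u \<noteq> - 1"
proof -
  obtain v where v: "u = scal qq * v" "v \<in> lattice X" using assms by (auto simp: q_lattice_def)
  obtain p q where pq: "augmentation v = Fract p q" "poly q 0 \<noteq> 0"
    using augmentation_lattice[OF v(2)] by (auto simp: regular_at_0_def)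
  then have q: "q \<noteq> 0" by auto
  have eq: "augmentation u = Fract ([:0, 1:] * p) q"
    using v pq by (simp add: augmentation_mult qq_def)
  show "augmentation u \<noteq> 1"
  proof
    assume "augmentation u = 1"
    then have "[:0, 1:] * p = q" using eq q by (simp add: One_fract_def eq_fract)
    then show False using pq(2) by auto
  qed
  show "augmentation u \<noteq> - 1"
  proof
    assume "augmentation u = - 1"
    then have "[:0, 1:] * p = - q" using eq q by (simp add: One_fract_def eq_fract)
    then have "poly q 0 = - poly ([:0, 1:] * p) 0" by simp
    then show False using pq(2) by simp
  qed
qed

lemma zero_in_q_lattice: "0 \<in> q_lattice X"
  using lattice.ideal[OF serre_ideal.zero] by (force simp: q_lattice_def)

lemma one_in_kashiwara_monomials: "1 \<in> kashiwara_monomials X"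
  by (rule kashiwara_monomials.one)
    (auto simp: words_alg_def serre_ideal.zero zero_list_def)

lemma one_in_lattice: "1 \<in> lattice X"
proof -
  have "1 \<in> regular_at_0"
    by (auto simp: regular_at_0_def One_fract_def intro!: exI[of _ 1])
  moreover have "scal 1 = 1" by (simp add: scal_def zero_list_def[symmetric])
  ultimately show ?thesis
    using lattice.add[OF lattice.ideal[OF serre_ideal.zero] one_in_kashiwara_monomials, of 1 X] by simp
qed

lemma one_in_b_infinity: "1 \<in> b_infinity X"
  using one_in_lattice zero_in_q_lattice by (simp add: b_infinity_def lattice_class_def)

lemma b_infinity_in_B_infinity: "b_infinity X \<in> B_infinity_elts X"
proof -
  have "1 \<notin> q_lattice X" using augmentation_q_lattice(1) by fastforce
  then have "b_infinity X \<noteq> q_lattice X" using one_in_b_infinity by blast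
  then show ?thesis
    using one_in_kashiwara_monomials by (simp add: B_infinity_elts_def b_infinity_def)
qed

text \<open>A representative differs from 1 by an element of \<open>q_lattice X\<close>, so its
  constant term is nonzero; the empty word therefore occurs in it and forces its weight to be
  0.\<close>

lemma class_weight_b_infinity: "class_weight X (b_infinity X) = (\<lambda>j. 0)"
  unfolding class_weight_def
proof (rule the_equality)
  show "\<exists>u\<in>b_infinity X. \<forall>w\<in>Poly_Mapping.keys u. word_weight X w = (\<lambda>j. 0)"
    using one_in_b_infinity by (intro bexI[of _ 1]) (auto simp: word_weight_def zero_list_def)
next
  fix \<mu> assume "\<exists>u\<in>b_infinity X. \<forall>w\<in>Poly_Mapping.keys u. word_weight X w = \<mu>"
  then obtain u where u: "u \<in> b_infinity X" "\<forall>w\<in>Poly_Mapping.keys u. word_weight X w = \<mu>" by blast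
  have "augmentation (u - 1) \<noteq> - 1"
    using u(1) augmentation_q_lattice(2) by (auto simp: b_infinity_def lattice_class_def)
  then have "[] \<in> Poly_Mapping.keys u" by (auto simp: lookup_minus in_keys_iff)
  then show "\<mu> = (\<lambda>j. 0)" using u(2) by (auto simp: word_weight_def)
qed

text \<open>With the string decomposition \<open>[1]\<close> of 1, \<open>kashiwara_e\<close>
  relates 1 to the empty sum 0, which lies in \<open>q_lattice X\<close>.\<close>

lemma e_b_infinity: "et (B_infinity X) i (b_infinity X) = None"
proof -
  have "qder X i 1 = 0" by (simp add: qder_def zero_list_def)
  then have "string_decomposition X i 1 [1]"
    by (auto simp: string_decomposition_def words_alg_def zero_list_def divided_power_0 serre_ideal.zero)
  then have "kashiwara_e X i 1 0"
    by (auto simp: kashiwara_e_def words_alg_def serre_ideal.zero intro!: exI[of _ "[1]"])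
  then show ?thesis
    using one_in_b_infinity zero_in_q_lattice by (auto simp: B_infinity_def induced_on_classes_def Let_def)
qed

lemma option_iterate_0: "option_iterate g 0 b = Some b"
  by (simp add: option_iterate_def)

lemma option_iterate_Suc: "option_iterate g (Suc n) b = Option.bind (g b) (option_iterate g n)"
  unfolding option_iterate_def funpow_Suc_right
proof -
  have "((\<lambda>x. Option.bind x g) ^^ n) (Option.bind (Some b) g) = Option.bind (g b) (\<lambda>b. ((\<lambda>x. Option.bind x g) ^^ n) (Some b))"
  proof (cases "g b")
    case None
    then show ?thesis by (induction n) simp_all
  qed simp
  then show "((\<lambda>x. Option.bind x g) ^^ n \<circ> (\<lambda>x. Option.bind x g)) (Some b) =
      Option.bind (g b) (\<lambda>b. ((\<lambda>x. Option.bind x g) ^^ n) (Some b))" by simp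
qed

lemma max_iterations_None:
  assumes "g b = None"
  shows "max_iterations g b = 0"
proof -
  have "{n. option_iterate g n b \<noteq> None} = {0}"
  proof (intro set_eqI)
    fix n show "n \<in> {n. option_iterate g n b \<noteq> None} \<longleftrightarrow> n \<in> {0}"
      by (cases n) (simp_all add: assms option_iterate_0 option_iterate_Suc)
  qed
  then show ?thesis by (simp add: max_iterations_def)
qed

lemma eps_b_infinity: "eps (B_infinity X) i (b_infinity X) = Fin 0"
  using max_iterations_None[where g = "et (B_infinity X) i" and b = "b_infinity X"] e_b_infinity[of X i]
  by (simp add: B_infinity_def Let_def)

lemma wt_b_infinity: "wt (B_infinity X) (b_infinity X) = (\<lambda>j. 0)"
  by (simp add: B_infinity_def Let_def class_weight_b_infinity)

section \<open>Signatures of tensor products\<close>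

text \<open>With factors labelled by row and group, different families of paths give lists that
  differ only in their order.\<close>

definition pivot_factors :: "etype \<Rightarrow> (nat \<Rightarrow> weight list) \<Rightarrow> (nat \<times> weight) list" where
  "pivot_factors X p = map (\<lambda>(r, x, x'). (r, arrow_group X r x x')) (factor_arrows X p)"

definition factor_crystals :: "etype \<Rightarrow> (nat \<Rightarrow> weight list) \<Rightarrow> (free_alg set + int) crystal list" where
  "factor_crystals X p = transport_crystal Inl projl (B_infinity X) #
    map (\<lambda>(r, d). transport_crystal Inr projr (elementary_crystal X (pivot_color X r d))) (pivot_factors X p)"

lemma earlier_asym:
  assumes "(r, d) \<in> factors_of_color X i" "(q, e) \<in> factors_of_color X i" "earlier X q e r d"
  shows "\<not> earlier X r d q e" "(q, e) \<noteq> (r, d)"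
  using assms pivots_antisym[of r X d e] by (auto simp: earlier_def factors_of_color_def)

lemma earlier_total:
  assumes "(r, d) \<in> factors_of_color X i" "(q, e) \<in> factors_of_color X i" "(q, e) \<noteq> (r, d)"
  shows "earlier X q e r d \<or> earlier X r d q e"
  using assms pivots_comparable[of r X d e] by (auto simp: earlier_def factors_of_color_def not_less_iff_gr_or_eq)

text \<open>A signature value contains the factor's own count with coefficient 1 and the counts of
  equally colored factors to its left with the Cartan entry 2.\<close>

lemma peak_incr:
  assumes rd: "(r, d) \<in> factors_of_color X i" and qe: "(q, e) \<in> factors_of_color X i"
  shows "peak X (incr s r d z) i q e = peak X s i q e +
    (if (q, e) = (r, d) then z else if earlier X r d q e then 2 * z else 0)"
proof -
  have r: "r \<in> {1..nrows X}" "d \<in> reduced_nodes X r" "pivot_color X r d = i"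
    and q: "q \<in> {1..nrows X}" "e \<in> reduced_nodes X q"
    using rd qe by (auto simp: factors_of_color_def)
  have incr: "incr s r d z k c = s k c + (if (k, c) = (r, d) then z else 0)" for k c
    by (auto simp: incr_def)
  have upper: "(\<Sum>k\<in>{q<..nrows X}. \<Sum>c\<in>reduced_nodes X k. cartan X i (pivot_color X k c) * incr s r d z k c) =
      (\<Sum>k\<in>{q<..nrows X}. \<Sum>c\<in>reduced_nodes X k. cartan X i (pivot_color X k c) * s k c) +
      (if q < r then 2 * z else 0)"
  proof -
    have "(\<Sum>c\<in>reduced_nodes X k. cartan X i (pivot_color X k c) * incr s r d z k c) =
        (\<Sum>c\<in>reduced_nodes X k. cartan X i (pivot_color X k c) * s k c) + (if k = r then 2 * z else 0)"
      if "k \<in> {q<..nrows X}" for k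
    proof -
      have "k \<in> {1..nrows X}" using that by auto
      then have "finite (reduced_nodes X k)" by (rule finite_reduced_nodes)
      moreover have "cartan X i (pivot_color X k c) * incr s r d z k c =
          cartan X i (pivot_color X k c) * s k c + (if c = d then if k = r then 2 * z else 0 else 0)" for c
        using r(3) by (auto simp: incr algebra_simps)
      ultimately show ?thesis using r(2) by (auto simp: sum.distrib)
    qed
    then show ?thesis using r(1) by (simp add: sum.distrib)
  qed
  have lower: "(\<Sum>c\<in>{c \<in> reduced_nodes X q. below X c e \<and> c \<noteq> e}. cartan X i (pivot_color X q c) * incr s r d z q c) =
      (\<Sum>c\<in>{c \<in> reduced_nodes X q. below X c e \<and> c \<noteq> e}. cartan X i (pivot_color X q c) * s q c) +
      (if q = r \<and> below X d e \<and> d \<noteq> e then 2 * z else 0)"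
  proof -
    have "finite {c \<in> reduced_nodes X q. below X c e \<and> c \<noteq> e}" using finite_reduced_nodes[OF q(1)] by simp
    moreover have "cartan X i (pivot_color X q c) * incr s r d z q c =
        cartan X i (pivot_color X q c) * s q c + (if c = d then if q = r then 2 * z else 0 else 0)" for c
      using r(3) by (auto simp: incr algebra_simps)
    ultimately show ?thesis using r(2) by (auto simp: sum.distrib)
  qed
  show ?thesis
    unfolding peak_def upper lower using incr by (auto simp: earlier_def)
qed

text \<open>Peaks to the left stay, the peak of d rises by 1 and those to the right by 2. The latter
  were strictly smaller and at most catch up, so the last maximum turns into the first one. This
  makes \<open>et\<close> undo \<open>ft\<close>.\<close>

lemma first_peak_incr:
  assumes "last_peak X s i r d"
  shows "first_peak X (incr s r d 1) i r d" "peak X (incr s r d 1) i r d = peak X s i r d + 1"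
proof -
  have rd: "(r, d) \<in> factors_of_color X i" using assms by (simp add: last_peak_def)
  show eq: "peak X (incr s r d 1) i r d = peak X s i r d + 1" using peak_incr[OF rd rd] by simp
  show "first_peak X (incr s r d 1) i r d"
    unfolding first_peak_def eq
  proof (intro conjI rd)
    show "\<forall>(q, e)\<in>factors_of_color X i.
      (earlier X q e r d \<longrightarrow> peak X (incr s r d 1) i q e < peak X s i r d + 1) \<and>
      (earlier X r d q e \<longrightarrow> peak X (incr s r d 1) i q e \<le> peak X s i r d + 1)"
    proof (safe, goal_cases)
      case (1 q e)
      then have "peak X s i q e \<le> peak X s i r d" using assms by (fastforce simp: last_peak_def)
      then show ?case using 1 earlier_asym[OF rd, of q e] peak_incr[OF rd, of q e s 1] by auto
    next
      case (2 q e)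
      then have "peak X s i q e < peak X s i r d" using assms by (fastforce simp: last_peak_def)
      then show ?case using 2 earlier_asym(2)[OF 2(1) rd] peak_incr[OF rd, of q e s 1] by auto
    qed
  qed (use assms in \<open>simp add: last_peak_def\<close>)
qed

text \<open>The reverse shift: peaks to the left were strictly smaller and remain at most the
  lowered value, those to the right fall by 2 and end strictly below it, and positivity becomes
  nonnegativity.\<close>

lemma last_peak_decr:
  assumes "first_peak X s i r d"
  shows "last_peak X (incr s r d (-1)) i r d" "peak X (incr s r d (-1)) i r d = peak X s i r d - 1"
proof -
  have rd: "(r, d) \<in> factors_of_color X i" using assms by (simp add: first_peak_def)
  show eq: "peak X (incr s r d (-1)) i r d = peak X s i r d - 1" using peak_incr[OF rd rd] by simp
  show "last_peak X (incr s r d (-1)) i r d"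
    unfolding last_peak_def eq
  proof (intro conjI rd)
    show "\<forall>(q, e)\<in>factors_of_color X i.
      (earlier X q e r d \<longrightarrow> peak X (incr s r d (-1)) i q e \<le> peak X s i r d - 1) \<and>
      (earlier X r d q e \<longrightarrow> peak X (incr s r d (-1)) i q e < peak X s i r d - 1)"
    proof (safe, goal_cases)
      case (1 q e)
      then have "peak X s i q e < peak X s i r d" using assms by (fastforce simp: first_peak_def)
      then show ?case using 1 earlier_asym[OF rd, of q e] peak_incr[OF rd, of q e s "-1"] by auto
    next
      case (2 q e)
      then have "peak X s i q e \<le> peak X s i r d" using assms by (fastforce simp: first_peak_def)
      then show ?case using 2 earlier_asym(2)[OF 2(1) rd] peak_incr[OF rd, of q e s "-1"] by auto
    qed
  qed (use assms in \<open>simp add: first_peak_def\<close>)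
qed

lemma incr_incr [simp]: "incr (incr s r d z) r d (- z) = s" "incr (incr s r d (- z)) r d z = s"
  by (auto simp: incr_def)

lemma elts_T_infinity: "elts (T_infinity X) = {tableau_of X s | s. count_family X s}"
proof -
  have "T \<in> {tableau_of X s | s. count_family X s}" if "marginally_large X T" for T
    using tableau_of_box_count[OF that, symmetric] count_family_box_count by blast
  then show ?thesis using marginally_large_tableau_of by (auto simp: T_infinity_def)
qed

section \<open>The elements of \<open>K_infinity\<close> for a fixed choice of paths\<close>

context
  fixes X :: etype and p :: "nat \<Rightarrow> weight list"
  assumes p: "\<forall>r\<in>{1..nrows X}. full_path X r (p r)"
begin

lemma pivot_factors_eq: "pivot_factors X p =
    concat (map (\<lambda>r. map (Pair r) (rev (map (\<lambda>(x, x'). arrow_group X r x x') (path_arrows (p r)))))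
      (rev [1..<Suc (nrows X)]))"
  by (simp add: pivot_factors_def factor_arrows_def map_concat o_def rev_map case_prod_unfold)

lemma set_pivot_factors: "set (pivot_factors X p) = {(r, d). r \<in> {1..nrows X} \<and> d \<in> reduced_nodes X r}"
proof -
  have "(\<lambda>(x, x'). arrow_group X r x x') ` set (path_arrows (p r)) = reduced_nodes X r"
    if "r \<in> {1..nrows X}" for r
    using full_path_pivots(1)[OF that bspec[OF p that]] by simp
  then have "(\<Union>r\<in>{1..nrows X}. Pair r ` (\<lambda>(x, x'). arrow_group X r x x') ` set (path_arrows (p r))) =
      (\<Union>r\<in>{1..nrows X}. Pair r ` reduced_nodes X r)"
    by (intro SUP_cong refl) simp
  moreover have "set (pivot_factors X p) =
      (\<Union>r\<in>{1..nrows X}. Pair r ` (\<lambda>(x, x'). arrow_group X r x x') ` set (path_arrows (p r)))"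
    unfolding pivot_factors_eq by (simp add: atLeastLessThanSuc_atLeastAtMost del: upt_Suc)
  ultimately show ?thesis by auto
qed

lemma sorted_pivot_factors:
  "sorted_wrt (\<lambda>(q, e) (r, d). r < q \<or> r = q \<and> \<not> below X d e) (pivot_factors X p)"
  unfolding pivot_factors_eq
proof (intro sorted_wrt_rows sorted_wrt_rev_upt)
  fix r assume "r \<in> set (rev [1..<Suc (nrows X)])"
  then have r: "r \<in> {1..nrows X}" by auto
  show "sorted_wrt (\<lambda>e d. \<not> below X d e) (rev (map (\<lambda>(x, x'). arrow_group X r x x') (path_arrows (p r))))"
    using full_path_pivots(2)[OF r bspec[OF p r]] by (simp add: sorted_wrt_rev)
qed

lemma pivot_factors_order:
  assumes "u < v" "v < length (pivot_factors X p)"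
    "pivot_factors X p ! u = (q, e)" "pivot_factors X p ! v = (r, d)"
  shows "r < q \<or> r = q \<and> \<not> below X d e"
  using sorted_wrt_nth_less[OF sorted_pivot_factors assms(1,2)] assms(3,4) by simp

lemma distinct_pivot_factors: "distinct (pivot_factors X p)"
proof -
  have "pivot_factors X p ! u \<noteq> pivot_factors X p ! v" if "u < v" "v < length (pivot_factors X p)" for u v
    using pivot_factors_order[OF that] by (cases "pivot_factors X p ! u") fastforce
  then show ?thesis by (metis distinct_conv_nth linorder_neqE_nat)
qed

lemma ambient_crystal_eq: "ambient_crystal X p = tensor (factor_crystals X p)"
proof -
  have "(case y of (r, x, x') \<Rightarrow> transport_crystal Inr projr (elementary_crystal X (arrow_color X x x'))) =
      (case (case y of (r, x, x') \<Rightarrow> (r, arrow_group X r x x')) of (r, d) \<Rightarrow>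
        (transport_crystal Inr projr (elementary_crystal X (pivot_color X r d)) :: (free_alg set + int) crystal))"
    if "y \<in> set (factor_arrows X p)" for y
  proof -
    obtain r x x' where y: "y = (r, x, x')" by (cases y)
    then have r: "r \<in> {1..nrows X}" and "(x, x') \<in> set (path_arrows (p r))"
      using that by (auto simp: factor_arrows_def)
    then obtain i where "row_arrow X r i x x'" using full_path_pivots(3)[OF r bspec[OF p r]] by blast
    then show ?thesis using arrow_group(2,5)[OF r] y by simp
  qed
  then show ?thesis
    by (simp add: ambient_crystal_def factor_crystals_def pivot_factors_def o_def cong: map_cong)
qed

lemma K_element_eq: "K_element X p s =
    Inl (b_infinity X) # map (\<lambda>(r, d). Inr (- s r d)) (pivot_factors X p)"
  by (simp add: K_element_def pivot_factors_def o_def case_prod_unfold)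

lemma K_element_cong:
  assumes "\<And>r d. r \<in> {1..nrows X} \<Longrightarrow> d \<in> reduced_nodes X r \<Longrightarrow> s r d = s' r d"
  shows "K_element X p s = K_element X p s'"
  using assms set_pivot_factors by (auto simp: K_element_eq)

lemma K_element_inj:
  assumes "K_element X p s = K_element X p s'" "r \<in> {1..nrows X}" "d \<in> reduced_nodes X r"
  shows "s r d = s' r d"
proof -
  have "(r, d) \<in> set (pivot_factors X p)" using assms set_pivot_factors by blast
  then show ?thesis using assms(1) by (auto simp: K_element_eq)
qed

lemma K_element_incr:
  assumes "v < length (pivot_factors X p)" "pivot_factors X p ! v = (r, d)"
  shows "(K_element X p s)[Suc v := Inr (- (s r d + z))] = K_element X p (incr s r d z)"
proof -
  have "pivot_factors X p ! u \<noteq> (r, d)" if "u < length (pivot_factors X p)" "u \<noteq> v" for u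
    using distinct_pivot_factors assms that by (metis nth_eq_iff_index_eq)
  then show ?thesis
    using assms by (auto simp: K_element_eq incr_def nth_list_update case_prod_unfold prod_eq_iff
        intro!: nth_equalityI)
qed

lemma elts_K_infinity: "elts (K_infinity X p) = {K_element X p s | s. count_family X s}"
  by (simp add: K_infinity_def restrict_crystal_def K_infinity_elts_def count_family_def)

lemma length_factor_crystals: "length (factor_crystals X p) = Suc (length (pivot_factors X p))"
  by (simp add: factor_crystals_def)

lemma length_K_element: "length (K_element X p s) = Suc (length (pivot_factors X p))"
  by (simp add: K_element_eq)

lemma factor_0:
  "factor_crystals X p ! 0 = transport_crystal Inl projl (B_infinity X)"
  "K_element X p s ! 0 = Inl (b_infinity X)"
  by (simp_all add: factor_crystals_def K_element_eq)

lemma factor_Suc: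
  assumes "v < length (pivot_factors X p)" "pivot_factors X p ! v = (r, d)"
  shows "factor_crystals X p ! Suc v = transport_crystal Inr projr (elementary_crystal X (pivot_color X r d))"
    "K_element X p s ! Suc v = Inr (- s r d)"
  using assms by (simp_all add: factor_crystals_def K_element_eq)

lemma wt_factor_0: "wt (factor_crystals X p ! 0) (K_element X p s ! 0) j = 0"
  by (simp add: factor_0 transport_crystal_def wt_b_infinity)

lemma wt_factor_Suc:
  assumes "v < length (pivot_factors X p)"
  shows "wt (factor_crystals X p ! Suc v) (K_element X p s ! Suc v) j =
    (case pivot_factors X p ! v of (r, d) \<Rightarrow> - s r d * simple_root X (pivot_color X r d) j)"
  using factor_Suc[OF assms] by (cases "pivot_factors X p ! v") (simp add: transport_crystal_def elementary_crystal_def)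

lemma K_element_in_ambient: "K_element X p s \<in> elts (ambient_crystal X p)"
proof -
  have "K_element X p s ! k \<in> elts (factor_crystals X p ! k)" if "k < Suc (length (pivot_factors X p))" for k
  proof (cases k)
    case 0
    then show ?thesis by (simp add: factor_0 transport_crystal_def B_infinity_def Let_def b_infinity_in_B_infinity)
  next
    case (Suc v)
    then have v: "v < length (pivot_factors X p)" using that by simp
    show ?thesis
      using factor_Suc[OF v] Suc
      by (cases "pivot_factors X p ! v") (simp add: transport_crystal_def elementary_crystal_def)
  qed
  then show ?thesis
    by (simp add: ambient_crystal_eq tensor_def length_factor_crystals length_K_element)
qed

lemma wt_K_element: "wt (K_infinity X p) (K_element X p s) =
    (\<lambda>j. - (\<Sum>(r, d)\<in>set (pivot_factors X p). s r d * simple_root X (pivot_color X r d) j))"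
proof
  fix j
  have "wt (K_infinity X p) (K_element X p s) j =
      (\<Sum>v<length (pivot_factors X p). case pivot_factors X p ! v of (r, d) \<Rightarrow> - s r d * simple_root X (pivot_color X r d) j)"
    by (simp add: K_infinity_def restrict_crystal_def ambient_crystal_eq tensor_def tensor_wt_def
        length_K_element sum.lessThan_Suc_shift wt_factor_0 wt_factor_Suc del: sum.lessThan_Suc)
  also have "\<dots> = (\<Sum>b\<in>set (pivot_factors X p). case b of (r, d) \<Rightarrow> - s r d * simple_root X (pivot_color X r d) j)"
    by (rule sum.reindex_bij_betw) (use bij_betw_nth[OF distinct_pivot_factors] in auto)
  finally show "wt (K_infinity X p) (K_element X p s) j =
      - (\<Sum>(r, d)\<in>set (pivot_factors X p). s r d * simple_root X (pivot_color X r d) j)"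
    by (simp add: sum_negf case_prod_unfold)
qed

lemma signature_K_0: "signature_value (factor_crystals X p) i (K_element X p s) 0 = Fin 0"
  by (simp add: signature_value_def factor_0 transport_crystal_def eps_b_infinity)

lemma signature_K_other:
  assumes "v < length (pivot_factors X p)" "pivot_factors X p ! v = (r, d)" "pivot_color X r d \<noteq> i"
  shows "signature_value (factor_crystals X p) i (K_element X p s) (Suc v) = Minf"
  using assms by (simp add: signature_value_def factor_Suc transport_crystal_def elementary_crystal_def)

lemma in_factors_of_color_iff:
  "(r, d) \<in> factors_of_color X i \<longleftrightarrow> (r, d) \<in> set (pivot_factors X p) \<and> pivot_color X r d = i"
  by (auto simp: factors_of_color_def set_pivot_factors)

text \<open>Only factors with nonzero Cartan entry affect the weight sum. Their colors equal or
  neighbor i, so they lie in other rows or are comparable with d, and \<open>earlier\<close> decides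
  on which side they stand for any choice of paths.\<close>

lemma signature_K_peak:
  assumes i: "i \<in> index_set X" and v: "v < length (pivot_factors X p)"
    and rd: "pivot_factors X p ! v = (r, d)" "pivot_color X r d = i"
  shows "signature_value (factor_crystals X p) i (K_element X p s) (Suc v) = Fin (peak X s i r d)"
proof -
  let ?P = "pivot_factors X p"
  define g where "g = (\<lambda>(q, e). s q e * cartan X i (pivot_color X q e))"
  have "(r, d) \<in> set ?P" using v rd nth_mem by metis
  then have r: "r \<in> {1..nrows X}" and d: "d \<in> reduced_nodes X r" by (auto simp: set_pivot_factors)
  have "(\<Sum>u<Suc v. wt (factor_crystals X p ! u) (K_element X p s ! u) i) = (\<Sum>u<v. - g (?P ! u))"
    unfolding sum.lessThan_Suc_shift wt_factor_0 using v i
    by (simp add: wt_factor_Suc g_def simple_root_def case_prod_unfold)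
  then have "- (\<Sum>u<Suc v. wt (factor_crystals X p ! u) (K_element X p s ! u) i) = (\<Sum>u<v. g (?P ! u))"
    by (simp add: sum_negf del: sum.lessThan_Suc)
  also have "\<dots> = (\<Sum>b\<in>(!) ?P ` {..<v}. g b)"
    using v distinct_pivot_factors by (subst sum.reindex) (auto simp: inj_on_def nth_eq_iff_index_eq)
  also have "\<dots> = (\<Sum>b\<in>{(q, e). (q, e) \<in> set ?P \<and> earlier X q e r d}. g b)"
  proof (rule sum.mono_neutral_cong)
    have *: "b \<in> (!) ?P ` {..<v} \<longleftrightarrow> earlier X q e r d"
      if b: "b = (q, e)" "b \<in> set ?P" "g b \<noteq> 0" for b q e
    proof -
      obtain u where u: "u < length ?P" "?P ! u = (q, e)" using b by (auto simp: in_set_conv_nth)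
      have e: "e \<in> reduced_nodes X q" using b by (auto simp: set_pivot_factors)
      have cmp: "q = r \<Longrightarrow> below X d e \<or> below X e d"
        using pivots_comparable[OF r d, of e] e b rd(2) by (auto simp: g_def)
      have "b \<in> (!) ?P ` {..<v} \<longleftrightarrow> u < v"
        using u v b distinct_pivot_factors by (auto simp: nth_eq_iff_index_eq intro!: image_eqI[of _ _ u])
      also have "\<dots> \<longleftrightarrow> earlier X q e r d"
      proof (cases u v rule: linorder_cases)
        case less
        have "r < q \<or> r = q \<and> \<not> below X d e" using pivot_factors_order[OF less v u(2) rd(1)] .
        then show ?thesis using less cmp by (auto simp: earlier_def)
      next
        case equal
        then show ?thesis using u rd by (simp add: earlier_def)
      next
        case greater
        have "q < r \<or> q = r \<and> \<not> below X e d" using pivot_factors_order[OF greater u(1) rd(1) u(2)] .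
        then show ?thesis using greater by (auto simp: earlier_def)
      qed
      finally show ?thesis .
    qed
    have mem: "b \<in> set ?P" if "b \<in> (!) ?P ` {..<v}" for b using that v by auto
    fix b :: "nat \<times> weight"
    obtain q e where b: "b = (q, e)" by (cases b)
    show "g b = 0" if "b \<in> {(q, e). (q, e) \<in> set ?P \<and> earlier X q e r d} - (!) ?P ` {..<v}"
      using *[of b q e] b that by blast
    show "g b = 0" if "b \<in> (!) ?P ` {..<v} - {(q, e). (q, e) \<in> set ?P \<and> earlier X q e r d}"
      using *[of b q e] mem[of b] b that by auto
  next
    show "finite {(q, e). (q, e) \<in> set ?P \<and> earlier X q e r d}"
      by (rule finite_subset[of _ "set ?P"]) auto
  qed simp_all
  also have "{(q, e). (q, e) \<in> set ?P \<and> earlier X q e r d} =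
      Sigma {r<..nrows X} (reduced_nodes X) \<union> {r} \<times> {e \<in> reduced_nodes X r. below X e d \<and> e \<noteq> d}"
    using r by (auto simp: set_pivot_factors earlier_def)
  also have "(\<Sum>b\<in>\<dots>. g b) = (\<Sum>q\<in>{r<..nrows X}. \<Sum>e\<in>reduced_nodes X q. g (q, e)) +
      (\<Sum>e\<in>{e \<in> reduced_nodes X r. below X e d \<and> e \<noteq> d}. g (r, e))"
  proof -
    have fin: "finite (reduced_nodes X q)" if "q \<in> {r<..nrows X}" for q
      using that by (intro finite_reduced_nodes) auto
    have "(\<Sum>b\<in>{r} \<times> {e \<in> reduced_nodes X r. below X e d \<and> e \<noteq> d}. g b) =
        (\<Sum>e\<in>{e \<in> reduced_nodes X r. below X e d \<and> e \<noteq> d}. g (r, e))"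
      by (rule sum.reindex_bij_witness[of _ "Pair r" snd]) auto
    moreover have "(\<Sum>b\<in>Sigma {r<..nrows X} (reduced_nodes X). g b) =
        (\<Sum>q\<in>{r<..nrows X}. \<Sum>e\<in>reduced_nodes X q. g (q, e))"
      using fin by (subst sum.Sigma) auto
    ultimately show ?thesis
      using fin finite_reduced_nodes[OF r] by (subst sum.union_disjoint) auto
  qed
  finally have "s r d - (\<Sum>u<Suc v. wt (factor_crystals X p ! u) (K_element X p s ! u) i) = peak X s i r d"
    by (simp add: peak_def g_def mult.commute)
  moreover have "eps (factor_crystals X p ! Suc v) i (K_element X p s ! Suc v) = Fin (s r d)"
    using factor_Suc[OF v rd(1)] rd(2) by (simp add: transport_crystal_def elementary_crystal_def)
  ultimately show ?thesis by (simp add: signature_value_def)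
qed

lemma factor_index:
  assumes "(r, d) \<in> factors_of_color X i"
  obtains v where "v < length (pivot_factors X p)" "pivot_factors X p ! v = (r, d)" "pivot_color X r d = i"
  using assms by (auto simp: in_factors_of_color_iff in_set_conv_nth)

lemma signature_K_cases:
  assumes i: "i \<in> index_set X" and u: "u < length (pivot_factors X p)"
  shows "signature_value (factor_crystals X p) i (K_element X p s) (Suc u) = Minf \<or>
    (\<exists>(q, e)\<in>factors_of_color X i. pivot_factors X p ! u = (q, e) \<and>
      signature_value (factor_crystals X p) i (K_element X p s) (Suc u) = Fin (peak X s i q e))"
proof -
  obtain q e where qe: "pivot_factors X p ! u = (q, e)" by fastforce
  show ?thesis
  proof (cases "pivot_color X q e = i")
    case True
    then have "(q, e) \<in> factors_of_color X i" using u qe nth_mem by (metis in_factors_of_color_iff)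
    then show ?thesis using qe signature_K_peak[OF i u qe True] by blast
  qed (use signature_K_other[OF u qe] in simp)
qed

lemma earlier_index:
  assumes rd: "(r, d) \<in> factors_of_color X i" and qe: "(q, e) \<in> factors_of_color X i"
    and "v < length (pivot_factors X p)" "pivot_factors X p ! v = (r, d)"
    and "u < length (pivot_factors X p)" "pivot_factors X p ! u = (q, e)" and "u < v"
  shows "earlier X q e r d"
proof -
  have "r < q \<or> r = q \<and> \<not> below X d e" using pivot_factors_order assms by blast
  moreover have "(q, e) \<noteq> (r, d)" using assms distinct_pivot_factors by (metis nth_eq_iff_index_eq less_irrefl)
  ultimately show ?thesis using earlier_total[OF rd qe] by (auto simp: earlier_def)
qed

lemma eps_K:
  assumes "k < Suc (length (pivot_factors X p))"
    and "signature_value (factor_crystals X p) i (K_element X p s) k = Fin z"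
    and "\<And>w. w < Suc (length (pivot_factors X p)) \<Longrightarrow>
      signature_value (factor_crystals X p) i (K_element X p s) w \<le> Fin z"
  shows "eps (K_infinity X p) i (K_element X p s) = Fin z"
proof -
  have "Max (signature_value (factor_crystals X p) i (K_element X p s) ` {..<Suc (length (pivot_factors X p))}) = Fin z"
    using assms by (intro Max_eqI) (auto simp: image_iff intro!: bexI[of _ k])
  then show ?thesis
    by (simp add: K_infinity_def restrict_crystal_def ambient_crystal_eq tensor_def tensor_eps_def length_K_element)
qed

lemma last_peak_K:
  assumes i: "i \<in> index_set X" and lp: "last_peak X s i r d"
  shows "ft (K_infinity X p) i (K_element X p s) = Some (K_element X p (incr s r d 1))"
    and "eps (K_infinity X p) i (K_element X p s) = Fin (peak X s i r d)"
proof -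
  let ?P = "pivot_factors X p"
  let ?sig = "signature_value (factor_crystals X p) i (K_element X p s)"
  have rd: "(r, d) \<in> factors_of_color X i" using lp by (simp add: last_peak_def)
  obtain v where v: "v < length ?P" "?P ! v = (r, d)" "pivot_color X r d = i" using rd by (rule factor_index)
  have sv: "?sig (Suc v) = Fin (peak X s i r d)" by (rule signature_K_peak[OF i v])
  \<comment> \<open>Equality with the leftmost factor is harmless, since \<open>ft\<close> prefers
    the rightmost maximum.\<close>
  have sig0: "?sig 0 \<le> ?sig (Suc v)" using signature_K_0[of i s] lp sv by (simp add: last_peak_def)
  have sig: "(u < v \<longrightarrow> ?sig (Suc u) \<le> ?sig (Suc v)) \<and> (v < u \<longrightarrow> ?sig (Suc u) < ?sig (Suc v))"
    if u: "u < length ?P" for u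
    using signature_K_cases[OF i u, of s]
  proof (elim disjE bexE)
    fix b assume b: "b \<in> factors_of_color X i"
      "case b of (q, e) \<Rightarrow> ?P ! u = (q, e) \<and> ?sig (Suc u) = Fin (peak X s i q e)"
    then obtain q e where qe: "(q, e) \<in> factors_of_color X i" "?P ! u = (q, e)" "?sig (Suc u) = Fin (peak X s i q e)"
      by auto
    then have "u < v \<longrightarrow> earlier X q e r d" "v < u \<longrightarrow> earlier X r d q e"
      using earlier_index[OF rd qe(1) v(1,2) u qe(2)] earlier_index[OF qe(1) rd u qe(2) v(1,2)] by auto
    then show ?thesis using qe lp sv by (fastforce simp: last_peak_def)
  qed (simp add: sv)
  then have before: "?sig w \<le> ?sig (Suc v)" if "w < Suc v" for w
    using that sig0 v(1) by (cases w) auto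
  have after: "?sig w < ?sig (Suc v)" if "w < Suc (length ?P)" "Suc v < w" for w
    using that sig by (cases w) auto
  have "f_position (factor_crystals X p) i (K_element X p s) = Suc v"
    unfolding f_position_def length_K_element
    using before after v(1) by (intro the1_equality[OF ex1_last_argmax]) auto
  then show "ft (K_infinity X p) i (K_element X p s) = Some (K_element X p (incr s r d 1))"
    using K_element_incr[OF v(1,2), of s 1] v(3) factor_Suc(1)[OF v(1,2)] factor_Suc(2)[OF v(1,2), of s]
    by (simp add: K_infinity_def restrict_crystal_def ambient_crystal_eq tensor_def transport_crystal_def
        elementary_crystal_def)
  have "?sig w \<le> Fin (peak X s i r d)" if "w < Suc (length ?P)" for w
    using before[of w] after[OF that] sv by (cases w "Suc v" rule: linorder_cases) auto
  then show "eps (K_infinity X p) i (K_element X p s) = Fin (peak X s i r d)"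
    using v(1) sv by (intro eps_K[of "Suc v"]) auto
qed

lemma first_peak_K:
  assumes i: "i \<in> index_set X" and fp: "first_peak X s i r d"
  shows "et (K_infinity X p) i (K_element X p s) = Some (K_element X p (incr s r d (-1)))"
    and "eps (K_infinity X p) i (K_element X p s) = Fin (peak X s i r d)"
proof -
  let ?P = "pivot_factors X p"
  let ?sig = "signature_value (factor_crystals X p) i (K_element X p s)"
  have rd: "(r, d) \<in> factors_of_color X i" using fp by (simp add: first_peak_def)
  obtain v where v: "v < length ?P" "?P ! v = (r, d)" "pivot_color X r d = i" using rd by (rule factor_index)
  have sv: "?sig (Suc v) = Fin (peak X s i r d)" by (rule signature_K_peak[OF i v])
  have sig0: "?sig 0 < ?sig (Suc v)" using signature_K_0[of i s] fp sv by (simp add: first_peak_def)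
  have sig: "(u < v \<longrightarrow> ?sig (Suc u) < ?sig (Suc v)) \<and> (v < u \<longrightarrow> ?sig (Suc u) \<le> ?sig (Suc v))"
    if u: "u < length ?P" for u
    using signature_K_cases[OF i u, of s]
  proof (elim disjE bexE)
    fix b assume b: "b \<in> factors_of_color X i"
      "case b of (q, e) \<Rightarrow> ?P ! u = (q, e) \<and> ?sig (Suc u) = Fin (peak X s i q e)"
    then obtain q e where qe: "(q, e) \<in> factors_of_color X i" "?P ! u = (q, e)" "?sig (Suc u) = Fin (peak X s i q e)"
      by auto
    then have "u < v \<longrightarrow> earlier X q e r d" "v < u \<longrightarrow> earlier X r d q e"
      using earlier_index[OF rd qe(1) v(1,2) u qe(2)] earlier_index[OF qe(1) rd u qe(2) v(1,2)] by auto
    then show ?thesis using qe fp sv by (fastforce simp: first_peak_def)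
  qed (simp add: sv)
  then have before: "?sig w < ?sig (Suc v)" if "w < Suc v" for w
    using that sig0 v(1) by (cases w) auto
  have after: "?sig w \<le> ?sig (Suc v)" if "w < Suc (length ?P)" "Suc v < w" for w
    using that sig by (cases w) auto
  have "e_position (factor_crystals X p) i (K_element X p s) = Suc v"
    unfolding e_position_def length_K_element
    using before after v(1) by (intro the1_equality[OF ex1_first_argmax]) auto
  then show "et (K_infinity X p) i (K_element X p s) = Some (K_element X p (incr s r d (-1)))"
    using K_element_incr[OF v(1,2), of s "-1"] v(3) factor_Suc(1)[OF v(1,2)] factor_Suc(2)[OF v(1,2), of s]
    by (simp add: K_infinity_def restrict_crystal_def ambient_crystal_eq tensor_def transport_crystal_def
        elementary_crystal_def)
  have "?sig w \<le> Fin (peak X s i r d)" if "w < Suc (length ?P)" for w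
    using before[of w] after[OF that] sv by (cases w "Suc v" rule: linorder_cases) auto
  then show "eps (K_infinity X p) i (K_element X p s) = Fin (peak X s i r d)"
    using v(1) sv by (intro eps_K[of "Suc v"]) auto
qed

text \<open>The leftmost factor attains the maximum 0, so \<open>et\<close> acts on
  \<open>b_infinity X\<close> and gives \<open>None\<close>.\<close>

lemma no_peak_K:
  assumes i: "i \<in> index_set X" and np: "\<forall>(r, d)\<in>factors_of_color X i. peak X s i r d \<le> 0"
  shows "et (K_infinity X p) i (K_element X p s) = None"
    and "eps (K_infinity X p) i (K_element X p s) = Fin 0"
proof -
  let ?sig = "signature_value (factor_crystals X p) i (K_element X p s)"
  have le: "?sig w \<le> Fin 0" if "w < Suc (length (pivot_factors X p))" for w
  proof (cases w)
    case (Suc u)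
    then have "u < length (pivot_factors X p)" using that by simp
    from signature_K_cases[OF i this, of s] show ?thesis using np Suc by auto
  qed (simp add: signature_K_0)
  have "e_position (factor_crystals X p) i (K_element X p s) = 0"
    unfolding e_position_def length_K_element
    using le by (intro the1_equality[OF ex1_first_argmax]) (auto simp: signature_K_0)
  then show "et (K_infinity X p) i (K_element X p s) = None"
    by (simp add: K_infinity_def restrict_crystal_def ambient_crystal_eq tensor_def transport_crystal_def
        factor_0 e_b_infinity)
  show "eps (K_infinity X p) i (K_element X p s) = Fin 0"
    using le by (intro eps_K[of 0]) (simp_all add: signature_K_0)
qed

lemma wt_K_incr:
  assumes "(r, d) \<in> factors_of_color X i"
  shows "wt (K_infinity X p) (K_element X p (incr s r d z)) =
    (\<lambda>j. wt (K_infinity X p) (K_element X p s) j - z * simple_root X i j)"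
proof
  fix j
  have rd: "(r, d) \<in> set (pivot_factors X p)" "pivot_color X r d = i"
    using assms in_factors_of_color_iff by auto
  have "(\<Sum>(q, e)\<in>set (pivot_factors X p). incr s r d z q e * simple_root X (pivot_color X q e) j) =
      (\<Sum>b\<in>set (pivot_factors X p). (case b of (q, e) \<Rightarrow> s q e * simple_root X (pivot_color X q e) j) +
        (if b = (r, d) then z * simple_root X i j else 0))"
    using rd(2) by (intro sum.cong refl) (auto simp: incr_def algebra_simps split: if_splits)
  then show "wt (K_infinity X p) (K_element X p (incr s r d z)) j =
      wt (K_infinity X p) (K_element X p s) j - z * simple_root X i j"
    using rd by (simp add: wt_K_element sum.distrib)
qed

lemma phi_K: "phi (K_infinity X p) i b = eps (K_infinity X p) i b + Fin (wt (K_infinity X p) b i)"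
  by (simp add: K_infinity_def restrict_crystal_def ambient_crystal_eq tensor_def)

lemma ft_K_cases:
  assumes "i \<in> index_set X" "count_family X s"
  obtains r d where "last_peak X s i r d" "count_family X (incr s r d 1)"
    "tableau_f X i (tableau_of X s) = Some (tableau_of X (incr s r d 1))"
    "ft (K_infinity X p) i (K_element X p s) = Some (K_element X p (incr s r d 1))"
  using tableau_f_tableau_of[OF assms(2,1)] last_peak_K(1)[OF assms(1)] by blast

lemma et_K_cases:
  assumes "i \<in> index_set X" "count_family X s"
  obtains (some) r d where "first_peak X s i r d" "count_family X (incr s r d (-1))"
    "tableau_e X i (tableau_of X s) = Some (tableau_of X (incr s r d (-1)))"
    "et (K_infinity X p) i (K_element X p s) = Some (K_element X p (incr s r d (-1)))"
  | (none) "tableau_e X i (tableau_of X s) = None" "et (K_infinity X p) i (K_element X p s) = None"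
    "eps (K_infinity X p) i (K_element X p s) = Fin 0"
  using tableau_e_tableau_of[OF assms(2,1)]
proof (elim disjE exE conjE)
  fix r d
  assume "first_peak X s i r d" "count_family X (incr s r d (-1))"
    "tableau_e X i (tableau_of X s) = Some (tableau_of X (incr s r d (-1)))"
  then show thesis using some first_peak_K(1)[OF assms(1)] by blast
next
  assume np: "\<forall>(r, d)\<in>factors_of_color X i. peak X s i r d \<le> 0"
    and e: "tableau_e X i (tableau_of X s) = None"
  show thesis by (rule none[OF e no_peak_K[OF assms(1) np]])
qed

text \<open>Each operator is a change of one count that preserves \<open>count_family\<close>;
  \<open>first_peak_incr\<close> and \<open>last_peak_decr\<close> give the effect on
  \<open>eps\<close> and make the operators mutually inverse.\<close>

lemma is_crystal_K_infinity: "is_crystal X (K_infinity X p)"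
  unfolding is_crystal_def
proof (intro conjI ballI allI impI)
  fix b j assume "b \<in> elts (K_infinity X p)" and j: "j \<notin> index_set X"
  then obtain s where "b = K_element X p s" by (auto simp: elts_K_infinity)
  moreover have "simple_root X i j = 0" for i using j by (simp add: simple_root_def)
  ultimately show "wt (K_infinity X p) b j = 0" by (simp add: wt_K_element case_prod_unfold)
next
  fix i b assume i: "i \<in> index_set X" and b: "b \<in> elts (K_infinity X p)"
  let ?K = "K_infinity X p"
  obtain s where s: "count_family X s" "b = K_element X p s" using b by (auto simp: elts_K_infinity)
  show "phi ?K i b = eps ?K i b + Fin (wt ?K b i)" by (rule phi_K)
  \<comment> \<open>A last peak always exists and its value is \<open>eps\<close>, so the axiom
    about \<open>Minf\<close> is vacuous.\<close>
  have fin: "\<exists>z. eps ?K i b = Fin z"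
    using ft_K_cases[OF i s(1)] last_peak_K(2)[OF i] s(2) by metis
  have root: "simple_root X i i = 2" using i by (simp add: simple_root_def)
  {
    fix b' assume e: "et ?K i b = Some b'"
    obtain r d where rd: "first_peak X s i r d" "count_family X (incr s r d (-1))"
        "b' = K_element X p (incr s r d (-1))"
      using et_K_cases[OF i s(1)] e s(2) by (metis option.distinct(1) option.inject)
    have rdf: "(r, d) \<in> factors_of_color X i" using rd(1) by (simp add: first_peak_def)
    show "b' \<in> elts ?K" using rd by (auto simp: elts_K_infinity)
    show wt: "wt ?K b' = (\<lambda>j. wt ?K b j + simple_root X i j)"
      using wt_K_incr[OF rdf, of s "-1"] by (simp add: rd s)
    show eps: "eps ?K i b' = eps ?K i b + Fin (- 1)"
      using first_peak_K(2)[OF i rd(1)] last_peak_K(2)[OF i last_peak_decr(1)[OF rd(1)]]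
        last_peak_decr(2)[OF rd(1)] by (simp add: rd s)
    show "phi ?K i b' = phi ?K i b + Fin 1" using fin by (auto simp: phi_K eps wt root)
  }
  {
    fix b' assume f: "ft ?K i b = Some b'"
    obtain r d where rd: "last_peak X s i r d" "count_family X (incr s r d 1)"
        "b' = K_element X p (incr s r d 1)"
      using ft_K_cases[OF i s(1)] f s(2) by (metis option.inject)
    have rdf: "(r, d) \<in> factors_of_color X i" using rd(1) by (simp add: last_peak_def)
    show "b' \<in> elts ?K" using rd by (auto simp: elts_K_infinity)
    show wt: "wt ?K b' = (\<lambda>j. wt ?K b j - simple_root X i j)"
      using wt_K_incr[OF rdf, of s 1] by (simp add: rd s)
    show eps: "eps ?K i b' = eps ?K i b + Fin 1"
      using last_peak_K(2)[OF i rd(1)] first_peak_K(2)[OF i first_peak_incr(1)[OF rd(1)]]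
        first_peak_incr(2)[OF rd(1)] by (simp add: rd s)
    show "phi ?K i b' = phi ?K i b + Fin (- 1)" using fin by (auto simp: phi_K eps wt root)
  }
  {
    fix b' assume "b' \<in> elts ?K"
    then obtain s' where s': "count_family X s'" "b' = K_element X p s'" by (auto simp: elts_K_infinity)
    show "ft ?K i b = Some b' \<longleftrightarrow> et ?K i b' = Some b"
    proof
      assume f: "ft ?K i b = Some b'"
      obtain r d where rd: "last_peak X s i r d" "b' = K_element X p (incr s r d 1)"
        using ft_K_cases[OF i s(1)] f s(2) by (metis option.inject)
      show "et ?K i b' = Some b"
        using first_peak_K(1)[OF i first_peak_incr(1)[OF rd(1)]] by (simp add: rd s)
    next
      assume e: "et ?K i b' = Some b"
      obtain r d where rd: "first_peak X s' i r d" "b = K_element X p (incr s' r d (-1))"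
        using et_K_cases[OF i s'(1)] e s'(2) by (metis option.distinct(1) option.inject)
      show "ft ?K i b = Some b'"
        using last_peak_K(1)[OF i last_peak_decr(1)[OF rd(1)]] incr_incr(2)[of s' r d 1] by (simp add: rd s')
    qed
  }
  assume "phi ?K i b = Minf"
  then have False using fin by (auto simp: phi_K)
  then show "et ?K i b = None" "ft ?K i b = None" by auto
qed

lemma tableau_to_K_tableau_of:
  "count_family X s \<Longrightarrow> tableau_to_K X p (tableau_of X s) = K_element X p s"
  unfolding tableau_to_K_def using box_count_tableau_of by (intro K_element_cong) blast

lemma bij_tableau_to_K: "bij_betw (tableau_to_K X p) (elts (T_infinity X)) (elts (K_infinity X p))"
proof (rule bij_betw_imageI)
  show "inj_on (tableau_to_K X p) (elts (T_infinity X))"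
  proof (rule inj_onI)
    fix T T' assume T: "T \<in> elts (T_infinity X)" "T' \<in> elts (T_infinity X)"
      and eq: "tableau_to_K X p T = tableau_to_K X p T'"
    obtain s s' where s: "T = tableau_of X s" "count_family X s" "T' = tableau_of X s'" "count_family X s'"
      using T by (auto simp: elts_T_infinity)
    then have "s r d = s' r d" if "r \<in> {1..nrows X}" "d \<in> reduced_nodes X r" for r d
      using eq K_element_inj[of s s' r d] that by (simp add: tableau_to_K_tableau_of)
    then have "filled X s r = filled X s' r" "level X s r m = level X s' r m" if "r \<in> {1..nrows X}" for r m
      using that by (auto simp: filled_def level_def cong: image_cong)
    then have "row_length X s r = row_length X s' r" "box X s r m = box X s' r m" if "r \<in> {1..nrows X}" for r m
      using that by (auto simp: row_length_def box_def intro!: sum.cong)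
    then show "T = T'" by (auto simp: s tableau_of_def fun_eq_iff)
  qed
  show "tableau_to_K X p ` elts (T_infinity X) = elts (K_infinity X p)"
    unfolding elts_T_infinity elts_K_infinity using tableau_to_K_tableau_of by (auto simp: image_iff) metis+
qed

text \<open>On \<open>K_infinity\<close>, \<open>eps\<close> drops by 1 with each application of
  \<open>et\<close>, and \<open>et\<close> gives \<open>None\<close> exactly when \<open>eps\<close>
  is 0. Since \<open>tableau_e\<close> runs in parallel, \<open>eps\<close> counts its possible
  iterations.\<close>

lemma tableau_eps_tableau_of:
  assumes i: "i \<in> index_set X" and s: "count_family X s"
  shows "Fin (tableau_eps X i (tableau_of X s)) = eps (K_infinity X p) i (K_element X p s)"
proof -
  have iter: "option_iterate (tableau_e X i) k (tableau_of X s) \<noteq> None \<longleftrightarrow> k \<le> n"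
    if "count_family X s" "eps (K_infinity X p) i (K_element X p s) = Fin (int n)" for n k s
    using that
  proof (induction n arbitrary: s k)
    case (0 s)
    show ?case
      using i 0(1)
    proof (cases rule: et_K_cases)
      case (some r d)
      then show ?thesis using first_peak_K(2)[OF i some(1)] 0 by (simp add: first_peak_def)
    next
      case none
      then show ?thesis by (cases k) (simp_all add: option_iterate_0 option_iterate_Suc)
    qed
  next
    case (Suc n s)
    show ?case
      using i Suc.prems(1)
    proof (cases rule: et_K_cases)
      case (some r d)
      have "eps (K_infinity X p) i (K_element X p (incr s r d (-1))) = Fin (int n)"
        using first_peak_K(2)[OF i some(1)] last_peak_K(2)[OF i last_peak_decr(1)[OF some(1)]]
          last_peak_decr(2)[OF some(1)] Suc.prems(2) by simp
      then show ?thesis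
        using Suc.IH[OF some(2)] some(3) by (cases k) (simp_all add: option_iterate_0 option_iterate_Suc)
    next
      case none
      then show ?thesis using Suc.prems by simp
    qed
  qed
  obtain n where n: "eps (K_infinity X p) i (K_element X p s) = Fin (int n)"
  proof -
    obtain r d where rd: "last_peak X s i r d" using ft_K_cases[OF i s] .
    then have "0 \<le> peak X s i r d" by (simp add: last_peak_def)
    then show thesis using that[of "nat (peak X s i r d)"] last_peak_K(2)[OF i rd] by simp
  qed
  have "{k. option_iterate (tableau_e X i) k (tableau_of X s) \<noteq> None} = {..n}"
    using iter[OF s n] by auto
  moreover have "Max {..n} = n" by (rule Max_eqI) auto
  ultimately show ?thesis by (simp add: tableau_eps_def max_iterations_def n)
qed

text \<open>The boxes of a row sum to minus \<open>row_height\<close> at full length; subtracting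
  one source per box cancels the source term and leaves each pivot with its full count.\<close>

lemma wt_tableau_of:
  assumes s: "count_family X s"
  shows "wt (K_infinity X p) (K_element X p s) = tableau_wt X (tableau_of X s)"
proof
  fix j
  show "wt (K_infinity X p) (K_element X p s) j = tableau_wt X (tableau_of X s) j"
  proof (cases "j \<in> index_set X")
    case False
    have zero: "c j = 0" if "r \<in> {1..nrows X}" "c \<in> row_nodes X r" for r c
      using that row_nodes_subset[OF that(1)] node_outside[OF _ False] by blast
    have "map (\<lambda>c. c j - source X r j) (tableau_of X s r) = map (\<lambda>c. 0) (tableau_of X s r)"
      if "r \<in> {1..nrows X}" for r
    proof (intro map_cong refl)
      fix x assume "x \<in> set (tableau_of X s r)"
      then have "x \<in> row_nodes X r" using tableau_of_row(1)[OF s that] by blast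
      then show "x j - source X r j = 0" using zero[OF that, of x] zero[OF that source_in_row[OF that]] by simp
    qed
    then have "(\<Sum>c\<leftarrow>tableau_of X s r. c j - source X r j) = 0" if "r \<in> {1..nrows X}" for r
      using that by (simp only: sum_list_0)
    then show ?thesis
      using False by (simp add: wt_K_element simple_root_def tableau_wt_def case_prod_unfold)
  next
    case j: True
    have row: "(\<Sum>c\<leftarrow>tableau_of X s r. c j - source X r j) =
        - (\<Sum>d\<in>reduced_nodes X r. s r d * simple_root X (pivot_color X r d) j)"
      if r: "r \<in> {1..nrows X}" for r
    proof -
      let ?L = "row_length X s r"
      have "(\<Sum>c\<leftarrow>tableau_of X s r. c j - source X r j) =
          (\<Sum>k<?L. box X s r (?L - Suc k) j - source X r j)"
        using r by (simp add: tableau_of_def o_def lessThan_atLeast0 interv_sum_list_conv_sum_set_nat)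
      also have "\<dots> = (\<Sum>k<?L. box X s r k j - source X r j)"
        by (rule sum.nat_diff_reindex)
      also have "\<dots> = - row_height X s j r ?L - int ?L * source X r j"
        using sum_boxes[OF s j r, of ?L] by (simp add: sum_subtractf)
      also have "\<dots> = - (\<Sum>d\<in>reduced_nodes X r. s r d * simple_root X (pivot_color X r d) j)"
        using row_height_filled[OF s j r, of ?L] filled_less[of r X s] r j
        by (simp add: simple_root_def mult.commute)
      finally show ?thesis .
    qed
    have "set (pivot_factors X p) = Sigma {1..nrows X} (reduced_nodes X)"
      by (auto simp: set_pivot_factors)
    moreover have "(\<Sum>(r, d)\<in>Sigma {1..nrows X} (reduced_nodes X). s r d * simple_root X (pivot_color X r d) j) =
        (\<Sum>r=1..nrows X. \<Sum>d\<in>reduced_nodes X r. s r d * simple_root X (pivot_color X r d) j)"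
      using finite_reduced_nodes by (subst sum.Sigma) auto
    ultimately show ?thesis
      using row by (simp add: wt_K_element tableau_wt_def sum_negf)
  qed
qed

end

text \<open>Transfers the axioms from \<open>K_infinity\<close> to tableaux. As \<psi> is injective
  on the elements of \<open>A\<close> only, closure of \<open>A\<close> under the operators is what
  allows values of \<open>et\<close> and \<open>ft\<close> to be compared through \<psi>.\<close>

lemma is_crystal_pullback:
  assumes B: "is_crystal X B" and bij: "bij_betw \<psi> (elts A) (elts B)"
    and wt: "\<And>b. b \<in> elts A \<Longrightarrow> wt B (\<psi> b) = wt A b"
    and eps: "\<And>i b. i \<in> index_set X \<Longrightarrow> b \<in> elts A \<Longrightarrow> eps B i (\<psi> b) = eps A i b"
    and phi: "\<And>i b. i \<in> index_set X \<Longrightarrow> b \<in> elts A \<Longrightarrow> phi B i (\<psi> b) = phi A i b"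
    and et: "\<And>i b. i \<in> index_set X \<Longrightarrow> b \<in> elts A \<Longrightarrow> et B i (\<psi> b) = map_option \<psi> (et A i b)"
    and ft: "\<And>i b. i \<in> index_set X \<Longrightarrow> b \<in> elts A \<Longrightarrow> ft B i (\<psi> b) = map_option \<psi> (ft A i b)"
    and et_closed: "\<And>i b b'. i \<in> index_set X \<Longrightarrow> b \<in> elts A \<Longrightarrow> et A i b = Some b' \<Longrightarrow> b' \<in> elts A"
    and ft_closed: "\<And>i b b'. i \<in> index_set X \<Longrightarrow> b \<in> elts A \<Longrightarrow> ft A i b = Some b' \<Longrightarrow> b' \<in> elts A"
  shows "is_crystal X A"
proof -
  have mem: "\<psi> b \<in> elts B" if "b \<in> elts A" for b using bij that by (auto simp: bij_betw_def)
  have inj: "b = b'" if "b \<in> elts A" "b' \<in> elts A" "\<psi> b = \<psi> b'" for b b'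
    using bij that by (auto simp: bij_betw_def inj_on_def)
  have eq: "et A i b' = Some b \<longleftrightarrow> et B i (\<psi> b') = Some (\<psi> b)"
      "ft A i b' = Some b \<longleftrightarrow> ft B i (\<psi> b') = Some (\<psi> b)"
    if "i \<in> index_set X" "b \<in> elts A" "b' \<in> elts A" for i b b'
    using et[OF that(1,3)] et_closed[OF that(1,3)] ft[OF that(1,3)] ft_closed[OF that(1,3)] inj[OF _ that(2)]
    by (cases "et A i b'"; cases "ft A i b'"; force)+
  note cr = B[unfolded is_crystal_def]
  show ?thesis
    unfolding is_crystal_def
  proof (intro conjI ballI allI impI)
    fix b j assume "b \<in> elts A" "j \<notin> index_set X"
    then show "wt A b j = 0" using cr mem wt[of b] by metis
  next
    fix i b assume i: "i \<in> index_set X" and b: "b \<in> elts A"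
    note cri = bspec[OF bspec[OF conjunct2[OF cr] i] mem[OF b]]
    note simps = wt[OF b] eps[OF i b] phi[OF i b]
    show "phi A i b = eps A i b + Fin (wt A b i)" using cri by (simp add: simps)
    {
      fix b' assume e: "et A i b = Some b'"
      then have b': "b' \<in> elts A" using et_closed i b by blast
      have "et B i (\<psi> b) = Some (\<psi> b')" using e et[OF i b] by simp
      then have "wt B (\<psi> b') = (\<lambda>j. wt B (\<psi> b) j + simple_root X i j) \<and>
          eps B i (\<psi> b') = eps B i (\<psi> b) + Fin (-1) \<and> phi B i (\<psi> b') = phi B i (\<psi> b) + Fin 1"
        using cri by blast
      then show "b' \<in> elts A" "wt A b' = (\<lambda>j. wt A b j + simple_root X i j)"
        "eps A i b' = eps A i b + Fin (-1)" "phi A i b' = phi A i b + Fin 1"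
        using b' by (simp_all add: simps wt eps i phi)
    }
    {
      fix b' assume f: "ft A i b = Some b'"
      then have b': "b' \<in> elts A" using ft_closed i b by blast
      have "ft B i (\<psi> b) = Some (\<psi> b')" using f ft[OF i b] by simp
      then have "wt B (\<psi> b') = (\<lambda>j. wt B (\<psi> b) j - simple_root X i j) \<and>
          eps B i (\<psi> b') = eps B i (\<psi> b) + Fin 1 \<and> phi B i (\<psi> b') = phi B i (\<psi> b) + Fin (-1)"
        using cri by blast
      then show "b' \<in> elts A" "wt A b' = (\<lambda>j. wt A b j - simple_root X i j)"
        "eps A i b' = eps A i b + Fin 1" "phi A i b' = phi A i b + Fin (-1)"
        using b' by (simp_all add: simps wt eps i phi)
    }
    {
      fix b' assume b': "b' \<in> elts A"
      then show "ft A i b = Some b' \<longleftrightarrow> et A i b' = Some b"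
        using cri mem[OF b'] eq[OF i] b by blast
    }
    assume "phi A i b = Minf"
    then have "et B i (\<psi> b) = None" "ft B i (\<psi> b) = None" using cri by (simp_all add: simps)
    then show "et A i b = None" "ft A i b = None" using et[OF i b] ft[OF i b] by auto
  qed
qed

theorem theorem9:
  fixes X :: etype and p :: "nat \<Rightarrow> weight list"
  assumes "\<And>r. r \<in> {1..nrows X} \<Longrightarrow> full_path X r (p r)"
  shows "K_infinity_elts X p \<subseteq> elts (ambient_crystal X p) \<and>
    crystal_isomorphism X (T_infinity X) (K_infinity X p) (tableau_to_K X p)"
proof (intro conjI)
  have p: "\<forall>r\<in>{1..nrows X}. full_path X r (p r)" using assms by blast
  let ?T = "T_infinity X" and ?K = "K_infinity X p" and ?\<psi> = "tableau_to_K X p"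
  have T_simps: "wt ?T = tableau_wt X" "eps ?T = (\<lambda>i T. Fin (tableau_eps X i T))"
      "phi ?T = (\<lambda>i T. Fin (tableau_eps X i T + tableau_wt X T i))" "et ?T = tableau_e X" "ft ?T = tableau_f X"
    by (simp_all add: T_infinity_def)
  show "K_infinity_elts X p \<subseteq> elts (ambient_crystal X p)"
    using K_element_in_ambient[OF p] by (auto simp: K_infinity_elts_def)
  have wt: "wt ?K (?\<psi> T) = wt ?T T" if "T \<in> elts ?T" for T
  proof -
    obtain s where s: "count_family X s" "T = tableau_of X s" using \<open>T \<in> elts ?T\<close> by (auto simp: elts_T_infinity)
    then show ?thesis using wt_tableau_of[OF p s(1)] tableau_to_K_tableau_of[OF p s(1)] by (simp add: T_simps)
  qed
  have eps: "eps ?K i (?\<psi> T) = eps ?T i T" if "i \<in> index_set X" "T \<in> elts ?T" for i T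
  proof -
    obtain s where s: "count_family X s" "T = tableau_of X s" using \<open>T \<in> elts ?T\<close> by (auto simp: elts_T_infinity)
    then show ?thesis
      using tableau_eps_tableau_of[OF p that(1) s(1)] tableau_to_K_tableau_of[OF p s(1)] by (simp add: T_simps)
  qed
  have phi: "phi ?K i (?\<psi> T) = phi ?T i T" if "i \<in> index_set X" "T \<in> elts ?T" for i T
    using phi_K[OF p, of i "?\<psi> T"] wt[OF that(2)] eps[OF that] by (simp add: T_simps)
  have et: "et ?K i (?\<psi> T) = map_option ?\<psi> (et ?T i T) \<and> (\<forall>T'. et ?T i T = Some T' \<longrightarrow> T' \<in> elts ?T)"
    if i: "i \<in> index_set X" and T: "T \<in> elts ?T" for i T
  proof -
    obtain s where s: "count_family X s" "T = tableau_of X s" using T by (auto simp: elts_T_infinity)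
    from p i s(1) show ?thesis
      by (cases rule: et_K_cases) (auto simp: s tableau_to_K_tableau_of[OF p] T_simps elts_T_infinity)
  qed
  have ft: "ft ?K i (?\<psi> T) = map_option ?\<psi> (ft ?T i T) \<and> (\<forall>T'. ft ?T i T = Some T' \<longrightarrow> T' \<in> elts ?T)"
    if i: "i \<in> index_set X" and T: "T \<in> elts ?T" for i T
  proof -
    obtain s where s: "count_family X s" "T = tableau_of X s" using T by (auto simp: elts_T_infinity)
    from p i s(1) show ?thesis
      by (cases rule: ft_K_cases) (auto simp: s tableau_to_K_tableau_of[OF p] T_simps elts_T_infinity)
  qed
  have et_closed: "T' \<in> elts ?T" if "i \<in> index_set X" "T \<in> elts ?T" "et ?T i T = Some T'" for i T T'
    using et[OF that(1,2)] that(3) by blast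
  have ft_closed: "T' \<in> elts ?T" if "i \<in> index_set X" "T \<in> elts ?T" "ft ?T i T = Some T'" for i T T'
    using ft[OF that(1,2)] that(3) by blast
  note K = is_crystal_K_infinity[OF p] and bij = bij_tableau_to_K[OF p]
  have "is_crystal X ?T"
    using is_crystal_pullback[OF K bij wt eps phi et[THEN conjunct1] ft[THEN conjunct1] et_closed ft_closed] .
  then show "crystal_isomorphism X ?T ?K ?\<psi>"
    unfolding crystal_isomorphism_def
    by (intro conjI ballI K bij wt eps phi et[THEN conjunct1] ft[THEN conjunct1])
qed

end
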